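(* Let $\mathfrak{D}$ be an exponential deriver. Then $\mathsf{MTP}^{\mathsf{exp}}_{\mathsf{unary}}(\mathfrak{D})$ is in NP.
   Context: A logic $\mathcal{L}$ has a set $S_{\mathcal{L}}$ of sentences, each with a size $|\alpha|$, and a model-based consequence relation $\models$. A hypergraph is $H=(V,E,\ell)$ with finite $V$, hyperedges $(S,d)$ ($S\subseteq V$, $d\in V$), labelling $\ell:V\to S_{\mathcal{L}}$, and size $|H|=\sum_{(S,d)\in E}(|\ell(d)|+\sum_{v\in S}|\ell(v)|)$. Leaves have no incoming hyperedge; sinks occur in no premise set. A derivation structure over finite $\mathcal{T}$ is a hypergraph whose leaves are labelled by elements of $\mathcal{T}$ and with $\{\ell(s)\mid s\in S\}\models\ell(d)$ for all hyperedges $(S,d)$. A path from $s$ to $t$ is a sequence $d_0,(S_1,d_1),\dots,(S_q,d_q),d_q$ with $d_0=s$, $d_q=t$, $d_{j-1}\in S_j$; a cycle is a path with $q\ge1$, $s=t$. A tree with root $t$ is a hypergraph in which $t$ is a sink and is reachable from every other vertex by exactly one path. A proof for $\mathcal{T}\models\eta$ is an acyclic derivation structure over $\mathcal{T}$ with exactly one sink, labelled $\eta$; a tree proof is a proof that is a tree. A homomorphism is a label-preserving vertex map sending each hyperedge $(S,d)$ to the hyperedge $(h(S),h(d))$. A deriver $\mathfrak{D}$ consists of $C_{\mathcal{L}}\subseteq S_{\mathcal{L}}$ and a map from pairs $(\mathcal{T},\eta)$ to derivation structures $\mathfrak{D}(\mathcal{T},\eta)$ over $\mathcal{T}$ such that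 $\mathcal{T}\models\eta$ iff $\mathfrak{D}(\mathcal{T},\eta)$ contains a proof for $\mathcal{T}\models\eta$; it is exponential if $|\mathfrak{D}(\mathcal{T},\eta)|\le 2^{p(|\mathcal{T}|+|\eta|)}$ for a polynomial $p$. A proof is admissible w.r.t. $\mathfrak{D}(\mathcal{T},\eta)$ if it has a homomorphism into it; $\mathrm{ct}(P)$ is the number of vertices. $\mathsf{MTP}^{\mathsf{exp}}_{\mathsf{unary}}(\mathfrak{D})$ is the problem: given finite $\mathcal{T}$, $\eta\in C_{\mathcal{L}}$ with $\mathcal{T}\models\eta$, and $n\in\mathbb{N}$ in unary, decide whether there is an admissible tree proof $P$ for $\mathcal{T}\models\eta$ with $\mathrm{ct}(P)\le n$. The derivation structure $\mathfrak{D}(\mathcal{T},\eta)$ is accessed only as follows: its vertices are numbered $v_1,\dots,v_m$ (indices of polynomial size in binary), and there are unit-cost oracle functions deciding, for given vertices $v_1,\dots,v_l$, whether $(\{v_1,\dots,v_{l-1}\},v_l)$ is a hyperedge, and, for a vertex $v$ and a sentence $\alpha$, whether $\ell(v)=\alpha$. *)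

theory Defs
  imports "HOL-Computational_Algebra.Polynomial"
begin

section \<open>Logics\<close>

record ('a, 'm) logic =
  sentences :: "'a set"
  sent_size :: "'a \<Rightarrow> nat"
  models :: "'m set"
  satisfies :: "'m \<Rightarrow> 'a \<Rightarrow> bool"

definition entails :: "('a, 'm) logic \<Rightarrow> 'a set \<Rightarrow> 'a \<Rightarrow> bool" where
  "entails L T \<eta> \<longleftrightarrow>
     (\<forall>M\<in>models L. (\<forall>\<alpha>\<in>T. satisfies L M \<alpha>) \<longrightarrow> satisfies L M \<eta>)"

definition theory_size :: "('a, 'm) logic \<Rightarrow> 'a set \<Rightarrow> nat" where
  "theory_size L T = (\<Sum>\<alpha>\<in>T. sent_size L \<alpha>)"


section \<open>Labelled hypergraphs\<close>

record ('v, 'a) hypergraph =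
  verts :: "'v set"
  hedges :: "('v set \<times> 'v) set"
  label :: "'v \<Rightarrow> 'a"

definition is_hypergraph :: "('a, 'm) logic \<Rightarrow> ('v, 'a) hypergraph \<Rightarrow> bool" where
  "is_hypergraph L H \<longleftrightarrow>
     finite (verts H) \<and>
     (\<forall>(S, d)\<in>hedges H. S \<subseteq> verts H \<and> d \<in> verts H) \<and>
     label H ` verts H \<subseteq> sentences L"

definition hypergraph_size :: "('a, 'm) logic \<Rightarrow> ('v, 'a) hypergraph \<Rightarrow> nat" where
  "hypergraph_size L H =
     (\<Sum>(S, d)\<in>hedges H. sent_size L (label H d) + (\<Sum>v\<in>S. sent_size L (label H v)))"

definition is_leaf :: "('v, 'a) hypergraph \<Rightarrow> 'v \<Rightarrow> bool" where
  "is_leaf H v \<longleftrightarrow> v \<in> verts H \<and> (\<forall>(S, d)\<in>hedges H. d \<noteq> v)"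

definition is_sink :: "('v, 'a) hypergraph \<Rightarrow> 'v \<Rightarrow> bool" where
  "is_sink H v \<longleftrightarrow> v \<in> verts H \<and> (\<forall>(S, d)\<in>hedges H. v \<notin> S)"

text \<open>A path is determined by its start vertex and its list of hyperedges.\<close>

fun is_path :: "('v, 'a) hypergraph \<Rightarrow> 'v \<Rightarrow> ('v set \<times> 'v) list \<Rightarrow> 'v \<Rightarrow> bool" where
  "is_path H s [] t \<longleftrightarrow> s \<in> verts H \<and> s = t"
| "is_path H s ((S, d) # es) t \<longleftrightarrow> (S, d) \<in> hedges H \<and> s \<in> S \<and> is_path H d es t"

definition acyclic_hypergraph :: "('v, 'a) hypergraph \<Rightarrow> bool" where
  "acyclic_hypergraph H \<longleftrightarrow> \<not> (\<exists>s es. es \<noteq> [] \<and> is_path H s es s)"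

definition is_tree :: "('v, 'a) hypergraph \<Rightarrow> 'v \<Rightarrow> bool" where
  "is_tree H t \<longleftrightarrow> is_sink H t \<and> (\<forall>s\<in>verts H - {t}. \<exists>!es. is_path H s es t)"

definition subhypergraph :: "('v, 'a) hypergraph \<Rightarrow> ('v, 'a) hypergraph \<Rightarrow> bool" where
  "subhypergraph P H \<longleftrightarrow>
     verts P \<subseteq> verts H \<and> hedges P \<subseteq> hedges H \<and> (\<forall>v\<in>verts P. label P v = label H v)"

definition homomorphism ::
    "('w \<Rightarrow> 'v) \<Rightarrow> ('w, 'a) hypergraph \<Rightarrow> ('v, 'a) hypergraph \<Rightarrow> bool" where
  "homomorphism h P H \<longleftrightarrow>
     (\<forall>v\<in>verts P. h v \<in> verts H \<and> label H (h v) = label P v) \<and>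
     (\<forall>(S, d)\<in>hedges P. (h ` S, h d) \<in> hedges H)"


section \<open>Derivation structures, proofs and derivers\<close>

definition derivation_structure ::
    "('a, 'm) logic \<Rightarrow> 'a set \<Rightarrow> ('v, 'a) hypergraph \<Rightarrow> bool" where
  "derivation_structure L T H \<longleftrightarrow>
     is_hypergraph L H \<and>
     (\<forall>v. is_leaf H v \<longrightarrow> label H v \<in> T) \<and>
     (\<forall>(S, d)\<in>hedges H. entails L (label H ` S) (label H d))"

definition is_proof ::
    "('a, 'm) logic \<Rightarrow> 'a set \<Rightarrow> 'a \<Rightarrow> ('v, 'a) hypergraph \<Rightarrow> bool" where
  "is_proof L T \<eta> P \<longleftrightarrow>
     derivation_structure L T P \<and> acyclic_hypergraph P \<and>
     (\<exists>t. {v. is_sink P v} = {t} \<and> label P t = \<eta>)"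

definition is_tree_proof ::
    "('a, 'm) logic \<Rightarrow> 'a set \<Rightarrow> 'a \<Rightarrow> ('v, 'a) hypergraph \<Rightarrow> bool" where
  "is_tree_proof L T \<eta> P \<longleftrightarrow> is_proof L T \<eta> P \<and> (\<exists>t. is_tree P t)"

record ('v, 'a) deriver =
  conclusions :: "'a set"
  structure_of :: "'a set \<Rightarrow> 'a \<Rightarrow> ('v, 'a) hypergraph"

definition is_theory :: "('a, 'm) logic \<Rightarrow> 'a set \<Rightarrow> bool" where
  "is_theory L T \<longleftrightarrow> finite T \<and> T \<subseteq> sentences L"

definition is_deriver :: "('a, 'm) logic \<Rightarrow> ('v, 'a) deriver \<Rightarrow> bool" where
  "is_deriver L D \<longleftrightarrow>
     conclusions D \<subseteq> sentences L \<and>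
     (\<forall>T \<eta>. is_theory L T \<longrightarrow> \<eta> \<in> conclusions D \<longrightarrow>
        derivation_structure L T (structure_of D T \<eta>) \<and>
        (entails L T \<eta> \<longleftrightarrow>
          (\<exists>P. subhypergraph P (structure_of D T \<eta>) \<and> is_proof L T \<eta> P)))"

definition exponential_deriver :: "('a, 'm) logic \<Rightarrow> ('v, 'a) deriver \<Rightarrow> bool" where
  "exponential_deriver L D \<longleftrightarrow>
     is_deriver L D \<and>
     (\<exists>p :: nat poly. \<forall>T \<eta>. is_theory L T \<longrightarrow> \<eta> \<in> conclusions D \<longrightarrow>
        hypergraph_size L (structure_of D T \<eta>)
          \<le> 2 ^ poly p (theory_size L T + sent_size L \<eta>))"

definition admissible ::
    "('v, 'a) deriver \<Rightarrow> 'a set \<Rightarrow> 'a \<Rightarrow> ('w, 'a) hypergraph \<Rightarrow> bool" where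
  "admissible D T \<eta> P \<longleftrightarrow> (\<exists>h. homomorphism h P (structure_of D T \<eta>))"

definition ct :: "('v, 'a) hypergraph \<Rightarrow> nat" where
  "ct P = card (verts P)"


section \<open>Nondeterministic oracle Turing machines\<close>

text \<open>
  Words are over the alphabet \<open>sym\<close>; tape cells additionally may be blank (\<open>None\<close>).
  A tape is a pair of finite lists: the cells to the left of the head, nearest first, and the cells
  from the head position to the right. All cells outside these lists are blank, so tapes are
  infinite in both directions.
\<close>

datatype sym = Zero | One | Hash

datatype move = MoveL | MoveR | Stay

type_synonym tape = "sym option list \<times> sym option list"

fun first_cell :: "sym option list \<Rightarrow> sym option" where
  "first_cell [] = None"
| "first_cell (c # cs) = c"

definition tape_read :: "tape \<Rightarrow> sym option" where
  "tape_read tp = first_cell (snd tp)"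

fun tape_write :: "sym option \<Rightarrow> tape \<Rightarrow> tape" where
  "tape_write c (l, r) = (l, c # tl r)"

fun tape_move :: "move \<Rightarrow> tape \<Rightarrow> tape" where
  "tape_move MoveL (l, r) = (tl l, first_cell l # r)"
| "tape_move MoveR (l, r) = (first_cell r # l, tl r)"
| "tape_move Stay tp = tp"

definition tape_act :: "sym option \<times> move \<Rightarrow> tape \<Rightarrow> tape" where
  "tape_act a tp = tape_move (snd a) (tape_write (fst a) tp)"

text \<open>The blank-free word that starts at the head position.\<close>

definition tape_word :: "tape \<Rightarrow> sym list" where
  "tape_word tp = map the (takeWhile (\<lambda>c. c \<noteq> None) (snd tp))"

text \<open>
  Tape \<open>0\<close> is the input tape and tape \<open>1\<close> the query tape; every tape is read/write.
  A transition \<open>(q, cs, q', as)\<close> applies in state \<open>q\<close> when the heads scan \<open>cs\<close>.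
  A query \<open>(q, y, n)\<close> takes one step from \<open>q\<close> to \<open>y\<close> or \<open>n\<close>, depending on whether the word on the
  query tape is in the oracle language.
\<close>

record machine =
  ntapes :: nat
  start_state :: nat
  accept_state :: nat
  transitions :: "(nat \<times> sym option list \<times> nat \<times> (sym option \<times> move) list) set"
  queries :: "(nat \<times> nat \<times> nat) set"

definition is_machine :: "machine \<Rightarrow> bool" where
  "is_machine M \<longleftrightarrow>
     2 \<le> ntapes M \<and> finite (transitions M) \<and> finite (queries M) \<and>
     (\<forall>(q, cs, q', as)\<in>transitions M. length cs = ntapes M \<and> length as = ntapes M)"

type_synonym config = "nat \<times> tape list"

inductive step :: "machine \<Rightarrow> sym list set \<Rightarrow> config \<Rightarrow> config \<Rightarrow> bool" for M Or where
  step_transition: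
    "(q, map tape_read tps, q', as) \<in> transitions M \<Longrightarrow>
     step M Or (q, tps) (q', map2 tape_act as tps)"
| step_query:
    "(q, y, n) \<in> queries M \<Longrightarrow>
     step M Or (q, tps) (if tape_word (tps ! 1) \<in> Or then y else n, tps)"

definition initial :: "machine \<Rightarrow> sym list \<Rightarrow> config" where
  "initial M w = (start_state M, ([], map Some w) # replicate (ntapes M - 1) ([], []))"

definition accepts :: "machine \<Rightarrow> sym list set \<Rightarrow> sym list \<Rightarrow> bool" where
  "accepts M Or w \<longleftrightarrow> (\<exists>tps. (step M Or)\<^sup>*\<^sup>* (initial M w) (accept_state M, tps))"

text \<open>All computations, on all inputs and with all oracles, are polynomially bounded.\<close>

definition polynomial_time :: "machine \<Rightarrow> bool" where
  "polynomial_time M \<longleftrightarrow>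
     (\<exists>p :: nat poly. \<forall>Or w k c.
        (step M Or ^^ k) (initial M w) c \<longrightarrow> k \<le> poly p (length w))"

text \<open>
  A promise problem is given by its instances \<open>I\<close> and its yes-instances \<open>Y\<close>. An instance may have
  several representations \<open>codes i\<close> as words, and it comes with its own oracle language.
  No answer is prescribed for words that represent no instance.
\<close>

definition in_NP ::
    "'i set \<Rightarrow> 'i set \<Rightarrow> ('i \<Rightarrow> sym list set) \<Rightarrow> ('i \<Rightarrow> sym list set) \<Rightarrow> bool" where
  "in_NP I Y codes orac \<longleftrightarrow>
     (\<exists>M. is_machine M \<and> polynomial_time M \<and>
        (\<forall>i\<in>I. \<forall>w\<in>codes i. accepts M (orac i) w \<longleftrightarrow> i \<in> Y))"


section \<open>Representation of sentences, instances and derivation structures\<close>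

definition word_of_bits :: "bool list \<Rightarrow> sym list" where
  "word_of_bits bs = map (\<lambda>b. if b then One else Zero) bs"

text \<open>
  Sentences are represented by bit strings whose length agrees with the size of the sentence up to
  a polynomial.
\<close>

definition sentence_coding :: "('a, 'm) logic \<Rightarrow> ('a \<Rightarrow> bool list) \<Rightarrow> bool" where
  "sentence_coding L code \<longleftrightarrow>
     inj_on code (sentences L) \<and>
     (\<exists>p :: nat poly. \<forall>\<alpha>\<in>sentences L.
        length (code \<alpha>) \<le> poly p (sent_size L \<alpha>) \<and>
        sent_size L \<alpha> \<le> poly p (length (code \<alpha>)))"

text \<open>The theory is listed in an arbitrary order, and \<open>n\<close> is written in unary.\<close>

definition instance_codes ::
    "('a \<Rightarrow> bool list) \<Rightarrow> 'a set \<times> 'a \<times> nat \<Rightarrow> sym list set" where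
  "instance_codes code = (\<lambda>(T, \<eta>, n).
     {word_of_bits (code \<eta>) @ [Hash] @ replicate n One @ [Hash] @
        concat (map (\<lambda>\<alpha>. word_of_bits (code \<alpha>) @ [Hash]) ts)
      | ts. distinct ts \<and> set ts = T})"

text \<open>
  \<open>num T \<eta> = [v\<^sub>1, \<dots>, v\<^sub>m]\<close> enumerates the vertices of the derivation structure. The bound
  on \<open>m\<close> says that indices have polynomial size in binary; it does not follow from the bound on the
  size of the hypergraph, which ignores vertices that occur in no hyperedge.
\<close>

definition vertex_numbering ::
    "('a, 'm) logic \<Rightarrow> ('v, 'a) deriver \<Rightarrow> ('a set \<Rightarrow> 'a \<Rightarrow> 'v list) \<Rightarrow> bool" where
  "vertex_numbering L D num \<longleftrightarrow>
     (\<forall>T \<eta>. is_theory L T \<longrightarrow> \<eta> \<in> conclusions D \<longrightarrow>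
        distinct (num T \<eta>) \<and> set (num T \<eta>) = verts (structure_of D T \<eta>)) \<and>
     (\<exists>p :: nat poly. \<forall>T \<eta>. is_theory L T \<longrightarrow> \<eta> \<in> conclusions D \<longrightarrow>
        length (num T \<eta>) \<le> 2 ^ poly p (theory_size L T + sent_size L \<eta>))"

text \<open>Most significant bit first, without leading zeros.\<close>

fun binary :: "nat \<Rightarrow> bool list" where
  "binary n = (if n = 0 then [] else binary (n div 2) @ [odd n])"

declare binary.simps [simp del]

definition index_word :: "nat \<Rightarrow> sym list" where
  "index_word i = word_of_bits (binary i) @ [Hash]"

text \<open>
  The two oracle functions for a derivation structure with vertices \<open>vs = [v\<^sub>1, \<dots>, v\<^sub>m]\<close>, joined
  into one language by a tag symbol. Words that are not well-formed queries about vertices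
  \<open>v\<^sub>i\<close> with \<open>1 \<le> i \<le> m\<close> are answered negatively.
\<close>

definition edge_queries :: "('v, 'a) hypergraph \<Rightarrow> 'v list \<Rightarrow> sym list set" where
  "edge_queries H vs =
     {Zero # concat (map index_word (is @ [j])) | is j.
        set is \<subseteq> {1..length vs} \<and> j \<in> {1..length vs} \<and>
        ((\<lambda>i. vs ! (i - 1)) ` set is, vs ! (j - 1)) \<in> hedges H}"

definition label_queries ::
    "('a, 'm) logic \<Rightarrow> ('a \<Rightarrow> bool list) \<Rightarrow> ('v, 'a) hypergraph \<Rightarrow> 'v list \<Rightarrow> sym list set" where
  "label_queries L code H vs =
     {One # index_word i @ word_of_bits (code \<alpha>) | i \<alpha>.
        i \<in> {1..length vs} \<and> \<alpha> \<in> sentences L \<and> label H (vs ! (i - 1)) = \<alpha>}"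


section \<open>Minimal tree proofs\<close>

definition MTP_instances ::
    "('a, 'm) logic \<Rightarrow> ('v, 'a) deriver \<Rightarrow> ('a set \<times> 'a \<times> nat) set" where
  "MTP_instances L D =
     {(T, \<eta>, n). is_theory L T \<and> \<eta> \<in> conclusions D \<and> entails L T \<eta>}"

text \<open>As vertex sets are finite, it suffices to consider proofs with vertices in \<open>nat\<close>.\<close>

definition MTP_yes ::
    "('a, 'm) logic \<Rightarrow> ('v, 'a) deriver \<Rightarrow> ('a set \<times> 'a \<times> nat) set" where
  "MTP_yes L D =
     {(T, \<eta>, n). \<exists>P :: (nat, 'a) hypergraph.
        is_tree_proof L T \<eta> P \<and> admissible D T \<eta> P \<and> ct P \<le> n}"

definition MTP_oracle ::
    "('a, 'm) logic \<Rightarrow> ('v, 'a) deriver \<Rightarrow> ('a \<Rightarrow> bool list) \<Rightarrow> ('a set \<Rightarrow> 'a \<Rightarrow> 'v list)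
     \<Rightarrow> 'a set \<times> 'a \<times> nat \<Rightarrow> sym list set" where
  "MTP_oracle L D code num = (\<lambda>(T, \<eta>, n).
     edge_queries (structure_of D T \<eta>) (num T \<eta>) \<union>
     label_queries L code (structure_of D T \<eta>) (num T \<eta>))"

end

(*
  A tree proof can be guessed in breadth-first order as a list of vertices of the derivation
  structure, where every vertex comes with the list of its children. The concatenation of these
  lists of children, preceded by the root, must be the list of vertices itself. As the bound n is in
  unary and indices have polynomially many bits, the guess has polynomial length, and each vertex
  costs one oracle query: either its label is in the theory, or it is the conclusion of a hyperedge
  whose premises are its children.

  The machine guesses the queries and copies the vertex and its children to two tapes, which are
  compared at the end; it needs no other access to what it has guessed. It may run forever, so it is
  simulated by a machine that also counts down an odometer with d digits, each of which is the
  position of a head on a tape of the length of the input. This makes every computation polynomially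
  long, whatever the oracle, and d is chosen such that the accepting computations can finish.
*)

theory Submission
  imports Defs "HOL-Library.Countable"
begin

section \<open>Tree proofs in breadth-first order\<close>

text \<open>Breadth-first order needs no pointers: the lists of children of successive vertices are
  consecutive blocks of the vertex list, so the shape of the tree is checked by comparing two words
  symbol by symbol. The equation behind this does not exclude cycles by itself: behind a complete
  tree the list may continue with vertices that are children of each other, and this tail has to be
  cut off. The polynomials that bound indices and codes depend on the logic, the deriver and the
  codings, and no machine can compute them from its input. The guessing machine is therefore one
  fixed machine that guesses words of arbitrary length; these polynomials enter only through the
  number \<open>d\<close> of digits of the clock. A query step changes the state but moves no head,
  so it cannot tick. The time bound thus rests on the fact that no query follows another one
  directly.\<close>

definition parent_graph ::
    "nat \<Rightarrow> (nat \<Rightarrow> nat) \<Rightarrow> nat set \<Rightarrow> (nat \<Rightarrow> 'a) \<Rightarrow> (nat, 'a) hypergraph" where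
  "parent_graph k par E lab =
     \<lparr>verts = {..<k}, hedges = (\<lambda>d. ({c. 0 < c \<and> c < k \<and> par c = d}, d)) ` E, label = lab\<rparr>"

lemma parent_graph_simps [simp]:
  "verts (parent_graph k par E lab) = {..<k}"
  "hedges (parent_graph k par E lab) = (\<lambda>d. ({c. 0 < c \<and> c < k \<and> par c = d}, d)) ` E"
  "label (parent_graph k par E lab) = lab"
  by (simp_all add: parent_graph_def)

text \<open>Parents have smaller numbers than their children, so every path descends towards 0.
  \<open>E\<close> is not determined by \<open>par\<close>: a vertex without children may be a leaf
  or the conclusion of a hyperedge without premises.\<close>

locale parent_tree =
  fixes k :: nat and par :: "nat \<Rightarrow> nat" and E :: "nat set" and lab :: "nat \<Rightarrow> 'a"
  assumes pos: "0 < k"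
    and E_sub: "E \<subseteq> {..<k}"
    and par_less: "\<And>c. 0 < c \<Longrightarrow> c < k \<Longrightarrow> par c < c"
    and par_E: "\<And>c. 0 < c \<Longrightarrow> c < k \<Longrightarrow> par c \<in> E"
begin

abbreviation "P \<equiv> parent_graph k par E lab"

lemma path_decreases: "is_path P s es t \<Longrightarrow> t \<le> s \<and> (es \<noteq> [] \<longrightarrow> t < s)"
proof (induction es arbitrary: s)
  case (Cons e es)
  obtain S d where e: "e = (S, d)" by (cases e)
  with Cons.prems have "(S, d) \<in> hedges P" "s \<in> S" "is_path P d es t" by auto
  then have "d < s" using par_less by auto
  then show ?case using Cons.IH[OF \<open>is_path P d es t\<close>] by auto
qed auto

lemma acyclic: "acyclic_hypergraph P"
  unfolding acyclic_hypergraph_def using path_decreases by blast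

lemma sinks: "{v. is_sink P v} = {0}"
proof (intro set_eqI iffI)
  fix v assume "v \<in> {v. is_sink P v}"
  then have v: "v < k" and ns: "\<And>d. d \<in> E \<Longrightarrow> v \<notin> {c. 0 < c \<and> c < k \<and> par c = d}"
    by (auto simp: is_sink_def)
  show "v \<in> {0}" using ns[of "par v"] par_E[of v] v by auto
qed (use pos in \<open>auto simp: is_sink_def\<close>)

lemma path_exists: "c < k \<Longrightarrow> \<exists>es. is_path P c es 0"
proof (induction c rule: less_induct)
  case (less c)
  show ?case
  proof (cases "c = 0")
    case True
    then have "is_path P c [] 0" using pos by simp
    then show ?thesis by blast
  next
    case False
    then have "par c < c" using par_less less.prems by auto
    then obtain es where "is_path P (par c) es 0" using less by force
    then have "is_path P c (({c'. 0 < c' \<and> c' < k \<and> par c' = par c}, par c) # es) 0"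
      using False less.prems par_E[of c] by auto
    then show ?thesis by blast
  qed
qed

text \<open>A vertex other than the root is a premise of one hyperedge only, the one into
  \<open>par c\<close>, so a path has no choice at any step.\<close>

lemma path_unique: "is_path P c es 0 \<Longrightarrow> is_path P c es' 0 \<Longrightarrow> es = es'"
proof (induction es arbitrary: c es')
  case Nil
  then have "c = 0" by simp
  then show ?case using path_decreases[OF Nil.prems(2)] by auto
next
  case (Cons e es)
  obtain S d where e: "e = (S, d)" by (cases e)
  with Cons.prems(1) have 1: "(S, d) \<in> hedges P" "c \<in> S" "is_path P d es 0" by auto
  then have d: "d = par c" "S = {c'. 0 < c' \<and> c' < k \<and> par c' = d}" "0 < c" by auto
  obtain e' es'' where es': "es' = e' # es''" using Cons.prems(2) d(3) by (cases es') auto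
  obtain S' d' where e': "e' = (S', d')" by (cases e')
  with Cons.prems(2) es' have 2: "(S', d') \<in> hedges P" "c \<in> S'" "is_path P d' es'' 0" by auto
  then have "d' = par c" "S' = {c'. 0 < c' \<and> c' < k \<and> par c' = d'}" by auto
  with d have "e = e'" using e e' by simp
  moreover have "es = es''" using Cons.IH 1 2 d \<open>d' = par c\<close> by auto
  ultimately show ?case using es' by simp
qed

lemma tree: "is_tree P 0"
  unfolding is_tree_def
proof (intro conjI ballI)
  show "is_sink P 0" using sinks by blast
  fix s assume "s \<in> verts P - {0}"
  then have "s < k" by simp
  then show "\<exists>!es. is_path P s es 0" using path_exists path_unique by (intro ex_ex1I)
qed

end

text \<open>
  \<open>as\<close> lists the vertices of a tree proof in breadth-first order, as vertices of \<open>G\<close>, and \<open>Ds\<close> lists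
  for each of them its children. The equation in the first conjunct says that every vertex except
  the root is a child exactly once.
\<close>

definition bfs_proof ::
    "('v, 'a) hypergraph \<Rightarrow> 'a set \<Rightarrow> 'a \<Rightarrow> 'v list \<Rightarrow> 'v list list \<Rightarrow> bool" where
  "bfs_proof G T \<eta> as Ds \<longleftrightarrow>
     (\<exists>r. as = r # concat Ds \<and> label G r = \<eta>) \<and> set as \<subseteq> verts G \<and>
     list_all2 (\<lambda>v C. C = [] \<and> label G v \<in> T \<or> (set C, v) \<in> hedges G) as Ds"

text \<open>The vertices of the tree are positions in \<open>as\<close>, and \<open>(!) as\<close>
  is the homomorphism, so a vertex of \<open>G\<close> may be used several times. The list is read
  as a queue to which processing position \<open>d\<close> appends the block \<open>Ds ! d\<close>.
  With \<open>as = [r, a]\<close> and \<open>Ds = [[], [a]]\<close> the list equation holds although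
  \<open>a\<close> is its own child; stopping at the empty queue removes such tails and only makes
  the proof smaller.\<close>

lemma tree_proof_of_bfs_proof:
  fixes G :: "('v, 'a) hypergraph"
  assumes G: "derivation_structure L T G" and bfs: "bfs_proof G T \<eta> as Ds"
  shows "\<exists>(P :: (nat, 'a) hypergraph) h.
    is_tree_proof L T \<eta> P \<and> homomorphism h P G \<and> ct P \<le> length as"
proof -
  obtain r where r: "as = r # concat Ds" "label G r = \<eta>" and vs: "set as \<subseteq> verts G"
    and nodes: "list_all2 (\<lambda>v C. C = [] \<and> label G v \<in> T \<or> (set C, v) \<in> hedges G) as Ds"
    using bfs unfolding bfs_proof_def by blast
  have len: "length Ds = length as" using nodes by (simp add: list_all2_lengthD)
  \<comment> \<open>\<open>m j\<close> positions have been enqueued when \<open>j\<close> are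
    processed; the 1 is the root. The children of \<open>j\<close> occupy the positions from
    \<open>m j\<close> up to \<open>m (Suc j) - 1\<close>.\<close>
  define m where "m j = Suc (length (concat (take j Ds)))" for j
  have m_Suc: "m (Suc j) = m j + length (Ds ! j)" if "j < length Ds" for j
    using that by (simp add: m_def take_Suc_conv_app_nth)
  have m_mono: "m i \<le> m j" if "i \<le> j" for i j
    using that by (auto simp: m_def le_iff_add take_add)
  have m_end: "m (length as) = length as"
    using r(1) len by (simp add: m_def)
  \<comment> \<open>The queue may run empty before the end of \<open>as\<close>; the tree consists of the vertices up to there.\<close>
  define k where "k = (LEAST j. m j \<le> j)"
  have mk: "m k \<le> k" unfolding k_def by (rule LeastI[of _ "length as"]) (simp add: m_end)
  have k_le: "k \<le> length as" unfolding k_def by (rule Least_le) (use m_end in auto)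
  have m_gt: "i < m i" if "i < k" for i
    using that not_less_Least[of i "\<lambda>j. m j \<le> j"] unfolding k_def by auto
  have k_pos: "0 < k" using mk by (cases k) (auto simp: m_def)
  have mk_eq: "m k = k"
    using m_gt[of "k - 1"] m_mono[of "k - 1" k] mk k_pos by linarith
  have child: "as ! (m d + t) = Ds ! d ! t" if "d < length Ds" "t < length (Ds ! d)" for d t
  proof -
    have "concat Ds = concat (take d Ds) @ Ds ! d @ concat (drop (Suc d) Ds)"
      using that(1) by (metis concat.simps(2) concat_append id_take_nth_drop)
    then show ?thesis using r(1) that(2) by (simp add: m_def nth_append)
  qed
  \<comment> \<open>The vertex whose block of children contains position \<open>c\<close>.\<close>
  define par where "par c = (LEAST i. c < m (Suc i))" for c
  have par_iff: "par c = d \<longleftrightarrow> m d \<le> c \<and> c < m (Suc d)" if "0 < c" "c < k" for c d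
  proof -
    have "c < m (Suc (k - 1))" using that mk_eq k_pos by simp
    then have 1: "c < m (Suc (par c))" unfolding par_def by (rule LeastI)
    have 2: "m (par c) \<le> c"
    proof (cases "par c")
      case (Suc i)
      then have "\<not> c < m (Suc i)"
        using not_less_Least[of i "\<lambda>i. c < m (Suc i)"] unfolding par_def by auto
      then show ?thesis using Suc by simp
    qed (use that in \<open>simp add: m_def\<close>)
    show ?thesis
    proof
      assume "m d \<le> c \<and> c < m (Suc d)"
      then show "par c = d"
        using 1 2 m_mono[of "Suc d" "par c"] m_mono[of "Suc (par c)" d] by linarith
    qed (use 1 2 in auto)
  qed
  have par_k: "par c < k" if "0 < c" "c < k" for c
    using par_iff[OF that, of "par c"] m_mono[of k "par c"] mk_eq that by linarith
  define E where "E = {d. d < k \<and> (set (Ds ! d), as ! d) \<in> hedges G}"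
  have node: "Ds ! d = [] \<and> label G (as ! d) \<in> T" if "d < k" "d \<notin> E" for d
    using that k_le len list_all2_nthD[OF nodes, of d] unfolding E_def by auto
  define P where "P = parent_graph k par E (\<lambda>c. label G (as ! c))"
  interpret parent_tree k par E "\<lambda>c. label G (as ! c)"
  proof
    fix c assume c: "0 < c" "c < k"
    \<comment> \<open>The queue is not yet empty at \<open>par c\<close>, so
      \<open>par c < m (par c)\<close>, and its block of children begins at
      \<open>m (par c) \<le> c\<close>.\<close>
    show "par c < c" using par_iff[OF c, of "par c"] m_gt[OF par_k[OF c]] by simp
    show "par c \<in> E"
    proof (rule ccontr)
      assume "par c \<notin> E"
      then have "Ds ! par c = []" using node par_k[OF c] by simp
      moreover have "par c < length Ds" using par_k[OF c] k_le len by linarith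
      ultimately have "m (Suc (par c)) = m (par c)" using m_Suc by simp
      moreover have "m (par c) \<le> c" "c < m (Suc (par c))" using par_iff[OF c, of "par c"] by simp_all
      ultimately show False by linarith
    qed
  qed (use k_pos in \<open>auto simp: E_def\<close>)
  have children: "(!) as ` {c. 0 < c \<and> c < k \<and> par c = d} = set (Ds ! d)" if "d < k" for d
  proof -
    have d: "d < length Ds" using that k_le len by simp
    have "{c. 0 < c \<and> c < k \<and> par c = d} = {m d..<m (Suc d)}"
    proof -
      have "m (Suc d) \<le> k" "0 < m d" using m_mono[of "Suc d" k] mk_eq that by (auto simp: m_def)
      have "c \<in> {c. 0 < c \<and> c < k \<and> par c = d} \<longleftrightarrow> c \<in> {m d..<m (Suc d)}" for c
      proof (cases "0 < c \<and> c < k")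
        case True
        then show ?thesis using par_iff[of c d] by simp
      next
        case False
        then show ?thesis using \<open>m (Suc d) \<le> k\<close> \<open>0 < m d\<close> by auto
      qed
      then show ?thesis by blast
    qed
    also have "\<dots> = (+) (m d) ` {..<length (Ds ! d)}"
      using m_Suc[OF d] by (simp add: lessThan_atLeast0 add.commute)
    also have "(!) as ` \<dots> = (!) (Ds ! d) ` {..<length (Ds ! d)}"
      using child[OF d] by (auto simp: image_image)
    finally show ?thesis by (auto simp: set_conv_nth)
  qed
  have hedge: "((!) as ` S, as ! d) \<in> hedges G" if "(S, d) \<in> hedges P" for S d
    using that children by (auto simp: P_def E_def)
  have wf: "is_hypergraph L G" using G by (simp add: derivation_structure_def)
  have as_in: "as ! c \<in> verts G" if "c < k" for c
    using vs that k_le by (auto simp: subset_iff)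
  have "homomorphism ((!) as) P G"
    unfolding homomorphism_def using as_in hedge by (auto simp: P_def)
  moreover have "derivation_structure L T P"
    unfolding derivation_structure_def
  proof (intro conjI allI impI ballI)
    show "is_hypergraph L P"
      using wf as_in E_sub by (auto simp: is_hypergraph_def P_def)
  next
    fix v assume "is_leaf P v"
    then have "v < k" "v \<notin> E" by (auto simp: is_leaf_def P_def)
    then show "label P v \<in> T" using node by (simp add: P_def)
  next
    fix e assume e: "e \<in> hedges P"
    obtain S d where e': "e = (S, d)" by (cases e)
    with e have "entails L (label G ` ((!) as ` S)) (label G (as ! d))"
      using hedge G unfolding derivation_structure_def by blast
    then show "case e of (S, d) \<Rightarrow> entails L (label P ` S) (label P d)"
      by (simp add: e' P_def image_image)
  qed
  moreover have "label P 0 = \<eta>" using r by (simp add: P_def)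
  ultimately have "is_proof L T \<eta> P"
    using acyclic sinks unfolding is_proof_def P_def by blast
  then have "is_tree_proof L T \<eta> P"
    using tree unfolding is_tree_proof_def P_def by blast
  moreover have "ct P \<le> length as" using k_le by (simp add: ct_def P_def)
  ultimately show ?thesis using \<open>homomorphism ((!) as) P G\<close> by blast
qed

section \<open>From tree proofs to breadth-first lists\<close>

lemma is_path_start:
  assumes "\<And>S d. (S, d) \<in> hedges H \<Longrightarrow> S \<subseteq> verts H \<and> d \<in> verts H" and "is_path H s es t"
  shows "s \<in> verts H"
proof (cases es)
  case (Cons e es')
  then have "(fst e, snd e) \<in> hedges H" "s \<in> fst e" using assms(2) by (cases e; simp)+
  then show ?thesis using assms(1) by blast
qed (use assms(2) in auto)

lemma is_path_append:
  "is_path H s (es @ es') t \<longleftrightarrow> (\<exists>u. is_path H s es u \<and> is_path H u es' t)"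
  if "\<And>S d. (S, d) \<in> hedges H \<Longrightarrow> S \<subseteq> verts H \<and> d \<in> verts H"
proof (induction es arbitrary: s)
  case Nil
  have "s \<in> verts H" if "is_path H s es' t"
    using is_path_start that \<open>\<And>S d. (S, d) \<in> hedges H \<Longrightarrow> S \<subseteq> verts H \<and> d \<in> verts H\<close>
    by metis
  then show ?case by auto
qed auto

text \<open>\<open>f i\<close> is the vertex reached after \<open>i\<close> hyperedges, and a
  repetition among these \<open>length es + 1\<close> vertices would be a cycle. This bounds the
  depth of a proof.\<close>

lemma acyclic_path_length:
  assumes wf: "\<And>S d. (S, d) \<in> hedges H \<Longrightarrow> S \<subseteq> verts H \<and> d \<in> verts H"
    and fin: "finite (verts H)" and acyc: "acyclic_hypergraph H" and path: "is_path H s es t"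
  shows "length es < card (verts H)"
proof -
  have path_take: "\<exists>u. is_path H s (take i es) u \<and> is_path H u (drop i es) t" for i
    using path is_path_append[OF wf, of s "take i es" "drop i es" t] by simp
  define f where "f i = (SOME u. is_path H s (take i es) u \<and> is_path H u (drop i es) t)" for i
  have f: "is_path H s (take i es) (f i)" "is_path H (f i) (drop i es) t" for i
    using someI_ex[OF path_take[of i]] unfolding f_def by auto
  have det: "is_path H a es u \<Longrightarrow> is_path H a es v \<Longrightarrow> u = v" for a es u v
    by (induction es arbitrary: a) auto
  have "inj_on f {..length es}"
  proof (rule linorder_inj_onI)
    fix i j assume ij: "i < j" "i \<in> {..length es}" "j \<in> {..length es}"
    have "take j es = take i es @ take (j - i) (drop i es)"
      using take_add[of i "j - i" es] ij by simp
    then obtain u where "is_path H s (take i es) u" "is_path H u (take (j - i) (drop i es)) (f j)"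
      using f(1)[of j] is_path_append[OF wf] by metis
    then have "is_path H (f i) (take (j - i) (drop i es)) (f j)"
      using det f(1)[of i] by blast
    moreover have "take (j - i) (drop i es) \<noteq> []" using ij by auto
    ultimately show "f i \<noteq> f j" using acyc unfolding acyclic_hypergraph_def by metis
  qed auto
  moreover have "f ` {..length es} \<subseteq> verts H"
  proof safe
    fix i show "f i \<in> verts H" using is_path_start[OF wf f(2)] .
  qed
  ultimately have "card {..length es} \<le> card (verts H)" using fin card_inj_on_le by blast
  then show ?thesis by simp
qed

lemma distinct_concat_map:
  assumes "distinct xs" "\<And>x. x \<in> set xs \<Longrightarrow> distinct (f x)"
    and "\<And>x y v. x \<in> set xs \<Longrightarrow> y \<in> set xs \<Longrightarrow> v \<in> set (f x) \<Longrightarrow> v \<in> set (f y) \<Longrightarrow> x = y"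
  shows "distinct (concat (map f xs))"
  using assms
proof (induction xs)
  case (Cons x xs)
  have "distinct (concat (map f xs))" using Cons.prems by (intro Cons.IH) auto
  moreover have "set (f x) \<inter> (\<Union>y\<in>set xs. set (f y)) = {}" using Cons.prems by fastforce
  ultimately show ?case using Cons.prems by simp
qed simp

primrec level :: "('v \<Rightarrow> 'v list) \<Rightarrow> 'v \<Rightarrow> nat \<Rightarrow> 'v list" where
  "level ch t 0 = [t]"
| "level ch t (Suc i) = concat (map ch (level ch t i))"

text \<open>Once level \<open>n\<close> is empty, this becomes the equation between the vertex list
  and the lists of children that \<open>bfs_proof\<close> asks for.\<close>

lemma concat_levels:
  "t # concat (map ch (concat (map (level ch t) [0..<n]))) = concat (map (level ch t) [0..<n]) @ level ch t n"
  by (induction n) auto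

text \<open>The list consists of the levels of the tree. Uniqueness of paths makes the levels
  disjoint and free of repetitions, so the list is not longer than the number of vertices.\<close>

lemma bfs_proof_of_tree_proof:
  fixes G :: "('v, 'a) hypergraph" and P :: "('w, 'a) hypergraph"
  assumes P: "is_tree_proof L T \<eta> P" and h: "homomorphism h P G"
  shows "\<exists>as Ds. bfs_proof G T \<eta> as Ds \<and> length as \<le> ct P"
proof -
  from P have D: "derivation_structure L T P" and acyc: "acyclic_hypergraph P"
    by (auto simp: is_tree_proof_def is_proof_def)
  obtain t where t: "{v. is_sink P v} = {t}" "label P t = \<eta>"
    using P by (auto simp: is_tree_proof_def is_proof_def)
  obtain t' where "is_tree P t'" using P by (auto simp: is_tree_proof_def)
  moreover from this have "t' = t" using t(1) by (auto simp: is_tree_def)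
  ultimately have "is_tree P t" by simp
  have wf: "\<And>S d. (S, d) \<in> hedges P \<Longrightarrow> S \<subseteq> verts P \<and> d \<in> verts P" and fin: "finite (verts P)"
    using D by (auto simp: derivation_structure_def is_hypergraph_def)
  have start: "s \<in> verts P" if "is_path P s es u" for s es u
    using is_path_start[OF wf that] .
  have uniq: "es = es'" if "is_path P s es t" "is_path P s es' t" "s \<noteq> t" for s es es'
  proof -
    have "\<exists>!es. is_path P s es t"
      using \<open>is_tree P t\<close> start that unfolding is_tree_def by blast
    then show ?thesis using that by blast
  qed
  \<comment> \<open>\<open>is_tree\<close> does not speak about paths from the root to itself; a
    nonempty one would be a cycle.\<close>
  have path_unique: "es = es'" if "is_path P s es t" "is_path P s es' t" for s es es'
    using that uniq acyc unfolding acyclic_hypergraph_def by metis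
  have tv: "t \<in> verts P" using t(1) by (auto simp: is_sink_def)
  have ch_ex: "\<exists>C. distinct C \<and> (C = [] \<and> label P d \<in> T \<or> (set C, d) \<in> hedges P)"
    if d: "d \<in> verts P" for d
  proof (cases "is_leaf P d")
    case True
    then have "label P d \<in> T" using D by (auto simp: derivation_structure_def)
    then show ?thesis by (intro exI[of _ "[]"]) auto
  next
    case False
    then obtain S where S: "(S, d) \<in> hedges P" using d by (auto simp: is_leaf_def)
    then have "finite S" using wf fin finite_subset by blast
    then show ?thesis using S finite_distinct_list by metis
  qed
  \<comment> \<open>Several hyperedges with disjoint premise sets may lead into \<open>d\<close>,
    even in a tree. Choosing one of them drops the vertices that belong to the others, so the
    resulting list can be shorter than \<open>ct P\<close>.\<close>
  define ch where
    "ch d = (SOME C. distinct C \<and> (C = [] \<and> label P d \<in> T \<or> (set C, d) \<in> hedges P))" for d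
  have ch: "distinct (ch d)" "ch d = [] \<and> label P d \<in> T \<or> (set (ch d), d) \<in> hedges P"
    if "d \<in> verts P" for d
    using someI_ex[OF ch_ex[OF that]] unfolding ch_def by auto
  have ch_edge: "(set (ch d), d) \<in> hedges P" if "d \<in> verts P" "v \<in> set (ch d)" for d v
    using ch[OF that(1)] that(2) by auto
  let ?lv = "level ch t"
  have lv_path: "v \<in> set (?lv i) \<Longrightarrow> v \<in> verts P \<and> (\<exists>es. length es = i \<and> is_path P v es t)" for v i
  proof (induction i arbitrary: v)
    case (Suc i)
    then obtain u where u: "u \<in> set (?lv i)" "v \<in> set (ch u)" by auto
    then obtain es where es: "length es = i" "is_path P u es t" and uv: "u \<in> verts P"
      using Suc.IH by blast
    have e: "(set (ch u), u) \<in> hedges P" using ch_edge[OF uv u(2)] .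
    then have "length ((set (ch u), u) # es) = Suc i \<and> is_path P v ((set (ch u), u) # es) t"
      using es u by simp
    moreover have "v \<in> verts P" using wf e u by blast
    ultimately show ?case by blast
  qed (use tv in \<open>auto intro: exI[of _ "[]"]\<close>)
  have lv_disj: "i = j" if "v \<in> set (?lv i)" "v \<in> set (?lv j)" for v i j
    using that lv_path path_unique by metis
  have ch_disj: "u = u'" if u: "u \<in> set (?lv i)" "u' \<in> set (?lv i)" and v: "v \<in> set (ch u)" "v \<in> set (ch u')"
    for u u' v i
  proof -
    obtain es es' where p: "is_path P u es t" "is_path P u' es' t" "u \<in> verts P" "u' \<in> verts P"
      using lv_path[OF u(1)] lv_path[OF u(2)] by metis
    have "is_path P v ((set (ch u), u) # es) t" "is_path P v ((set (ch u'), u') # es') t"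
      using p ch_edge v by auto
    then show ?thesis using path_unique by blast
  qed
  have lv_dist: "distinct (?lv i)" for i
  proof (induction i)
    case (Suc i)
    have "v \<in> verts P" if "v \<in> set (?lv i)" for v using that lv_path by blast
    then show ?case using Suc ch(1) ch_disj
      by (auto intro!: distinct_concat_map)
  qed simp
  obtain n where n: "?lv n = []" "n > 0"
  proof
    \<comment> \<open>A vertex at this depth would have a path longer than acyclicity
      permits.\<close>
    show "?lv (card (verts P)) = []"
      using lv_path acyclic_path_length[OF wf fin acyc] by (metis less_irrefl list.set_intros(1) neq_Nil_conv)
    show "card (verts P) > 0" using tv fin card_gt_0_iff by blast
  qed
  define xs where "xs = concat (map ?lv [0..<n])"
  have xs: "xs = t # concat (map ch xs)"
    using concat_levels[of t ch n] n unfolding xs_def by simp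
  have "set xs \<subseteq> verts P" unfolding xs_def using lv_path by auto
  have "distinct xs"
    unfolding xs_def using lv_dist lv_disj by (intro distinct_concat_map) auto
  then have "length xs \<le> ct P"
    unfolding ct_def using \<open>set xs \<subseteq> verts P\<close> fin by (metis card_mono distinct_card)
  have hv: "h v \<in> verts G" "label G (h v) = label P v" if "v \<in> verts P" for v
    using h that by (auto simp: homomorphism_def)
  have he: "(h ` S, h d) \<in> hedges G" if "(S, d) \<in> hedges P" for S d
    using h that by (auto simp: homomorphism_def)
  have node: "map h (ch v) = [] \<and> label G (h v) \<in> T \<or> (set (map h (ch v)), h v) \<in> hedges G"
    if "v \<in> set xs" for v
  proof -
    have v: "v \<in> verts P" using that \<open>set xs \<subseteq> verts P\<close> by blast
    show ?thesis using ch(2)[OF v] he[of "set (ch v)" v] hv[OF v] by auto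
  qed
  have "bfs_proof G T \<eta> (map h xs) (map (\<lambda>v. map h (ch v)) xs)"
    unfolding bfs_proof_def
  proof (intro conjI exI)
    show "map h xs = h t # concat (map (\<lambda>v. map h (ch v)) xs)"
      by (subst xs) (simp add: map_concat comp_def)
    show "label G (h t) = \<eta>" using hv tv t(2) by simp
    show "set (map h xs) \<subseteq> verts G" using hv \<open>set xs \<subseteq> verts P\<close> by auto
    show "list_all2 (\<lambda>v C. C = [] \<and> label G v \<in> T \<or> (set C, v) \<in> hedges G) (map h xs)
        (map (\<lambda>v. map h (ch v)) xs)"
      using node by (auto simp: list_all2_conv_all_nth)
  qed
  then show ?thesis using \<open>length xs \<le> ct P\<close> by (metis length_map)
qed


section \<open>Clocked machines\<close>

text \<open>A tape has many representations, because moving the head leaves explicit blanks at the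
  ends of the lists. The clock is therefore specified through the contents of cells.\<close>

definition cell :: "sym option list \<Rightarrow> nat \<Rightarrow> sym option" where
  "cell cs i = (if i < length cs then cs ! i else None)"

text \<open>Negative positions are to the left of the head.\<close>

definition view :: "tape \<Rightarrow> int \<Rightarrow> sym option" where
  "view tp i = (if 0 \<le> i then cell (snd tp) (nat i) else cell (fst tp) (nat (- i - 1)))"

lemma cell_Cons: "cell (c # cs) i = (if i = 0 then c else cell cs (i - 1))"
  by (cases i) (auto simp: cell_def)

lemma cell_tl: "cell (tl cs) i = cell cs (Suc i)"
  by (cases cs) (auto simp: cell_def)

lemma first_cell_eq: "first_cell cs = cell cs 0"
  by (cases cs) (auto simp: cell_def)

lemma tape_read_view: "tape_read tp = view tp 0"
  by (simp add: tape_read_def view_def first_cell_eq)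

lemma view_write: "view (tape_write c tp) i = (if i = 0 then c else view tp i)"
  by (cases tp) (auto simp: view_def cell_Cons cell_tl)

lemma view_left: "view (tape_move MoveL tp) i = view tp (i - 1)"
proof (cases tp)
  case (Pair l r)
  consider "i < 0" | "i = 0" | "0 < i" by linarith
  then show ?thesis
  proof cases
    case 1
    then have "Suc (nat (- i - 1)) = nat (- (i - 1) - 1)" by simp
    then show ?thesis using 1 by (simp add: Pair view_def cell_tl)
  next
    case 2
    then show ?thesis by (simp add: Pair view_def cell_Cons first_cell_eq)
  next
    case 3
    then have "nat i - 1 = nat (i - 1)" by simp
    then show ?thesis using 3 by (simp add: Pair view_def cell_Cons)
  qed
qed

lemma view_right: "view (tape_move MoveR tp) i = view tp (i + 1)"
proof (cases tp)
  case (Pair l r)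
  consider "i < -1" | "i = -1" | "0 \<le> i" by linarith
  then show ?thesis
  proof cases
    case 1
    then have "nat (- i - 1) - 1 = nat (- (i + 1) - 1)" by simp
    then show ?thesis using 1 by (simp add: Pair view_def cell_Cons)
  next
    case 2
    then show ?thesis by (simp add: Pair view_def cell_Cons first_cell_eq)
  next
    case 3
    then have "Suc (nat i) = nat (i + 1)" by simp
    then show ?thesis using 3 by (simp add: Pair view_def cell_tl)
  qed
qed

lemma view_act_left: "view (tape_act (view tp 0, MoveL) tp) i = view tp (i - 1)"
  by (simp add: tape_act_def view_left view_write)

lemma view_act_right: "view (tape_act (view tp 0, MoveR) tp) i = view tp (i + 1)"
  by (simp add: tape_act_def view_right view_write)

lemma view_act_stay: "view (tape_act (view tp 0, Stay) tp) i = view tp i"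
  by (simp add: tape_act_def view_write)

section \<open>The odometer\<close>

text \<open>
  The clock is an odometer whose digits are the head positions on tapes that contain \<open>1\<^sup>N\<close>.
  Resetting a digit would take many steps; instead, a head that reaches an end of the word turns
  around, so that every tick is a single step. The directions (\<open>True\<close> is to the right) are kept
  in the state. The value of a digit is the number of moves left in the current direction.
\<close>

definition dir :: "bool \<Rightarrow> move" where
  "dir b = (if b then MoveR else MoveL)"

text \<open>\<open>p\<close> is the position of the head when the word occupies the positions 1 to
  \<open>N\<close>. The digit is 0 when the head has arrived at the blank behind the end it moves
  towards, so a zero is recognized by reading a blank. The possible values are 0 to
  \<open>N\<close>, which makes the base \<open>N + 1\<close>.\<close>

definition digit :: "nat \<Rightarrow> bool \<Rightarrow> nat \<Rightarrow> tape \<Rightarrow> bool" where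
  "digit N b r tp \<longleftrightarrow> r \<le> N \<and>
     (let p = (if b then int N + 1 - int r else int r) in
      \<forall>i. view tp i = (if 1 \<le> i + p \<and> i + p \<le> int N then Some One else None))"

text \<open>Decrement with borrow, least significant digit first. A head on a blank turns around and
  steps back into the word, which takes its digit from 0 to \<open>N\<close> in one move, and the
  borrow passes to the next digit. If all heads scan blanks, the result is \<open>None\<close> and
  no simulated transition applies.\<close>

fun tick :: "bool list \<Rightarrow> sym option list \<Rightarrow> (bool list \<times> (sym option \<times> move) list) option" where
  "tick (b # bs) (c # cs) =
     (if c \<noteq> None then Some (b # bs, (c, dir b) # map (\<lambda>c. (c, Stay)) cs)
      else map_option (\<lambda>(bs', as). ((\<not> b) # bs', (c, dir (\<not> b)) # as)) (tick bs cs))"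
| "tick _ _ = None"

lemma tick_length:
  "tick bs cs = Some (bs', as) \<Longrightarrow> length cs = length bs \<Longrightarrow>
    length bs' = length bs \<and> length as = length bs"
  by (induction bs cs arbitrary: bs' as rule: tick.induct) (auto split: if_splits)

text \<open>The summand \<open>v + N * v\<close> is \<open>Suc N * v\<close>: this is positional
  notation in base \<open>N + 1\<close>.\<close>

inductive clock :: "nat \<Rightarrow> bool list \<Rightarrow> tape list \<Rightarrow> nat \<Rightarrow> bool" for N where
  clock_Nil: "clock N [] [] 0"
| clock_Cons: "digit N b r tp \<Longrightarrow> clock N bs tps v \<Longrightarrow> clock N (b # bs) (tp # tps) (r + (v + N * v))"

lemma digit_read: "digit N b r tp \<Longrightarrow> tape_read tp = (if 0 < r then Some One else None)"
  by (auto simp: digit_def tape_read_view Let_def)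

lemma digit_stay: "digit N b r tp \<Longrightarrow> digit N b r (tape_act (tape_read tp, Stay) tp)"
  by (simp add: digit_def tape_read_view view_act_stay)

lemma view_act_dir:
  "view (tape_act (tape_read tp, dir b) tp) i = view tp (if b then i + 1 else i - 1)"
  by (simp add: dir_def tape_read_view view_act_left view_act_right)

lemma digit_move:
  "digit N b (Suc r) tp \<Longrightarrow> digit N b r (tape_act (tape_read tp, dir b) tp)"
  unfolding digit_def view_act_dir by (auto simp: Let_def)

lemma digit_turn:
  "digit N b 0 tp \<Longrightarrow> digit N (\<not> b) N (tape_act (tape_read tp, dir (\<not> b)) tp)"
  unfolding digit_def view_act_dir by (auto simp: Let_def)

lemma clock_stay:
  "clock N bs tps v \<Longrightarrow> clock N bs (map2 tape_act (map (\<lambda>c. (c, Stay)) (map tape_read tps)) tps) v"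
  by (induction rule: clock.induct) (auto intro: clock.intros digit_stay)

lemma clock_length: "clock N bs tps v \<Longrightarrow> length tps = length bs"
  by (induction rule: clock.induct) auto

lemma clock_tick:
  assumes "clock N bs tps v"
  shows "if v = 0 then tick bs (map tape_read tps) = None
    else \<exists>bs' as. tick bs (map tape_read tps) = Some (bs', as) \<and> clock N bs' (map2 tape_act as tps) (v - 1)"
  using assms
proof (induction rule: clock.induct)
  case (clock_Cons b r tp bs tps v)
  show ?case
  proof (cases r)
    case (Suc r')
    have "clock N (b # bs) (map2 tape_act ((tape_read tp, dir b) # map (\<lambda>c. (c, Stay)) (map tape_read tps))
        (tp # tps)) (r' + (v + N * v))"
      using clock_Cons Suc by (auto intro!: clock.clock_Cons digit_move clock_stay[simplified])
    then show ?thesis using Suc digit_read[OF clock_Cons.hyps(1)] by simp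
  next
    case 0
    have none: "tape_read tp = None" using 0 digit_read[OF clock_Cons.hyps(1)] by simp
    show ?thesis
    proof (cases "v = 0")
      case False
      then obtain bs' as where t: "tick bs (map tape_read tps) = Some (bs', as)"
        "clock N bs' (map2 tape_act as tps) (v - 1)" using clock_Cons.IH by auto
      have "clock N ((\<not> b) # bs') (map2 tape_act ((tape_read tp, dir (\<not> b)) # as) (tp # tps))
          (N + ((v - 1) + N * (v - 1)))"
        using clock_Cons.hyps(1) 0 t(2) by (auto intro!: clock.clock_Cons digit_turn)
      moreover have "N + ((v - 1) + N * (v - 1)) = r + (v + N * v) - 1"
        using 0 False by (cases v) auto
      ultimately show ?thesis using t(1) none False by simp
    qed (use clock_Cons.IH none 0 in simp)
  qed
qed simp

lemma clock_full:
  assumes "digit N b N tp"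
  shows "clock N (replicate d b) (replicate d tp) (Suc N ^ d - 1)"
proof (induction d)
  case (Suc d)
  obtain x where x: "Suc N ^ d = Suc x" by (metis gr0_conv_Suc zero_less_Suc zero_less_power)
  have "N + ((Suc N ^ d - 1) + N * (Suc N ^ d - 1)) = Suc N ^ Suc d - 1"
    by (simp only: power_Suc x) simp
  then show ?case using clock_Cons[OF assms Suc] by simp
qed (simp add: clock_Nil)


section \<open>Construction of the clocked machine\<close>

text \<open>
  The clocked machine starts the simulation when it has read the input once; by then it has written
  a blank into the scanned cell of every tape.
\<close>

definition late_initial :: "machine \<Rightarrow> sym list \<Rightarrow> config" where
  "late_initial M w =
     (start_state M, (map Some (rev w), [None]) # replicate (ntapes M - 1) ([], [None]))"

text \<open>All accepting states are merged, as a machine has only one.\<close>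

definition clocked_state :: "machine \<Rightarrow> nat \<Rightarrow> bool list \<Rightarrow> nat" where
  "clocked_state M q ds = (if q = accept_state M then 1 else to_nat (q, ds) + 2)"

text \<open>State 0 is the setup. While the head crosses the input, each clock head writes a 1 in
  step with it, so the words of the clock get the length of the input without any computation. The
  step on the blank behind the input moves the clock heads left, which makes every digit maximal.
  Simulated transitions tick, whereas simulated queries keep the directions \<open>ds\<close>, as no
  head moves. The accepting state has no successors.\<close>

definition clocked :: "nat \<Rightarrow> machine \<Rightarrow> machine" where
  "clocked d M =
     \<lparr>ntapes = ntapes M + d, start_state = 0, accept_state = 1,
      transitions =
        {(0, Some c # replicate (ntapes M - 1) None @ replicate d None,
          0, (Some c, MoveR) # replicate (ntapes M - 1) (None, Stay) @ replicate d (Some One, MoveR)) | c. True}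
        \<union> {(0, replicate (ntapes M) None @ replicate d None,
          clocked_state M (start_state M) (replicate d False),
          replicate (ntapes M) (None, Stay) @ replicate d (None, MoveL))}
        \<union> {(clocked_state M q ds, cs @ ds_cs, clocked_state M q' ds', as @ ds_as)
          | q ds cs ds_cs q' ds' as ds_as.
            (q, cs, q', as) \<in> transitions M \<and> q \<noteq> accept_state M \<and>
            length ds = d \<and> length ds_cs = d \<and> tick ds ds_cs = Some (ds', ds_as)},
      queries = {(clocked_state M q ds, clocked_state M y ds, clocked_state M n ds)
          | q y n ds. (q, y, n) \<in> queries M \<and> q \<noteq> accept_state M \<and> length ds = d}\<rparr>"

lemma clocked_simps [simp]:
  "ntapes (clocked d M) = ntapes M + d" "start_state (clocked d M) = 0"
  "accept_state (clocked d M) = 1"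
  by (simp_all add: clocked_def)

lemma clocked_state_eq:
  "q' \<noteq> accept_state M \<Longrightarrow> clocked_state M q ds = clocked_state M q' ds' \<longleftrightarrow> q = q' \<and> ds = ds'"
  by (auto simp: clocked_state_def)

lemma clocked_state_pos [simp]: "clocked_state M q ds \<noteq> 0"
  by (simp add: clocked_state_def)

instance sym :: finite
proof
  have "(UNIV :: sym set) = {Zero, One, Hash}" using sym.exhaust by blast
  then show "finite (UNIV :: sym set)" by (metis finite.emptyI finite.insertI)
qed

instance move :: finite
proof
  have "(UNIV :: move set) = {MoveL, MoveR, Stay}" using move.exhaust by blast
  then show "finite (UNIV :: move set)" by (metis finite.emptyI finite.insertI)
qed

lemma finite_length: "finite {xs :: 'b::finite list. length xs = n}"
  using finite_lists_length_eq[of "UNIV :: 'b set" n] by simp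

lemma clocked_is_machine:
  assumes M: "is_machine M"
  shows "is_machine (clocked d M)"
proof -
  have N: "2 \<le> ntapes M" using M by (simp add: is_machine_def)
  let ?f = "\<lambda>((q, cs, q', as), ds, ds_cs). case tick ds ds_cs of Some (ds', ds_as) \<Rightarrow>
    (clocked_state M q ds, cs @ ds_cs, clocked_state M q' ds', as @ ds_as)"
  let ?A = "transitions M \<times> {ds :: bool list. length ds = d} \<times> {cs :: sym option list. length cs = d}"
  have "{(clocked_state M q ds, cs @ ds_cs, clocked_state M q' ds', as @ ds_as)
          | q ds cs ds_cs q' ds' as ds_as.
            (q, cs, q', as) \<in> transitions M \<and> q \<noteq> accept_state M \<and>
            length ds = d \<and> length ds_cs = d \<and> tick ds ds_cs = Some (ds', ds_as)} \<subseteq> ?f ` ?A" (is "?X \<subseteq> _")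
    by (force simp: image_iff)
  moreover have "finite ?A"
    using M by (intro finite_cartesian_product finite_length) (simp add: is_machine_def)
  ultimately have "finite ?X" using finite_surj by blast
  moreover have "finite {(0 :: nat, Some c # replicate (ntapes M - 1) None @ replicate d None,
          0 :: nat, (Some c, MoveR) # replicate (ntapes M - 1) (None, Stay) @ replicate d (Some One, MoveR)) | c :: sym. True}"
    by (simp add: full_SetCompr_eq)
  moreover have "finite {(clocked_state M q ds, clocked_state M y ds, clocked_state M n ds)
          | q y n ds. (q, y, n) \<in> queries M \<and> q \<noteq> accept_state M \<and> length ds = d}"
    (is "finite ?Q")
  proof -
    have "?Q \<subseteq> (\<lambda>((q, y, n), ds). (clocked_state M q ds, clocked_state M y ds, clocked_state M n ds)) `
      (queries M \<times> {ds. length ds = d})" by force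
    moreover have "finite (queries M \<times> {ds :: bool list. length ds = d})"
      using M by (intro finite_cartesian_product finite_length) (simp add: is_machine_def)
    ultimately show ?thesis using finite_surj by blast
  qed
  ultimately show ?thesis
    using M N by (auto simp: is_machine_def clocked_def dest!: tick_length)
qed

lemma map2_replicate: "map2 f (replicate k x) (replicate k y) = replicate k (f x y)"
  by (induction k) auto

lemma step_length:
  assumes "is_machine M" "step M Or (q, tps) (q', tps')" "length tps = ntapes M"
  shows "length tps' = ntapes M"
  using assms(2)
proof cases
  case (step_transition as)
  then show ?thesis using assms(1,3) unfolding is_machine_def by fastforce
qed (use assms in simp)

text \<open>Only an inequality holds for \<open>v'\<close>, because a query costs no tick.\<close>

lemma clocked_step:
  assumes M: "is_machine M" and step: "step M Or (q, tps) (q', tps')"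
    and q: "q \<noteq> accept_state M" and clk: "clock n ds clk v" "0 < v"
    and len: "length ds = d" "length tps = ntapes M"
  shows "\<exists>ds' clk' v'. step (clocked d M) Or (clocked_state M q ds, tps @ clk) (clocked_state M q' ds', tps' @ clk') \<and>
    clock n ds' clk' v' \<and> v - 1 \<le> v' \<and> length ds' = d"
  using step
proof cases
  case (step_transition as)
  obtain ds' as' where t: "tick ds (map tape_read clk) = Some (ds', as')"
    "clock n ds' (map2 tape_act as' clk) (v - 1)" using clock_tick[OF clk(1)] clk(2) by auto
  have l: "length clk = d" "length ds' = d" "length as' = d"
    using clock_length[OF clk(1)] tick_length[OF t(1)] len by auto
  have la: "length as = length tps"
    using step_transition(2) M len unfolding is_machine_def by fastforce
  have "(clocked_state M q ds, map tape_read (tps @ clk), clocked_state M q' ds', as @ as')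
      \<in> transitions (clocked d M)"
    unfolding clocked_def machine.simps map_append
    by (intro UnI2 CollectI exI conjI, rule refl) (use step_transition(2) q t(1) l len in auto)
  then have "step (clocked d M) Or (clocked_state M q ds, tps @ clk)
      (clocked_state M q' ds', map2 tape_act (as @ as') (tps @ clk))"
    by (rule step.step_transition)
  then show ?thesis using step_transition(1) t(2) l la by auto
next
  case (step_query y n)
  have "(clocked_state M q ds, clocked_state M y ds, clocked_state M n ds) \<in> queries (clocked d M)"
    using step_query q len unfolding clocked_def by auto
  moreover have nth: "(tps @ clk) ! 1 = tps ! 1" using M len by (simp add: is_machine_def nth_append)
  ultimately have "step (clocked d M) Or (clocked_state M q ds, tps @ clk)
      (if tape_word (tps ! 1) \<in> Or then clocked_state M y ds else clocked_state M n ds, tps @ clk)"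
    using step.step_query[of "clocked_state M q ds" _ _ _ Or "tps @ clk"] by metis
  then
  have "step (clocked d M) Or (clocked_state M q ds, tps @ clk) (clocked_state M q' ds, tps @ clk)"
    using step_query(1) nth by (cases "tape_word (tps ! 1) \<in> Or") simp_all
  then show ?thesis using step_query clk len by fastforce
qed

lemma clocked_run:
  assumes M: "is_machine M" and "(step M Or ^^ k) (q, tps) (accept_state M, tps')"
    and "clock n ds clk v" "k \<le> v" "length ds = d" "length tps = ntapes M"
  shows "\<exists>tps''. (step (clocked d M) Or)\<^sup>*\<^sup>* (clocked_state M q ds, tps @ clk) (1, tps'')"
  using assms(2-)
proof (induction k arbitrary: q tps ds clk v)
  case 0
  then show ?case by (auto simp: clocked_state_def)
next
  case (Suc k)
  show ?case
  proof (cases "q = accept_state M")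
    case False
    obtain q1 tps1 where s: "step M Or (q, tps) (q1, tps1)" "(step M Or ^^ k) (q1, tps1) (accept_state M, tps')"
      using Suc.prems(1) by (metis relpowp_Suc_D2 surj_pair)
    obtain ds' clk' v' where
      "step (clocked d M) Or (clocked_state M q ds, tps @ clk) (clocked_state M q1 ds', tps1 @ clk')"
      "clock n ds' clk' v'" "v - 1 \<le> v'" "length ds' = d"
      using clocked_step[OF M s(1) False Suc.prems(2) _ Suc.prems(4,5)] Suc.prems(3) by auto
    moreover have "k \<le> v'" using Suc.prems(3) \<open>v - 1 \<le> v'\<close> by linarith
    then obtain tps'' where
      "(step (clocked d M) Or)\<^sup>*\<^sup>* (clocked_state M q1 ds', tps1 @ clk') (1, tps'')"
      using Suc.IH[OF s(2) \<open>clock n ds' clk' v'\<close> _ \<open>length ds' = d\<close> step_length[OF M s(1) Suc.prems(5)]]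
      by blast
    ultimately show ?thesis by (meson converse_rtranclp_into_rtranclp)
  qed (auto simp: clocked_state_def)
qed

text \<open>\<open>tp\<close> is the common content of the other tapes of the simulated machine. It
  is blank throughout, but as a list it changes from \<open>([], [])\<close> to
  \<open>([], [None])\<close> when the first step writes a blank; the lemmas below cover both
  forms.\<close>

definition setup_tapes :: "nat \<Rightarrow> nat \<Rightarrow> tape \<Rightarrow> sym list \<Rightarrow> sym list \<Rightarrow> tape list" where
  "setup_tapes N d tp u v =
     (map Some (rev u), map Some v) # replicate (N - 1) tp @ replicate d (replicate (length u) (Some One), [])"

lemma setup_step:
  assumes "tp \<in> {([], []), ([], [None])}" "2 \<le> ntapes M"
  shows "step (clocked d M) Or (0, setup_tapes (ntapes M) d tp u (c # v))
    (0, setup_tapes (ntapes M) d ([], [None]) (u @ [c]) v)"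
proof -
  have "(0, map tape_read (setup_tapes (ntapes M) d tp u (c # v)), 0,
     (Some c, MoveR) # replicate (ntapes M - 1) (None, Stay) @ replicate d (Some One, MoveR))
     \<in> transitions (clocked d M)"
    using assms(1) by (auto simp: clocked_def setup_tapes_def tape_read_def)
  from step.step_transition[OF this, of Or] show ?thesis
    using assms(1) by (auto simp: setup_tapes_def map2_replicate tape_act_def)
qed

lemma setup_end:
  assumes "tp \<in> {([], []), ([], [None])}" "2 \<le> ntapes M"
  shows "step (clocked d M) Or (0, setup_tapes (ntapes M) d tp w [])
    (clocked_state M (start_state M) (replicate d False), snd (late_initial M w) @
      replicate d (tape_act (None, MoveL) (replicate (length w) (Some One), [])))"
proof -
  obtain N where N: "ntapes M = Suc N" using assms(2) by (cases "ntapes M") auto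
  have "(0, map tape_read (setup_tapes (ntapes M) d tp w []),
     clocked_state M (start_state M) (replicate d False),
     replicate (ntapes M) (None, Stay) @ replicate d (None, MoveL))
     \<in> transitions (clocked d M)"
    using assms(1) by (auto simp: clocked_def setup_tapes_def tape_read_def N)
  from step.step_transition[OF this, of Or] show ?thesis
    using assms(1) by (auto simp: setup_tapes_def map2_replicate tape_act_def N late_initial_def)
qed

lemma setup_digit: "digit N False N (tape_act (None, MoveL) (replicate N (Some One), []))"
proof -
  have "view (replicate N (Some One), []) 0 = None" by (simp add: view_def cell_def)
  from view_act_left[of "(replicate N (Some One), [])", unfolded this]
  show ?thesis unfolding digit_def by (auto simp: view_def cell_def Let_def)
qed

lemma clocked_accepts:
  assumes M: "is_machine M" and run: "(step M Or ^^ k) (late_initial M w) (accept_state M, tps)"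
    and k: "k < Suc (length w) ^ d"
  shows "accepts (clocked d M) Or w"
proof -
  have N: "2 \<le> ntapes M" using M by (simp add: is_machine_def)
  have run_setup: "w = u @ v \<Longrightarrow> tp \<in> {([], []), ([], [None])} \<Longrightarrow> \<exists>tp'\<in>{([], []), ([], [None])}.
    (step (clocked d M) Or)\<^sup>*\<^sup>* (0, setup_tapes (ntapes M) d tp u v) (0, setup_tapes (ntapes M) d tp' w [])"
    for u v tp
  proof (induction v arbitrary: u tp)
    case (Cons c v)
    obtain tp' where "tp' \<in> {([], []), ([], [None])}" "(step (clocked d M) Or)\<^sup>*\<^sup>*
        (0, setup_tapes (ntapes M) d ([], [None]) (u @ [c]) v) (0, setup_tapes (ntapes M) d tp' w [])"
      using Cons.IH[of "u @ [c]" "([], [None])"] Cons.prems(1) by auto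
    with setup_step[OF Cons.prems(2) N, of d Or u c v] show ?case
      by (meson converse_rtranclp_into_rtranclp)
  qed auto
  have init: "initial (clocked d M) w = (0, setup_tapes (ntapes M) d ([], []) [] w)"
    using N by (simp add: initial_def setup_tapes_def flip: replicate_add)
  obtain tp where tp: "tp \<in> {([], []), ([], [None])}"
    "(step (clocked d M) Or)\<^sup>*\<^sup>* (initial (clocked d M) w) (0, setup_tapes (ntapes M) d tp w [])"
    using run_setup[of "[]" w "([], [])"] init by auto
  have clk: "clock (length w) (replicate d False)
      (replicate d (tape_act (None, MoveL) (replicate (length w) (Some One), []))) (Suc (length w) ^ d - 1)"
    by (rule clock_full[OF setup_digit])
  have k: "k \<le> Suc (length w) ^ d - 1" "length (replicate d False) = d"
      "length (snd (late_initial M w)) = ntapes M"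
    using k N by (auto simp: late_initial_def)
  have run': "(step M Or ^^ k) (start_state M, snd (late_initial M w)) (accept_state M, tps)"
    using run by (simp add: late_initial_def)
  obtain tps' where
    "(step (clocked d M) Or)\<^sup>*\<^sup>* (clocked_state M (start_state M) (replicate d False), snd (late_initial M w) @
      replicate d (tape_act (None, MoveL) (replicate (length w) (Some One), []))) (1, tps')"
    using clocked_run[OF M run' clk] k by blast
  with tp setup_end[OF tp(1) N, of d Or w] show ?thesis
    unfolding accepts_def by (metis (no_types, lifting) clocked_simps(3) converse_rtranclp_into_rtranclp rtranclp_trans)
qed

section \<open>Running time and soundness of the clocked machine\<close>

text \<open>\<open>\<rho>\<close> bounds the number of remaining steps; a query does not use the clock.\<close>

inductive clocked_inv :: "machine \<Rightarrow> nat \<Rightarrow> sym list set \<Rightarrow> sym list \<Rightarrow> nat \<Rightarrow> config \<Rightarrow> bool"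
  for M d Or w where
  inv_setup: "w = u @ v \<Longrightarrow> tp \<in> {([], []), ([], [None])} \<Longrightarrow>
    clocked_inv M d Or w (length v + 2 * Suc (length w) ^ d) (0, setup_tapes (ntapes M) d tp u v)"
| inv_run: "(step M Or)\<^sup>*\<^sup>* (late_initial M w) (q, tps) \<Longrightarrow> clock (length w) ds clk v \<Longrightarrow>
    length ds = d \<Longrightarrow> length tps = ntapes M \<Longrightarrow>
    clocked_inv M d Or w (2 * v + (if q \<in> fst ` queries M then 1 else 0)) (clocked_state M q ds, tps @ clk)"

text \<open>A cycle of queries would run forever without a tick. Under this condition at most one
  query occurs between two transitions.\<close>

definition no_chained_queries :: "machine \<Rightarrow> bool" where
  "no_chained_queries M \<longleftrightarrow> (\<forall>(q, y, n)\<in>queries M. {y, n} \<inter> fst ` queries M = {})"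

text \<open>A tick lowers \<open>2 * v\<close> by 2, which pays for the transition and for one query
  after it. The query gives up the summand 1, which its answer states do not have. As the invariant
  also contains a run of \<open>M\<close>, it yields soundness together with the time bound.\<close>

lemma clocked_inv_step:
  assumes M: "is_machine M" and no_chain: "no_chained_queries M"
    and inv: "clocked_inv M d Or w \<rho> c" and step: "step (clocked d M) Or c c'"
  shows "\<exists>\<rho>' < \<rho>. clocked_inv M d Or w \<rho>' c'"
  using inv
proof cases
  case (inv_setup u v tp)
  have N: "2 \<le> ntapes M" using M by (simp add: is_machine_def)
  obtain N' where N': "ntapes M = Suc N'" using N by (cases "ntapes M") auto
  show ?thesis
  proof (cases v)
    case (Cons a v')
    have c': "c' = (0, setup_tapes (ntapes M) d ([], [None]) (u @ [a]) v')"
      using step unfolding inv_setup(2)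
    proof cases
      case (step_transition q' as)
      then show ?thesis using inv_setup(4) clocked_state_pos Cons
        by (auto simp: clocked_def setup_tapes_def tape_read_def N' map2_replicate tape_act_def)
    next
      case (step_query y n)
      then show ?thesis by (auto simp: clocked_def)
    qed
    then show ?thesis
      using clocked_inv.inv_setup[of w "u @ [a]" v' "([], [None])" M d Or] inv_setup Cons
      by (intro exI[of _ "length v' + 2 * Suc (length w) ^ d"]) auto
  next
    case Nil
    let ?clk = "replicate d (tape_act (None, MoveL) (replicate (length w) (Some One), []))"
    have c': "c' = (clocked_state M (start_state M) (replicate d False), snd (late_initial M w) @ ?clk)"
      using step unfolding inv_setup(2)
    proof cases
      case (step_transition q' as)
      then show ?thesis using inv_setup(3,4) clocked_state_pos Nil
        by (auto simp: clocked_def setup_tapes_def tape_read_def N' map2_replicate tape_act_def late_initial_def)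
    next
      case (step_query y n)
      then show ?thesis by (auto simp: clocked_def)
    qed
    have "clocked_inv M d Or w (2 * (Suc (length w) ^ d - 1) + (if start_state M \<in> fst ` queries M then 1 else 0)) c'"
      unfolding c'
      by (rule inv_run) (use N clock_full[OF setup_digit] in \<open>auto simp: late_initial_def\<close>)
    moreover have "2 * (Suc (length w) ^ d - 1) + (if start_state M \<in> fst ` queries M then 1 else 0) < \<rho>"
    proof -
      obtain x where "Suc (length w) ^ d = Suc x" by (metis gr0_conv_Suc zero_less_Suc zero_less_power)
      then show ?thesis using inv_setup(1) by simp
    qed
    ultimately show ?thesis by blast
  qed
next
  case (inv_run q tps ds clk v)
  have N: "2 \<le> ntapes M" using M by (simp add: is_machine_def)
  have lc: "length clk = d" using clock_length[OF inv_run(4)] inv_run(5) by simp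
  show ?thesis
    using step unfolding inv_run(2)
  proof cases
    case (step_transition q1 as1)
    then obtain q' ds' cs ds_cs as ds_as where t: "(q, cs, q', as) \<in> transitions M" "length ds_cs = d"
      "tick ds ds_cs = Some (ds', ds_as)" "map tape_read (tps @ clk) = cs @ ds_cs" "q1 = clocked_state M q' ds'"
      "as1 = as @ ds_as"
      using clocked_state_pos[of M q ds] by (auto simp: clocked_def clocked_state_eq)
    have l: "length cs = ntapes M" "length as = ntapes M"
      using t(1) M unfolding is_machine_def by fastforce+
    then have cs: "cs = map tape_read tps" "ds_cs = map tape_read clk"
      using t(4) inv_run(6) by auto
    then have v: "v \<noteq> 0" "clock (length w) ds' (map2 tape_act ds_as clk) (v - 1)"
      using clock_tick[OF inv_run(4)] t(3) by (auto split: if_splits)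
    have s: "step M Or (q, tps) (q', map2 tape_act as tps)"
      using t(1) cs by (auto intro: step.step_transition)
    have ld: "length ds' = d" "length ds_as = d" using tick_length[OF t(3)] t(2) inv_run(5) by auto
    have "c' = (clocked_state M q' ds', map2 tape_act as tps @ map2 tape_act ds_as clk)"
      using step_transition(1) t(5,6) l inv_run(6) by simp
    then have "clocked_inv M d Or w (2 * (v - 1) + (if q' \<in> fst ` queries M then 1 else 0)) c'"
      using clocked_inv.inv_run[OF rtranclp.rtrancl_into_rtrancl[OF inv_run(3) s] v(2) ld(1)]
        step_length[OF M s inv_run(6)] by simp
    moreover have "2 * (v - 1) + (if q' \<in> fst ` queries M then 1 else 0) < \<rho>"
      using inv_run(1) v(1) by auto
    ultimately show ?thesis by blast
  next
    case (step_query y1 n1)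
    then obtain y n where t: "(q, y, n) \<in> queries M" "y1 = clocked_state M y ds" "n1 = clocked_state M n ds"
      by (auto simp: clocked_def clocked_state_eq)
    define q' where "q' = (if tape_word (tps ! 1) \<in> Or then y else n)"
    have s: "step M Or (q, tps) (q', tps)" unfolding q'_def by (rule step.step_query[OF t(1)])
    have c': "c' = (clocked_state M q' ds, tps @ clk)"
      using step_query(1) t(2,3) N inv_run(6) by (simp add: q'_def nth_append)
    have "q' \<notin> fst ` queries M" using no_chain t(1) by (auto simp: q'_def no_chained_queries_def)
    then have "clocked_inv M d Or w (2 * v) c'"
      using clocked_inv.inv_run[OF rtranclp.rtrancl_into_rtrancl[OF inv_run(3) s] inv_run(4-6)] c' by simp
    moreover have "q \<in> fst ` queries M" using t(1) by force
    then have "2 * v < \<rho>" using inv_run(1) by simp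
    ultimately show ?thesis by blast
  qed
qed

lemma clocked_inv_initial:
  assumes M: "is_machine M"
  shows "clocked_inv M d Or w (length w + 2 * Suc (length w) ^ d) (initial (clocked d M) w)"
proof -
  have "initial (clocked d M) w = (0, setup_tapes (ntapes M) d ([], []) [] w)"
    using M by (simp add: is_machine_def initial_def setup_tapes_def flip: replicate_add)
  then show ?thesis using inv_setup[of w "[]" w "([], [])" M d Or] by simp
qed

lemma clocked_polynomial_time:
  assumes M: "is_machine M" and no_chain: "no_chained_queries M"
  shows "polynomial_time (clocked d M)"
proof -
  have bound: "\<exists>\<rho>. k + \<rho> \<le> length w + 2 * Suc (length w) ^ d \<and> clocked_inv M d Or w \<rho> c"
    if "(step (clocked d M) Or ^^ k) (initial (clocked d M) w) c" for k Or w c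
    using that
  proof (induction k arbitrary: c)
    case 0
    then show ?case using clocked_inv_initial[OF M] by auto
  next
    case (Suc k)
    then obtain c1 where c1: "(step (clocked d M) Or ^^ k) (initial (clocked d M) w) c1"
      "step (clocked d M) Or c1 c" by auto
    then obtain \<rho> where \<rho>: "k + \<rho> \<le> length w + 2 * Suc (length w) ^ d" "clocked_inv M d Or w \<rho> c1"
      using Suc.IH by blast
    obtain \<rho>' where "\<rho>' < \<rho>" "clocked_inv M d Or w \<rho>' c"
      using clocked_inv_step[OF M no_chain \<rho>(2) c1(2)] by blast
    then show ?case using \<rho>(1) by (intro exI[of _ \<rho>']) auto
  qed
  have "k \<le> poly ([:0, 1:] + 2 * [:1, 1:] ^ d) (length w)"
    if "(step (clocked d M) Or ^^ k) (initial (clocked d M) w) c" for k Or w c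
  proof -
    have "poly ([:0, 1:] + 2 * [:1, 1:] ^ d) n = n + 2 * Suc n ^ d" for n :: nat
      by (simp add: poly_power)
    then show ?thesis using bound[OF that] by auto
  qed
  then show ?thesis unfolding polynomial_time_def by blast
qed

text \<open>The clock can only cut runs off, so this direction holds for every
  \<open>d\<close>.\<close>

lemma clocked_accepts_only:
  assumes M: "is_machine M" and no_chain: "no_chained_queries M"
    and acc: "accepts (clocked d M) Or w"
  shows "\<exists>tps. (step M Or)\<^sup>*\<^sup>* (late_initial M w) (accept_state M, tps)"
proof -
  obtain tps where "(step (clocked d M) Or)\<^sup>*\<^sup>* (initial (clocked d M) w) (1, tps)"
    using acc by (auto simp: accepts_def)
  then have "\<exists>\<rho>. clocked_inv M d Or w \<rho> (1, tps)"
  proof (induction rule: rtranclp_induct)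
    case base
    then show ?case using clocked_inv_initial[OF M] by blast
  next
    case (step c c')
    then show ?case using clocked_inv_step[OF M no_chain] by blast
  qed
  then obtain \<rho> where "clocked_inv M d Or w \<rho> (1, tps)" ..
  then show ?thesis
  proof cases
    case (inv_run q tps' ds clk v)
    from inv_run(2) have "q = accept_state M" by (simp add: clocked_state_def split: if_splits)
    then show ?thesis using inv_run by blast
  qed simp
qed


section \<open>Guessing and checking a tree proof\<close>

definition bit_sym :: "bool \<Rightarrow> sym" where
  "bit_sym b = (if b then One else Zero)"

definition delimited :: "bool list list \<Rightarrow> sym list" where
  "delimited vs = concat (map (\<lambda>v. word_of_bits v @ [Hash]) vs)"

lemma word_of_bits_simps [simp]:
  "word_of_bits [] = []" "word_of_bits (b # bs) = bit_sym b # word_of_bits bs"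
  "length (word_of_bits bs) = length bs" "word_of_bits bs = [] \<longleftrightarrow> bs = []"
  by (simp_all add: word_of_bits_def bit_sym_def)

lemma word_of_bits_append [simp]: "word_of_bits (bs @ bs') = word_of_bits bs @ word_of_bits bs'"
  by (simp add: word_of_bits_def)

lemma bit_sym_neq [simp]: "bit_sym b \<noteq> Hash" "Hash \<noteq> bit_sym b"
  by (simp_all add: bit_sym_def)

lemma bit_sym_eq [simp]: "bit_sym b = bit_sym b' \<longleftrightarrow> b = b'"
  by (simp add: bit_sym_def)

lemma word_of_bits_nth [simp]: "i < length bs \<Longrightarrow> word_of_bits bs ! i = bit_sym (bs ! i)"
  by (simp add: word_of_bits_def bit_sym_def)

lemma delimited_simps [simp]:
  "delimited [] = []" "delimited (v # vs) = word_of_bits v @ Hash # delimited vs"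
  "delimited (us @ vs) = delimited us @ delimited vs"
  by (simp_all add: delimited_def)

lemma word_of_bits_split:
  "word_of_bits u @ Hash # x = word_of_bits v @ Hash # y \<Longrightarrow> u = v \<and> x = y"
proof (induction u arbitrary: v)
  case Nil
  then show ?case by (cases v) auto
next
  case (Cons b u)
  then show ?case by (cases v) auto
qed

lemma word_of_bits_inj: "word_of_bits u = word_of_bits v \<Longrightarrow> u = v"
  using word_of_bits_split[of u "[]" v "[]"] by simp

lemma delimited_inj: "delimited us = delimited vs \<Longrightarrow> us = vs"
proof (induction us arbitrary: vs)
  case Nil
  then show ?case by (cases vs) auto
next
  case (Cons u us)
  then show ?case
    by (cases vs) (auto dest: word_of_bits_split)
qed

lemma count_word_of_bits [simp]: "count_list (word_of_bits v) Hash = 0"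
  by (induction v) auto

lemma count_delimited [simp]: "count_list (delimited vs) Hash = length vs"
  by (induction vs) auto

text \<open>For the sentence that the machine copies from the theory. The second premise says that
  \<open>j\<close> is the beginning of a block; without it, \<open>v\<close> could be a proper
  suffix of an entry.\<close>

lemma delimited_block:
  assumes "drop j (delimited vs) = word_of_bits v @ Hash # rest"
    and "0 < j \<Longrightarrow> delimited vs ! (j - 1) = Hash"
  shows "v \<in> set vs"
  using assms
proof (induction vs arbitrary: j)
  case (Cons u us)
  consider "j = 0" | "0 < j" "j \<le> length u" | "length u < j" by linarith
  then show ?case
  proof cases
    case 1
    then show ?thesis using Cons.prems(1) by (auto dest: word_of_bits_split)
  next
    case 2
    then have "j - 1 < length u" by linarith
    then have "delimited (u # us) ! (j - 1) \<noteq> Hash" by (simp add: nth_append)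
    then show ?thesis using Cons.prems(2) 2 by simp
  next
    case 3
    then have "j = Suc (length u + (j - length u - 1))" by simp
    then obtain i where i: "j = Suc (length u + i)" by blast
    have "v \<in> set us"
    proof (rule Cons.IH[of i])
      show "drop i (delimited us) = word_of_bits v @ Hash # rest"
        using Cons.prems(1) by (simp add: i)
      show "delimited us ! (i - 1) = Hash" if "0 < i"
        using Cons.prems(2) that by (simp add: i nth_append nth_Cons')
    qed
    then show ?thesis by simp
  qed
qed simp

section \<open>The guessing machine\<close>

datatype state = Init | Rewind | InGoal | InBound | InTheory | Main
  | EdgeConcl | EdgePrem | Ask | Answered
  | LeafSeek | LeafCopy | LeafReturn | LeafVertex
  | SkipTheory | SkipBound | CopyGoal | RootVertex | AskRoot | ToBound | Compare | Accept | Reject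

instance state :: countable by countable_datatype

instance state :: finite
proof
  have "(UNIV :: state set) = {Init, Rewind, InGoal, InBound, InTheory, Main, EdgeConcl, EdgePrem, Ask,
    Answered, LeafSeek, LeafCopy, LeafReturn, LeafVertex, SkipTheory, SkipBound, CopyGoal, RootVertex,
    AskRoot, ToBound, Compare, Accept, Reject}" using state.exhaust by blast
  then show "finite (UNIV :: state set)" by (metis finite.emptyI finite.insertI)
qed

text \<open>The tapes are the input, the query, the vertices and the children. The last two are
  stacks, so everything is guessed backwards: the last vertex first, for each vertex its last child
  first, and every word from its last bit. The nondeterministic choices are the branch taken in
  \<open>Main\<close>, the bits, the ends of the words and the separator at which
  \<open>LeafSeek\<close> stops. The first pass over the input replaces the two separators between
  its parts by blanks, so that later passes find the borders by looking for a blank. For this reason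
  \<open>copy_end\<close> has two cases: the first sentence of the theory is preceded by a blank,
  every other one by \<open>Hash\<close>. \<open>Reject\<close> has no rule, hence a negative answer
  ends the run.\<close>

inductive rule :: "state \<Rightarrow> sym option list \<Rightarrow> state \<Rightarrow> (sym option \<times> move) list \<Rightarrow> bool" where
  init: "rule Init [i, q, a, b] Rewind [(i, MoveL), (q, Stay), (a, Stay), (b, Stay)]"
| rewind: "i \<noteq> None \<Longrightarrow> rule Rewind [i, q, a, b] Rewind [(i, MoveL), (q, Stay), (a, Stay), (b, Stay)]"
| rewind_end: "rule Rewind [None, q, a, b] InGoal [(None, MoveR), (q, Stay), (a, Stay), (b, Stay)]"
| goal: "rule InGoal [Some (bit_sym x), q, a, b] InGoal
    [(Some (bit_sym x), MoveR), (q, Stay), (a, Stay), (b, Stay)]"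
| goal_end: "rule InGoal [Some Hash, q, a, b] InBound [(None, MoveR), (q, Stay), (a, Stay), (b, Stay)]"
| bound: "rule InBound [Some One, q, a, b] InBound [(Some One, MoveR), (q, Stay), (a, Stay), (b, Stay)]"
| bound_end: "rule InBound [Some Hash, q, a, b] InTheory [(None, MoveR), (q, Stay), (a, Stay), (b, Stay)]"
| thy: "i \<noteq> None \<Longrightarrow> rule InTheory [i, q, a, b] InTheory [(i, MoveR), (q, Stay), (a, Stay), (b, Stay)]"
| thy_end: "rule InTheory [None, q, a, b] Main [(None, Stay), (q, Stay), (a, Stay), (b, Stay)]"
| edge: "rule Main [i, q, a, b] EdgeConcl [(i, Stay), (Some Hash, MoveL), (Some Hash, MoveR), (b, Stay)]"
| concl_bit: "rule EdgeConcl [i, q, a, b] EdgeConcl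
    [(i, Stay), (Some (bit_sym x), MoveL), (Some (bit_sym x), MoveR), (b, Stay)]"
| concl_end: "s \<in> {EdgeConcl, EdgePrem} \<Longrightarrow> rule s [i, q, a, b] EdgePrem
    [(i, Stay), (Some Hash, MoveL), (a, Stay), (Some Hash, MoveR)]"
| prem_bit: "rule EdgePrem [i, q, a, b] EdgePrem
    [(i, Stay), (Some (bit_sym x), MoveL), (a, Stay), (Some (bit_sym x), MoveR)]"
| edge_ask: "s \<in> {EdgeConcl, EdgePrem} \<Longrightarrow> rule s [i, q, a, b] Ask
    [(i, Stay), (Some Zero, Stay), (a, Stay), (b, Stay)]"
| answered: "rule Answered [i, q, a, b] Main [(i, Stay), (None, MoveL), (a, Stay), (b, Stay)]"
| leaf: "rule Main [i, q, a, b] LeafSeek [(i, MoveL), (q, Stay), (a, Stay), (b, Stay)]"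
| seek: "i \<noteq> None \<Longrightarrow> rule LeafSeek [i, q, a, b] LeafSeek [(i, MoveL), (q, Stay), (a, Stay), (b, Stay)]"
| seek_end: "rule LeafSeek [Some Hash, q, a, b] LeafCopy
    [(Some Hash, MoveL), (q, Stay), (a, Stay), (b, Stay)]"
| copy: "rule LeafCopy [Some (bit_sym x), q, a, b] LeafCopy
    [(Some (bit_sym x), MoveL), (Some (bit_sym x), MoveL), (a, Stay), (b, Stay)]"
| copy_end: "i \<in> {None, Some Hash} \<Longrightarrow> rule LeafCopy [i, q, a, b] LeafReturn
    [(i, MoveR), (q, Stay), (a, Stay), (b, Stay)]"
| return: "i \<noteq> None \<Longrightarrow> rule LeafReturn [i, q, a, b] LeafReturn
    [(i, MoveR), (q, Stay), (a, Stay), (b, Stay)]"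
| return_end: "rule LeafReturn [None, q, a, b] LeafVertex
    [(None, Stay), (Some Hash, MoveL), (Some Hash, MoveR), (b, Stay)]"
| vertex_bit: "rule LeafVertex [i, q, a, b] LeafVertex
    [(i, Stay), (Some (bit_sym x), MoveL), (Some (bit_sym x), MoveR), (b, Stay)]"
| leaf_ask: "rule LeafVertex [i, q, a, b] Ask [(i, Stay), (Some One, Stay), (a, Stay), (b, Stay)]"
| finish: "rule Main [i, q, a, b] SkipTheory [(i, MoveL), (q, Stay), (a, Stay), (b, Stay)]"
| skip_thy: "i \<noteq> None \<Longrightarrow> rule SkipTheory [i, q, a, b] SkipTheory
    [(i, MoveL), (q, Stay), (a, Stay), (b, Stay)]"
| skip_thy_end: "rule SkipTheory [None, q, a, b] SkipBound
    [(None, MoveL), (q, Stay), (a, Stay), (b, Stay)]"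
| skip_bound: "i \<noteq> None \<Longrightarrow> rule SkipBound [i, q, a, b] SkipBound
    [(i, MoveL), (q, Stay), (a, Stay), (b, Stay)]"
| skip_bound_end: "rule SkipBound [None, q, a, b] CopyGoal
    [(None, MoveL), (q, Stay), (a, Stay), (b, Stay)]"
| copy_goal: "rule CopyGoal [Some (bit_sym x), q, a, b] CopyGoal
    [(Some (bit_sym x), MoveL), (Some (bit_sym x), MoveL), (a, Stay), (b, Stay)]"
| copy_goal_end: "rule CopyGoal [None, q, a, b] RootVertex
    [(None, MoveR), (Some Hash, MoveL), (a, Stay), (Some Hash, MoveR)]"
| root_bit: "rule RootVertex [i, q, a, b] RootVertex
    [(i, Stay), (Some (bit_sym x), MoveL), (a, Stay), (Some (bit_sym x), MoveR)]"
| root_ask: "rule RootVertex [i, q, a, b] AskRoot [(i, Stay), (Some One, Stay), (a, Stay), (b, Stay)]"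
| to_bound: "i \<noteq> None \<Longrightarrow> rule ToBound [i, q, a, b] ToBound
    [(i, MoveR), (q, Stay), (a, Stay), (b, Stay)]"
| to_bound_end: "rule ToBound [None, q, a, b] Compare
    [(None, MoveR), (q, Stay), (a, MoveL), (b, MoveL)]"
| compare_bit: "rule Compare [i, q, Some (bit_sym x), Some (bit_sym x)] Compare
    [(i, Stay), (q, Stay), (Some (bit_sym x), MoveL), (Some (bit_sym x), MoveL)]"
| compare_hash: "rule Compare [Some One, q, Some Hash, Some Hash] Compare
    [(Some One, MoveR), (q, Stay), (Some Hash, MoveL), (Some Hash, MoveL)]"
| compare_end: "rule Compare [i, q, None, None] Accept [(i, Stay), (q, Stay), (None, Stay), (None, Stay)]"

definition tree_machine :: machine where
  "tree_machine =
     \<lparr>ntapes = 4, start_state = to_nat Init, accept_state = to_nat Accept,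
      transitions = {(to_nat s, cs, to_nat s', as) | s cs s' as. rule s cs s' as},
      queries = {(to_nat Ask, to_nat Answered, to_nat Reject), (to_nat AskRoot, to_nat ToBound, to_nat Reject)}\<rparr>"

lemma rule_length: "rule s cs s' as \<Longrightarrow> length cs = 4 \<and> length as = 4"
  by (induction rule: rule.induct) auto

lemma tree_machine_is_machine: "is_machine tree_machine"
proof -
  have "finite (UNIV :: state set)" "finite {cs :: sym option list. length cs = 4}"
    "finite {as :: (sym option \<times> move) list. length as = 4}"
    by (auto intro: finite_length)
  then have "finite ((UNIV :: state set) \<times> {cs :: sym option list. length cs = 4} \<times> (UNIV :: state set) \<times>
      {as :: (sym option \<times> move) list. length as = 4})" (is "finite ?A")
    by (intro finite_cartesian_product)
  moreover have "transitions tree_machine \<subseteq> (\<lambda>(s, cs, s', as). (to_nat s, cs, to_nat s', as)) ` ?A"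
    by (force simp: tree_machine_def dest: rule_length)
  ultimately have "finite (transitions tree_machine)" using finite_surj by blast
  then show ?thesis by (auto simp: is_machine_def tree_machine_def dest: rule_length)
qed

lemma tree_machine_no_chained_queries: "no_chained_queries tree_machine"
  by (simp add: no_chained_queries_def tree_machine_def)

lemma tree_machine_step:
  assumes "rule s [tape_read ti, tape_read tq, tape_read ta, tape_read tb] s' [ai, aq, aa, ab]"
  shows "step tree_machine Or (to_nat s, [ti, tq, ta, tb])
    (to_nat s', [tape_act ai ti, tape_act aq tq, tape_act aa ta, tape_act ab tb])"
proof -
  have "(to_nat s, map tape_read [ti, tq, ta, tb], to_nat s', [ai, aq, aa, ab]) \<in> transitions tree_machine"
    using assms by (auto simp: tree_machine_def)
  from step.step_transition[OF this, of Or] show ?thesis by simp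
qed

lemma tree_machine_step_cases:
  assumes "step tree_machine Or (to_nat s, [ti, tq, ta, tb]) c'"
  obtains s' ai aq aa ab where
    "rule s [tape_read ti, tape_read tq, tape_read ta, tape_read tb] s' [ai, aq, aa, ab]"
    "c' = (to_nat s', [tape_act ai ti, tape_act aq tq, tape_act aa ta, tape_act ab tb])"
  | "s = Ask" "c' = (to_nat (if tape_word tq \<in> Or then Answered else Reject), [ti, tq, ta, tb])"
  | "s = AskRoot" "c' = (to_nat (if tape_word tq \<in> Or then ToBound else Reject), [ti, tq, ta, tb])"
  using assms
proof cases
  case (step_transition q' as)
  then obtain s' where r: "rule s [tape_read ti, tape_read tq, tape_read ta, tape_read tb] s' as" "q' = to_nat s'"
    by (auto simp: tree_machine_def)
  then obtain ai aq aa ab where "as = [ai, aq, aa, ab]"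
    using rule_length[OF r(1)] by (auto simp: numeral_eq_Suc length_Suc_conv)
  then show ?thesis using r step_transition that(1) by simp
next
  case (step_query y n)
  then show ?thesis using that(2,3) by (auto simp: tree_machine_def)
qed

definition rest :: "tape \<Rightarrow> sym option list" where
  "rest tp = tl (snd tp)"

text \<open>
  The query tape is written from right to left, so that its head ends up at the start of the
  query; older queries are cut off by a blank.
\<close>

definition qword :: "tape \<Rightarrow> sym list" where
  "qword tp = map the (takeWhile (\<lambda>c. c \<noteq> None) (rest tp))"

lemma tape_act_simps [simp]:
  "fst (tape_act (c, MoveL) tp) = tl (fst tp)"
  "tape_read (tape_act (c, MoveL) tp) = first_cell (fst tp)"
  "rest (tape_act (c, MoveL) tp) = c # rest tp"
  "fst (tape_act (c, MoveR) tp) = c # fst tp"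
  "tape_read (tape_act (c, MoveR) tp) = first_cell (rest tp)"
  "rest (tape_act (c, MoveR) tp) = tl (rest tp)"
  "fst (tape_act (c, Stay) tp) = fst tp"
  "tape_read (tape_act (c, Stay) tp) = c"
  "rest (tape_act (c, Stay) tp) = rest tp"
  by (cases tp; simp add: tape_act_def tape_read_def rest_def)+

lemma qword_act [simp]:
  "qword (tape_act (Some x, MoveL) tp) = x # qword tp"
  "qword (tape_act (None, MoveL) tp) = []"
  "qword (tape_act (c, Stay) tp) = qword tp"
  by (simp_all add: qword_def)

lemma tape_word_act [simp]: "tape_word (tape_act (Some x, Stay) tp) = x # qword tp"
  by (cases tp) (simp add: tape_word_def tape_act_def qword_def rest_def)


section \<open>Certificates and soundness of the machine\<close>

text \<open>The counterpart of \<open>bfs_proof\<close> for guessed words, with oracle answers in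
  place of labels and hyperedges. It is stated for an arbitrary oracle, so the analysis of the
  machine is independent of derivation structures.\<close>

definition bit_certificate ::
    "sym list set \<Rightarrow> bool list \<Rightarrow> bool list set \<Rightarrow> bool list list \<Rightarrow> bool list list list \<Rightarrow> bool" where
  "bit_certificate Or \<eta> \<Theta> as Ds \<longleftrightarrow>
     (\<exists>r. as = r # concat Ds \<and> One # word_of_bits r @ Hash # word_of_bits \<eta> \<in> Or) \<and>
     list_all2 (\<lambda>v C. C = [] \<and> (\<exists>\<alpha>\<in>\<Theta>. One # word_of_bits v @ Hash # word_of_bits \<alpha> \<in> Or) \<or>
       Zero # delimited (C @ [v]) \<in> Or) as Ds"

locale tree_input =
  fixes Or :: "sym list set" and \<eta> :: "bool list" and n :: nat and \<theta>s :: "bool list list"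
begin

definition input :: "sym list" where
  "input = word_of_bits \<eta> @ [Hash] @ replicate n One @ [Hash] @ delimited \<theta>s"

text \<open>The input tape after the separators of its three parts have been replaced by blanks.\<close>

definition X :: "sym option list" where
  "X = None # map Some (word_of_bits \<eta>) @ None # replicate n (Some One) @ None #
     map Some (delimited \<theta>s) @ [None]"

text \<open>\<open>X\<close> has blanks exactly at 0, \<open>length \<eta> + 1\<close>,
  \<open>pre\<close> and \<open>last_pos\<close>. A head that moves to the next blank therefore
  stops at a border between two parts.\<close>

definition pre :: nat where "pre = length \<eta> + n + 2"

definition last_pos :: nat where "last_pos = pre + length (delimited \<theta>s) + 1"

text \<open>Equality of lists is appropriate here, as the blanks at both ends of \<open>X\<close>
  are explicit: the left one arises when the head rewinds beyond the input, the right one was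
  written before the start. No later move leaves \<open>X\<close>.\<close>

definition head_at :: "tape \<Rightarrow> nat \<Rightarrow> bool" where
  "head_at tp p \<longleftrightarrow> rev (fst tp) @ tape_read tp # rest tp = X \<and> length (fst tp) = p"

lemma length_X: "length X = Suc last_pos"
  by (simp add: X_def last_pos_def pre_def)

lemma X_nth_0: "X ! 0 = None" by (simp add: X_def)

lemma X_nth_goal: "0 < p \<Longrightarrow> p \<le> length \<eta> \<Longrightarrow> X ! p = Some (bit_sym (\<eta> ! (p - 1)))"
  by (cases p) (simp_all add: X_def nth_append)

lemma X_nth_bound:
  "X ! (length \<eta> + 1) = None"
  "length \<eta> + 1 < p \<Longrightarrow> p < pre \<Longrightarrow> X ! p = Some One"
  "X ! pre = None"
  by (auto simp: X_def pre_def nth_append nth_Cons')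

lemma drop_X: "pre \<le> p \<Longrightarrow> drop (Suc p) X = drop (p - pre) (map Some (delimited \<theta>s) @ [None])"
  by (simp add: X_def pre_def drop_Cons' Suc_diff_le)

lemma X_nth_theory: "pre < p \<Longrightarrow> p < last_pos \<Longrightarrow> X ! p = Some (delimited \<theta>s ! (p - pre - 1))"
proof -
  assume p: "pre < p" "p < last_pos"
  then obtain i where i: "p = Suc (pre + i)" using less_imp_Suc_add by blast
  have "X ! p = drop (Suc pre) X ! i"
    using p length_X i by simp
  then show "X ! p = Some (delimited \<theta>s ! (p - pre - 1))"
    using p i by (simp add: drop_X last_pos_def nth_append)
qed

lemma X_nth_last: "X ! last_pos = None"
proof -
  have "X \<noteq> []" "last X = None" by (simp_all add: X_def)
  then show ?thesis using length_X by (simp add: last_conv_nth)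
qed

lemma head_at_read: "head_at tp p \<Longrightarrow> tape_read tp = X ! p"
  unfolding head_at_def by (metis length_rev nth_append_length)

lemma head_at_le: "head_at tp p \<Longrightarrow> p \<le> last_pos"
  using length_X unfolding head_at_def by (metis add_Suc_right le_add1 length_Cons length_append length_rev nat.inject)

lemma head_at_rest: "head_at tp p \<Longrightarrow> rest tp = drop (Suc p) X"
  unfolding head_at_def by (metis append_eq_conv_conj drop_Suc_Cons drop_drop length_rev list.sel(3) plus_1_eq_Suc add.commute drop_Suc tl_drop)

lemma head_at_stay [intro]: "head_at tp p \<Longrightarrow> head_at (tape_act (tape_read tp, Stay) tp) p"
  by (simp add: head_at_def)

lemma head_at_left: "head_at tp p \<Longrightarrow> 0 < p \<Longrightarrow> head_at (tape_act (tape_read tp, MoveL) tp) (p - 1)"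
  by (cases "fst tp") (auto simp: head_at_def)

lemma head_at_right: "head_at tp p \<Longrightarrow> p < last_pos \<Longrightarrow> head_at (tape_act (tape_read tp, MoveR) tp) (Suc p)"
proof -
  assume a: "head_at tp p" and p: "p < last_pos"
  then have "rest tp \<noteq> []" using head_at_rest length_X by simp
  then obtain c cs where "rest tp = c # cs" by (cases "rest tp") auto
  then show ?thesis using a by (simp add: head_at_def)
qed

abbreviation node :: "bool list \<Rightarrow> bool list list \<Rightarrow> bool" where
  "node v C \<equiv> C = [] \<and> (\<exists>\<alpha>\<in>set \<theta>s. One # word_of_bits v @ Hash # word_of_bits \<alpha> \<in> Or) \<or>
       Zero # delimited (C @ [v]) \<in> Or"

abbreviation is_root :: "bool list \<Rightarrow> bool" where
  "is_root r \<equiv> One # word_of_bits r @ Hash # word_of_bits \<eta> \<in> Or"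

text \<open>
  Tapes \<open>2\<close> and \<open>3\<close> grow to the right and are read from the head to the left: they contain the
  vertices processed so far and the children of these vertices, the most recent first.
\<close>

definition lists :: "tape \<Rightarrow> tape \<Rightarrow> bool list list \<Rightarrow> bool list list \<Rightarrow> bool" where
  "lists ta tb as bs \<longleftrightarrow> fst ta = map Some (delimited as) \<and> fst tb = map Some (delimited bs)"

text \<open>\<open>Ds\<close> is on no tape: tape \<open>3\<close> holds only the concatenation, and
  its division into lists of children is a witness of the invariant. While a query is being written,
  its vertex \<open>v\<close> is already on tape \<open>2\<close> but not yet covered by
  \<open>list_all2 node\<close>; \<open>inv_Ask\<close> records what a positive answer will add. In
  \<open>inv_Compare\<close>, \<open>z\<close> is the common prefix compared so far, and its
  separators are counted by the head on the unary bound.\<close>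

inductive inv :: "state \<Rightarrow> tape \<Rightarrow> tape \<Rightarrow> tape \<Rightarrow> tape \<Rightarrow> bool" where
  inv_Init: "\<lbrakk>fst ti = map Some (rev input); tape_read ti = None; rest ti = []; qword tq = []; lists ta tb [] []\<rbrakk>
    \<Longrightarrow> inv Init ti tq ta tb"
| inv_Rewind: "\<lbrakk>input = u @ v; tape_read ti = first_cell (map Some (rev u)); fst ti = tl (map Some (rev u));
     rest ti = map Some v @ [None]; qword tq = []; lists ta tb [] []\<rbrakk>
    \<Longrightarrow> inv Rewind ti tq ta tb"
| inv_InGoal: "\<lbrakk>\<eta> = u @ v; fst ti = rev (None # map Some (word_of_bits u));
     tape_read ti # rest ti = map Some (word_of_bits v @ Hash # replicate n One @ Hash # delimited \<theta>s) @ [None];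
     qword tq = []; lists ta tb [] []\<rbrakk>
    \<Longrightarrow> inv InGoal ti tq ta tb"
| inv_InBound: "\<lbrakk>n = j + k; fst ti = rev (None # map Some (word_of_bits \<eta>) @ None # replicate j (Some One));
     tape_read ti # rest ti = map Some (replicate k One @ Hash # delimited \<theta>s) @ [None];
     qword tq = []; lists ta tb [] []\<rbrakk>
    \<Longrightarrow> inv InBound ti tq ta tb"
| inv_InTheory: "\<lbrakk>delimited \<theta>s = u @ v;
     fst ti = rev (None # map Some (word_of_bits \<eta>) @ None # replicate n (Some One) @ None # map Some u);
     tape_read ti # rest ti = map Some v @ [None]; qword tq = []; lists ta tb [] []\<rbrakk>
    \<Longrightarrow> inv InTheory ti tq ta tb"
| inv_Main: "\<lbrakk>head_at ti last_pos; list_all2 node as Ds; lists ta tb as (concat Ds); qword tq = []\<rbrakk>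
    \<Longrightarrow> inv Main ti tq ta tb"
| inv_EdgeConcl: "\<lbrakk>head_at ti last_pos; list_all2 node as Ds; lists ta tb (v # as) (concat Ds);
     qword tq = delimited [v]\<rbrakk>
    \<Longrightarrow> inv EdgeConcl ti tq ta tb"
| inv_EdgePrem: "\<lbrakk>head_at ti last_pos; list_all2 node as Ds; lists ta tb (v # as) (u # C @ concat Ds);
     qword tq = delimited (u # C @ [v])\<rbrakk>
    \<Longrightarrow> inv EdgePrem ti tq ta tb"
| inv_Ask: "\<lbrakk>head_at ti last_pos; list_all2 node as Ds; lists ta tb (v # as) (C @ concat Ds);
     tape_word tq \<in> Or \<Longrightarrow> node v C\<rbrakk>
    \<Longrightarrow> inv Ask ti tq ta tb"
| inv_Answered: "\<lbrakk>head_at ti last_pos; list_all2 node as Ds; lists ta tb as (concat Ds)\<rbrakk>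
    \<Longrightarrow> inv Answered ti tq ta tb"
| inv_LeafSeek: "\<lbrakk>head_at ti p; pre \<le> p; p < last_pos; list_all2 node as Ds; lists ta tb as (concat Ds); qword tq = []\<rbrakk>
    \<Longrightarrow> inv LeafSeek ti tq ta tb"
| inv_LeafCopy: "\<lbrakk>head_at ti p; pre \<le> p; p < last_pos; drop (Suc p) X = map Some (word_of_bits \<alpha>) @ Some Hash # cs;
     list_all2 node as Ds; lists ta tb as (concat Ds); qword tq = word_of_bits \<alpha>\<rbrakk>
    \<Longrightarrow> inv LeafCopy ti tq ta tb"
| inv_LeafReturn: "\<lbrakk>head_at ti p; pre < p; \<alpha> \<in> set \<theta>s; list_all2 node as Ds; lists ta tb as (concat Ds);
     qword tq = word_of_bits \<alpha>\<rbrakk>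
    \<Longrightarrow> inv LeafReturn ti tq ta tb"
| inv_LeafVertex: "\<lbrakk>head_at ti last_pos; \<alpha> \<in> set \<theta>s; list_all2 node as Ds; lists ta tb (v # as) (concat Ds);
     qword tq = word_of_bits v @ Hash # word_of_bits \<alpha>\<rbrakk>
    \<Longrightarrow> inv LeafVertex ti tq ta tb"
| inv_SkipTheory: "\<lbrakk>head_at ti p; pre \<le> p; p < last_pos; list_all2 node as Ds; lists ta tb as (concat Ds);
     qword tq = []\<rbrakk>
    \<Longrightarrow> inv SkipTheory ti tq ta tb"
| inv_SkipBound: "\<lbrakk>head_at ti p; length \<eta> < p; p < pre; list_all2 node as Ds; lists ta tb as (concat Ds);
     qword tq = []\<rbrakk>
    \<Longrightarrow> inv SkipBound ti tq ta tb"
| inv_CopyGoal: "\<lbrakk>head_at ti p; p \<le> length \<eta>; list_all2 node as Ds; lists ta tb as (concat Ds);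
     qword tq = word_of_bits (drop p \<eta>)\<rbrakk>
    \<Longrightarrow> inv CopyGoal ti tq ta tb"
| inv_RootVertex: "\<lbrakk>head_at ti 1; list_all2 node as Ds; lists ta tb as (r # concat Ds);
     qword tq = word_of_bits r @ Hash # word_of_bits \<eta>\<rbrakk>
    \<Longrightarrow> inv RootVertex ti tq ta tb"
| inv_AskRoot: "\<lbrakk>head_at ti 1; list_all2 node as Ds; lists ta tb as (r # concat Ds);
     tape_word tq \<in> Or \<Longrightarrow> is_root r\<rbrakk>
    \<Longrightarrow> inv AskRoot ti tq ta tb"
| inv_ToBound: "\<lbrakk>head_at ti p; 0 < p; p \<le> length \<eta> + 1; list_all2 node as Ds; lists ta tb as (r # concat Ds);
     is_root r\<rbrakk>
    \<Longrightarrow> inv ToBound ti tq ta tb"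
| inv_Compare: "\<lbrakk>head_at ti (length \<eta> + 2 + count_list z Hash); count_list z Hash \<le> n; list_all2 node as Ds; is_root r;
     delimited as = z @ x; delimited (r # concat Ds) = z @ y;
     tape_read ta = first_cell (map Some x); fst ta = tl (map Some x);
     tape_read tb = first_cell (map Some y); fst tb = tl (map Some y)\<rbrakk>
    \<Longrightarrow> inv Compare ti tq ta tb"
| inv_Accept: "\<lbrakk>bit_certificate Or \<eta> (set \<theta>s) as Ds; length as \<le> n\<rbrakk> \<Longrightarrow> inv Accept ti tq ta tb"
| inv_Reject: "inv Reject ti tq ta tb"

lemma lists_stay [simp]:
  "lists (tape_act (c, Stay) ta) tb as bs = lists ta tb as bs"
  "lists ta (tape_act (c, Stay) tb) as bs = lists ta tb as bs"
  by (simp_all add: lists_def)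

lemma lists_hash [simp]:
  "lists ta tb as bs \<Longrightarrow> lists (tape_act (Some Hash, MoveR) ta) tb ([] # as) bs"
  "lists ta tb as bs \<Longrightarrow> lists ta (tape_act (Some Hash, MoveR) tb) as ([] # bs)"
  by (simp_all add: lists_def)

lemma lists_bit [simp]:
  "lists ta tb (v # as) bs \<Longrightarrow> lists (tape_act (Some (bit_sym x), MoveR) ta) tb ((x # v) # as) bs"
  "lists ta tb as (v # bs) \<Longrightarrow> lists ta (tape_act (Some (bit_sym x), MoveR) tb) as ((x # v) # bs)"
  by (simp_all add: lists_def)

lemma first_cell_tl: "xs \<noteq> [] \<Longrightarrow> first_cell xs # tl xs = xs"
  by (cases xs) auto

lemma first_cell_Some: "first_cell (map Some xs) = Some x \<longleftrightarrow> (\<exists>ys. xs = x # ys)"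
  by (cases xs) auto

lemma first_cell_None: "first_cell (map Some xs) = None \<longleftrightarrow> xs = []"
  by (cases xs) auto

text \<open>The cell to the left of the copied word is the blank at \<open>pre\<close> or a
  separator, so the word is a whole sentence of the theory and not a suffix of one.\<close>

lemma head_at_copied_block:
  assumes p: "pre \<le> p" and X: "X ! p \<in> {None, Some Hash}" "p < last_pos"
    and d: "drop (Suc p) X = map Some (word_of_bits \<alpha>) @ Some Hash # cs"
  shows "\<alpha> \<in> set \<theta>s"
proof -
  let ?j = "p - pre"
  have j: "?j \<le> length (delimited \<theta>s)" using X(2) p by (simp add: last_pos_def)
  then have "map Some (drop ?j (delimited \<theta>s)) @ [None] = map Some (word_of_bits \<alpha>) @ Some Hash # cs"
    using d drop_X[OF p] by (simp add: drop_map)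
  \<comment> \<open>\<open>cs\<close> still contains the final blank of \<open>X\<close>. Cutting
    both sides at the first blank leaves symbols only.\<close>
  then have "takeWhile (\<lambda>c. c \<noteq> None) (map Some (drop ?j (delimited \<theta>s)) @ [None]) =
      takeWhile (\<lambda>c. c \<noteq> None) (map Some (word_of_bits \<alpha>) @ Some Hash # cs)" by simp
  then have "map Some (drop ?j (delimited \<theta>s)) =
      map Some (word_of_bits \<alpha>) @ Some Hash # takeWhile (\<lambda>c. c \<noteq> None) cs"
    by (simp add: takeWhile_append)
  then have "map the (map Some (drop ?j (delimited \<theta>s))) =
      map the (map Some (word_of_bits \<alpha>) @ Some Hash # takeWhile (\<lambda>c. c \<noteq> None) cs)" by (simp only:)
  then have "drop ?j (delimited \<theta>s) = word_of_bits \<alpha> @ Hash # map the (takeWhile (\<lambda>c. c \<noteq> None) cs)"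
    by (simp add: comp_def)
  moreover have "delimited \<theta>s ! (?j - 1) = Hash" if "0 < ?j"
    using X X_nth_theory[of p] that by simp
  ultimately show ?thesis by (rule delimited_block)
qed

lemma inv_rule:
  assumes "rule s cs s' as" "cs = [tape_read ti, tape_read tq, tape_read ta, tape_read tb]" "inv s ti tq ta tb"
  shows "inv s' (tape_act (as ! 0) ti) (tape_act (as ! 1) tq) (tape_act (as ! 2) ta) (tape_act (as ! 3) tb)"
  using assms
proof (induction rule: rule.induct)
  case (init i q a b)
  from init(2) show ?case
  proof cases
    case inv_Init
    then show ?thesis using init(1)
      by (intro inv_Rewind[of input "[]"]) (simp_all add: map_tl rev_map)
  qed
next
  case (rewind i q a b)
  from rewind(3) show ?case
  proof cases
    case (inv_Rewind u v)
    then obtain u' x where u: "u = u' @ [x]"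
      using rewind(1,2) by (cases u rule: rev_cases) auto
    then show ?thesis using rewind(2) inv_Rewind
      by (intro inv.inv_Rewind[of u' "x # v"]) simp_all
  qed
next
  case (rewind_end q a b)
  from rewind_end(2) show ?case
  proof cases
    case (inv_Rewind u v)
    then have "u = []" using rewind_end(1) by (cases u rule: rev_cases) auto
    then show ?thesis using rewind_end(1) inv_Rewind
      by (intro inv_InGoal[of "[]" \<eta>]) (simp_all add: input_def first_cell_tl)
  qed
next
  case (goal x q a b)
  from goal(2) show ?case
  proof cases
    case (inv_InGoal u v)
    then obtain v' where "v = x # v'" using goal(1) by (cases v) auto
    then show ?thesis using goal(1) inv_InGoal
      by (intro inv.inv_InGoal[of "u @ [x]" v']) (simp_all add: first_cell_tl)
  qed
next
  case (goal_end q a b)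
  from goal_end(2) show ?case
  proof cases
    case (inv_InGoal u v)
    then have "v = []" using goal_end(1) by (cases v) auto
    then show ?thesis using goal_end(1) inv_InGoal
      by (intro inv_InBound[of 0 n]) (simp_all add: first_cell_tl)
  qed
next
  case (bound q a b)
  from bound(2) show ?case
  proof cases
    case (inv_InBound j k)
    then obtain k' where "k = Suc k'" using bound(1) by (cases k) auto
    then show ?thesis using bound(1) inv_InBound
      by (intro inv.inv_InBound[of "Suc j" k']) (simp_all add: first_cell_tl replicate_append_same)
  qed
next
  case (bound_end q a b)
  from bound_end(2) show ?case
  proof cases
    case (inv_InBound j k)
    then have "k = 0" using bound_end(1) by (cases k) auto
    then show ?thesis using bound_end(1) inv_InBound
      by (intro inv_InTheory[of "[]" "delimited \<theta>s"]) (simp_all add: first_cell_tl)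
  qed
next
  case (thy i q a b)
  from thy(3) show ?case
  proof cases
    case (inv_InTheory u v)
    then obtain x v' where "v = x # v'" using thy(1,2) by (cases v) auto
    then show ?thesis using thy(2) inv_InTheory
      by (intro inv.inv_InTheory[of "u @ [x]" v']) (simp_all add: first_cell_tl)
  qed
next
  case (thy_end q a b)
  from thy_end(2) show ?case
  proof cases
    case (inv_InTheory u v)
    then have "v = []" using thy_end(1) by (cases v) auto
    then show ?thesis using thy_end(1) inv_InTheory
      by (intro inv_Main[of _ "[]" "[]"]) (simp_all add: head_at_def X_def last_pos_def pre_def)
  qed
next
  case (edge i q a b)
  from edge(2) show ?case
  proof cases
    case (inv_Main as Ds)
    then show ?thesis using edge(1)
      by (intro inv_EdgeConcl[of _ as Ds _ _ "[]"]) auto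
  qed
next
  case (concl_bit i q a b x)
  from concl_bit(2) show ?case
  proof cases
    case (inv_EdgeConcl as Ds v)
    then show ?thesis using concl_bit(1)
      by (intro inv.inv_EdgeConcl[of _ as Ds _ _ "x # v"]) auto
  qed
next
  case (concl_end s i q a b)
  then consider "inv EdgeConcl ti tq ta tb" | "inv EdgePrem ti tq ta tb" by auto
  then show ?case
  proof cases
    case 1
    then show ?thesis
    proof cases
      case (inv_EdgeConcl as Ds v)
      then show ?thesis using concl_end(2)
        by (intro inv.inv_EdgePrem[of _ as Ds _ _ v "[]" "[]"]) auto
    qed
  next
    case 2
    then show ?thesis
    proof cases
      case (inv_EdgePrem as Ds v u C)
      then show ?thesis using concl_end(2)
        by (intro inv.inv_EdgePrem[of _ as Ds _ _ v "[]" "u # C"]) auto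
    qed
  qed
next
  case (prem_bit i q a b x)
  from prem_bit(2) show ?case
  proof cases
    case (inv_EdgePrem as Ds v u C)
    then show ?thesis using prem_bit(1)
      by (intro inv.inv_EdgePrem[of _ as Ds _ _ v "x # u" C]) auto
  qed
next
  case (edge_ask s i q a b)
  then consider "inv EdgeConcl ti tq ta tb" | "inv EdgePrem ti tq ta tb" by auto
  then show ?case
  proof cases
    case 1
    then show ?thesis
    proof cases
      case (inv_EdgeConcl as Ds v)
      then show ?thesis using edge_ask(2)
        by (intro inv.inv_Ask[of _ as Ds _ _ v "[]"]) auto
    qed
  next
    case 2
    then show ?thesis
    proof cases
      case (inv_EdgePrem as Ds v u C)
      then show ?thesis using edge_ask(2)
        by (intro inv.inv_Ask[of _ as Ds _ _ v "u # C"]) auto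
    qed
  qed
next
  case (answered i q a b)
  from answered(2) show ?case
  proof cases
    case (inv_Answered as Ds)
    then show ?thesis using answered(1) by (intro inv.inv_Main[of _ as Ds]) auto
  qed
next
  case (leaf i q a b)
  from leaf(2) show ?case
  proof cases
    case (inv_Main as Ds)
    then show ?thesis using leaf(1) head_at_left[of ti last_pos]
      by (intro inv.inv_LeafSeek[of _ "last_pos - 1" as Ds]) (auto simp: last_pos_def)
  qed
next
  case (seek i q a b)
  from seek(3) show ?case
  proof cases
    case (inv_LeafSeek p as Ds)
    \<comment> \<open>The search cannot leave the theory, as \<open>seek\<close> does not apply to
      the blank at \<open>pre\<close>.\<close>
    then have "p \<noteq> pre" using seek(1,2) head_at_read X_nth_bound(3) by auto
    then show ?thesis using seek(2) inv_LeafSeek head_at_left[of ti p]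
      by (intro inv.inv_LeafSeek[of _ "p - 1" as Ds]) auto
  qed
next
  case (seek_end q a b)
  from seek_end(2) show ?case
  proof cases
    case (inv_LeafSeek p as Ds)
    then have X: "X ! p = Some Hash" using seek_end(1) head_at_read by auto
    then have p: "pre < p" using X_nth_bound(3) inv_LeafSeek(2) by (cases "p = pre") auto
    then have "drop (Suc (p - 1)) X = Some Hash # drop (Suc p) X"
      using X Cons_nth_drop_Suc[of p X] length_X inv_LeafSeek by simp
    then show ?thesis using seek_end(1) inv_LeafSeek p head_at_left[of ti p]
      by (intro inv.inv_LeafCopy[of _ "p - 1" "[]" "drop (Suc p) X" as Ds]) auto
  qed
next
  case (copy x q a b)
  from copy(2) show ?case
  proof cases
    case (inv_LeafCopy p \<alpha> cs as Ds)
    then have X: "X ! p = Some (bit_sym x)" using copy(1) head_at_read by auto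
    then have p: "pre < p" using X_nth_bound(3) inv_LeafCopy(2) by (cases "p = pre") auto
    then have "drop (Suc (p - 1)) X = Some (bit_sym x) # drop (Suc p) X"
      using X Cons_nth_drop_Suc[of p X] length_X inv_LeafCopy by simp
    moreover have "tape_read ti = Some (bit_sym x)" "q = tape_read tq" "a = tape_read ta" "b = tape_read tb"
      using copy(1) by simp_all
    ultimately show ?thesis using inv_LeafCopy p head_at_left[of ti p]
      by (intro inv.inv_LeafCopy[of _ "p - 1" "x # \<alpha>" cs as Ds]) auto
  qed
next
  case (copy_end i q a b)
  from copy_end(3) show ?case
  proof cases
    case (inv_LeafCopy p \<alpha> cs as Ds)
    then have "\<alpha> \<in> set \<theta>s"
      using copy_end(1,2) head_at_read head_at_copied_block[of p \<alpha> cs] by auto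
    then show ?thesis using copy_end(2) inv_LeafCopy head_at_right[of ti p]
      by (intro inv.inv_LeafReturn[of _ "Suc p" \<alpha> as Ds]) auto
  qed
next
  case (return i q a b)
  from return(3) show ?case
  proof cases
    case (inv_LeafReturn p \<alpha> as Ds)
    then have "p < last_pos"
      using return(1,2) head_at_read head_at_le[of ti p] X_nth_last by (cases "p = last_pos") auto
    then show ?thesis using return(2) inv_LeafReturn head_at_right[of ti p]
      by (intro inv.inv_LeafReturn[of _ "Suc p" \<alpha> as Ds]) auto
  qed
next
  case (return_end q a b)
  from return_end(2) show ?case
  proof cases
    case (inv_LeafReturn p \<alpha> as Ds)
    then have "p = last_pos"
      using return_end(1) head_at_read[of ti p] head_at_le[of ti p] X_nth_theory[of p] by force
    then show ?thesis using return_end(1) inv_LeafReturn head_at_stay[of ti p]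
      by (intro inv.inv_LeafVertex[of _ \<alpha> as Ds _ _ "[]"]) auto
  qed
next
  case (vertex_bit i q a b x)
  from vertex_bit(2) show ?case
  proof cases
    case (inv_LeafVertex \<alpha> as Ds v)
    then show ?thesis using vertex_bit(1)
      by (intro inv.inv_LeafVertex[of _ \<alpha> as Ds _ _ "x # v"]) auto
  qed
next
  case (leaf_ask i q a b)
  from leaf_ask(2) show ?case
  proof cases
    case (inv_LeafVertex \<alpha> as Ds v)
    then show ?thesis using leaf_ask(1)
      by (intro inv.inv_Ask[of _ as Ds _ _ v "[]"]) auto
  qed
next
  case (finish i q a b)
  from finish(2) show ?case
  proof cases
    case (inv_Main as Ds)
    then show ?thesis using finish(1) head_at_left[of ti last_pos]
      by (intro inv.inv_SkipTheory[of _ "last_pos - 1" as Ds]) (auto simp: last_pos_def)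
  qed
next
  case (skip_thy i q a b)
  from skip_thy(3) show ?case
  proof cases
    case (inv_SkipTheory p as Ds)
    then have "p \<noteq> pre" using skip_thy(1,2) head_at_read X_nth_bound(3) by auto
    then show ?thesis using skip_thy(2) inv_SkipTheory head_at_left[of ti p]
      by (intro inv.inv_SkipTheory[of _ "p - 1" as Ds]) auto
  qed
next
  case (skip_thy_end q a b)
  from skip_thy_end(2) show ?case
  proof cases
    case (inv_SkipTheory p as Ds)
    then have "p = pre" using skip_thy_end(1) head_at_read[of ti p] X_nth_theory[of p] by force
    then show ?thesis using skip_thy_end(1) inv_SkipTheory head_at_left[of ti p]
      by (intro inv.inv_SkipBound[of _ "p - 1" as Ds]) (auto simp: pre_def)
  qed
next
  case (skip_bound i q a b)
  from skip_bound(3) show ?case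
  proof cases
    case (inv_SkipBound p as Ds)
    then have "p \<noteq> length \<eta> + 1" using skip_bound(1,2) head_at_read X_nth_bound(1) by auto
    then show ?thesis using skip_bound(2) inv_SkipBound head_at_left[of ti p]
      by (intro inv.inv_SkipBound[of _ "p - 1" as Ds]) auto
  qed
next
  case (skip_bound_end q a b)
  from skip_bound_end(2) show ?case
  proof cases
    case (inv_SkipBound p as Ds)
    then have "p = length \<eta> + 1" using skip_bound_end(1) head_at_read[of ti p] X_nth_bound(2)[of p] by force
    then show ?thesis using skip_bound_end(1) inv_SkipBound head_at_left[of ti p]
      by (intro inv.inv_CopyGoal[of _ "p - 1" as Ds]) auto
  qed
next
  case (copy_goal x q a b)
  from copy_goal(2) show ?case
  proof cases
    case (inv_CopyGoal p as Ds)
    then have X: "X ! p = Some (bit_sym x)" using copy_goal(1) head_at_read by auto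
    then have p: "0 < p" using X_nth_0 by (cases p) auto
    then have "\<eta> ! (p - 1) = x" using X X_nth_goal[of p] inv_CopyGoal(2) by simp
    then have "drop (p - 1) \<eta> = x # drop p \<eta>"
      using p inv_CopyGoal(2) Cons_nth_drop_Suc[of "p - 1" \<eta>] by simp
    moreover have "tape_read ti = Some (bit_sym x)" "q = tape_read tq" "a = tape_read ta" "b = tape_read tb"
      using copy_goal(1) by simp_all
    ultimately show ?thesis using inv_CopyGoal p head_at_left[of ti p]
      by (intro inv.inv_CopyGoal[of _ "p - 1" as Ds]) auto
  qed
next
  case (copy_goal_end q a b)
  from copy_goal_end(2) show ?case
  proof cases
    case (inv_CopyGoal p as Ds)
    then have "p = 0" using copy_goal_end(1) head_at_read[of ti p] X_nth_goal[of p] by force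
    then show ?thesis using copy_goal_end(1) inv_CopyGoal head_at_right[of ti p]
      by (intro inv.inv_RootVertex[of _ as Ds _ _ "[]"]) (auto simp: last_pos_def)
  qed
next
  case (root_bit i q a b x)
  from root_bit(2) show ?case
  proof cases
    case (inv_RootVertex as Ds r)
    then show ?thesis using root_bit(1)
      by (intro inv.inv_RootVertex[of _ as Ds _ _ "x # r"]) auto
  qed
next
  case (root_ask i q a b)
  from root_ask(2) show ?case
  proof cases
    case (inv_RootVertex as Ds r)
    then show ?thesis using root_ask(1)
      by (intro inv.inv_AskRoot[of _ as Ds _ _ r]) auto
  qed
next
  case (to_bound i q a b)
  from to_bound(3) show ?case
  proof cases
    case (inv_ToBound p as Ds r)
    then have "p \<noteq> length \<eta> + 1" using to_bound(1,2) head_at_read X_nth_bound(1) by auto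
    then show ?thesis using to_bound(2) inv_ToBound head_at_right[of ti p]
      by (intro inv.inv_ToBound[of _ "Suc p" as Ds _ _ r]) (auto simp: last_pos_def pre_def)
  qed
next
  case (to_bound_end q a b)
  from to_bound_end(2) show ?case
  proof cases
    case (inv_ToBound p as Ds r)
    then have "p = length \<eta> + 1" using to_bound_end(1) head_at_read[of ti p] X_nth_goal[of p] by force
    then show ?thesis using to_bound_end(1) inv_ToBound head_at_right[of ti p]
      by (intro inv.inv_Compare[of _ "[]" as Ds r]) (auto simp: last_pos_def pre_def lists_def)
  qed
next
  case (compare_bit i q x)
  from compare_bit(2) show ?case
  proof cases
    case (inv_Compare z as Ds r u v)
    have ta: "tape_read ta = Some (bit_sym x)" using compare_bit(1) by (metis list.inject)
    then have "first_cell (map Some u) = Some (bit_sym x)" using inv_Compare(7) by simp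
    then obtain u' where u: "u = bit_sym x # u'" by (auto simp: first_cell_Some)
    have tb: "tape_read tb = Some (bit_sym x)" using compare_bit(1) by (metis list.inject)
    then have "first_cell (map Some v) = Some (bit_sym x)" using inv_Compare(9) by simp
    then obtain v' where v: "v = bit_sym x # v'" by (auto simp: first_cell_Some)
    moreover have "i = tape_read ti" "q = tape_read tq" using compare_bit(1) by simp_all
    ultimately show ?thesis using inv_Compare u ta tb head_at_stay[of ti]
      by (intro inv.inv_Compare[of _ "z @ [bit_sym x]" as Ds r u' v']) auto
  qed
next
  case (compare_hash q)
  from compare_hash(2) show ?case
  proof cases
    case (inv_Compare z as Ds r u v)
    have ta: "tape_read ta = Some Hash" using compare_hash(1) by (metis list.inject)
    then have "first_cell (map Some u) = Some Hash" using inv_Compare(7) by simp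
    then obtain u' where u: "u = Hash # u'" by (auto simp: first_cell_Some)
    have tb: "tape_read tb = Some Hash" using compare_hash(1) by (metis list.inject)
    then have "first_cell (map Some v) = Some Hash" using inv_Compare(9) by simp
    then obtain v' where v: "v = Hash # v'" by (auto simp: first_cell_Some)
    \<comment> \<open>After \<open>n\<close> separators the head is on the blank at
      \<open>pre\<close>, where the rule finds no 1. This is what enforces
      \<open>length as \<le> n\<close>.\<close>
    have "count_list z Hash \<noteq> n"
      using compare_hash(1) head_at_read[OF inv_Compare(1)] X_nth_bound(3) by (auto simp: pre_def)
    then have "count_list z Hash < n" using inv_Compare(2) by simp
    moreover have "tape_read ti = Some One" "q = tape_read tq" using compare_hash(1) by (metis list.inject)+
    ultimately show ?thesis using inv_Compare u v ta tb head_at_right[OF inv_Compare(1)]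
      by (intro inv.inv_Compare[of _ "z @ [Hash]" as Ds r u' v']) (auto simp: last_pos_def pre_def)
  qed
next
  case (compare_end i q)
  from compare_end(2) show ?case
  proof cases
    case (inv_Compare z as Ds r u v)
    have "tape_read ta = None" "tape_read tb = None" using compare_end(1) by simp_all
    then have "u = []" "v = []" using inv_Compare(7,9) by (metis first_cell_None)+
    then have "delimited as = delimited (r # concat Ds)" "delimited as = z" using inv_Compare by simp_all
    then have "as = r # concat Ds" "length as \<le> n"
      using delimited_inj inv_Compare(2) count_delimited[of as] by metis+
    then show ?thesis using inv_Compare(3,4)
      by (intro inv.inv_Accept[of as Ds]) (auto simp: bit_certificate_def)
  qed
qed

lemma inv_step:
  assumes inv: "inv s ti tq ta tb" and step: "step tree_machine Or (to_nat s, [ti, tq, ta, tb]) c"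
  shows "\<exists>s' ti' tq' ta' tb'. c = (to_nat s', [ti', tq', ta', tb']) \<and> inv s' ti' tq' ta' tb'"
  using step
proof (cases rule: tree_machine_step_cases)
  case (1 s' ai aq aa ab)
  then show ?thesis using inv_rule[OF 1(1) _ inv] by (fastforce simp: numeral_eq_Suc)
next
  case 2
  have "inv (if tape_word tq \<in> Or then Answered else Reject) ti tq ta tb"
  proof (cases "tape_word tq \<in> Or")
    case True
    from inv 2(1) have "inv Ask ti tq ta tb" by simp
    then show ?thesis
    proof cases
      case (inv_Ask as Ds v C)
      \<comment> \<open>The positive answer turns the guess into a new pair: \<open>v\<close> is
        added to the confirmed vertices and \<open>C\<close> to the witness
        \<open>Ds\<close>.\<close>
      then show ?thesis using True by (auto intro: inv_Answered[of _ "v # as" "C # Ds"])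
    qed
  qed (simp add: inv_Reject)
  then show ?thesis using 2 by blast
next
  case 3
  have "inv (if tape_word tq \<in> Or then ToBound else Reject) ti tq ta tb"
  proof (cases "tape_word tq \<in> Or")
    case True
    from inv 3(1) have "inv AskRoot ti tq ta tb" by simp
    then show ?thesis
    proof cases
      case (inv_AskRoot as Ds r)
      then show ?thesis using True by (auto intro: inv_ToBound[of _ 1 as Ds _ _ r])
    qed
  qed (simp add: inv_Reject)
  then show ?thesis using 3 by blast
qed

lemma tree_machine_simps [simp]:
  "ntapes tree_machine = 4" "start_state tree_machine = to_nat Init" "accept_state tree_machine = to_nat Accept"
  by (simp_all add: tree_machine_def)

lemma late_initial_tree_machine:
  "late_initial tree_machine input =
     (to_nat Init, [(map Some (rev input), [None]), ([], [None]), ([], [None]), ([], [None])])"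
  by (simp add: late_initial_def numeral_eq_Suc)

lemma tree_machine_sound:
  assumes "(step tree_machine Or)\<^sup>*\<^sup>* (late_initial tree_machine input) (accept_state tree_machine, tps)"
  shows "\<exists>as Ds. bit_certificate Or \<eta> (set \<theta>s) as Ds \<and> length as \<le> n"
proof -
  have "\<exists>s ti tq ta tb. c = (to_nat s, [ti, tq, ta, tb]) \<and> inv s ti tq ta tb"
    if "(step tree_machine Or)\<^sup>*\<^sup>* (late_initial tree_machine input) c" for c
    using that
  proof (induction rule: rtranclp_induct)
    case base
    have "inv Init (map Some (rev input), [None]) ([], [None]) ([], [None]) ([], [None])"
      by (rule inv_Init) (simp_all add: tape_read_def rest_def qword_def lists_def)
    then show ?case using late_initial_tree_machine by blast
  next
    case (step c c')
    then show ?case using inv_step by blast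
  qed
  from this[OF assms] obtain ti tq ta tb where "inv Accept ti tq ta tb" by auto
  then show ?thesis by cases auto
qed


subsection \<open>Accepting runs\<close>

text \<open>All configurations with \<open>P\<close> are considered, because descriptions such as
  \<open>cfg\<close> leave open what a run ignores, for example old queries. An upper bound in place
  of an exact number of steps allows rounding by \<open>reaches_mono\<close>.\<close>

definition reaches :: "nat \<Rightarrow> (config \<Rightarrow> bool) \<Rightarrow> (config \<Rightarrow> bool) \<Rightarrow> bool" where
  "reaches k P Q \<longleftrightarrow> (\<forall>c. P c \<longrightarrow> (\<exists>j\<le>k. \<exists>c'. (step tree_machine Or ^^ j) c c' \<and> Q c'))"

lemma reaches_refl: "reaches 0 P P"
  unfolding reaches_def by (metis le_refl relpowp_0_I)

lemma reaches_mono: "reaches j P Q \<Longrightarrow> j \<le> k \<Longrightarrow> reaches k P Q"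
  unfolding reaches_def by (meson le_trans)

lemma reaches_trans [trans]: "reaches j P Q \<Longrightarrow> reaches k Q R \<Longrightarrow> reaches (j + k) P R"
  unfolding reaches_def by (meson add_le_mono relpowp_trans)

lemma reaches_step: "(\<And>c. P c \<Longrightarrow> \<exists>c'. step tree_machine Or c c' \<and> Q c') \<Longrightarrow> reaches 1 P Q"
  unfolding reaches_def by (metis le_refl relpowp_1)

definition cfg :: "state \<Rightarrow> nat \<Rightarrow> (tape \<Rightarrow> bool) \<Rightarrow> bool list list \<Rightarrow> bool list list \<Rightarrow> config \<Rightarrow> bool" where
  "cfg s p Q as bs c \<longleftrightarrow>
     (\<exists>ti tq ta tb. c = (to_nat s, [ti, tq, ta, tb]) \<and> head_at ti p \<and> Q tq \<and> lists ta tb as bs)"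

definition qw :: "sym list \<Rightarrow> tape \<Rightarrow> bool" where "qw w tp \<longleftrightarrow> qword tp = w"

definition tw :: "sym list \<Rightarrow> tape \<Rightarrow> bool" where "tw w tp \<longleftrightarrow> tape_word tp = w"

lemma reaches_cfg:
  assumes "\<And>ti tq ta tb. head_at ti p \<Longrightarrow> Q tq \<Longrightarrow> lists ta tb as bs \<Longrightarrow>
    \<exists>ai aq aa ab. rule s [tape_read ti, tape_read tq, tape_read ta, tape_read tb] s' [ai, aq, aa, ab] \<and>
      head_at (tape_act ai ti) p' \<and> Q' (tape_act aq tq) \<and> lists (tape_act aa ta) (tape_act ab tb) as' bs'"
  shows "reaches 1 (cfg s p Q as bs) (cfg s' p' Q' as' bs')"
proof (rule reaches_step)
  fix c assume "cfg s p Q as bs c"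
  then obtain ti tq ta tb where c: "c = (to_nat s, [ti, tq, ta, tb])" and *: "head_at ti p" "Q tq" "lists ta tb as bs"
    unfolding cfg_def by blast
  obtain ai aq aa ab where
    r: "rule s [tape_read ti, tape_read tq, tape_read ta, tape_read tb] s' [ai, aq, aa, ab]"
    "head_at (tape_act ai ti) p'" "Q' (tape_act aq tq)" "lists (tape_act aa ta) (tape_act ab tb) as' bs'"
    using assms[OF *] by blast
  show "\<exists>c'. step tree_machine Or c c' \<and> cfg s' p' Q' as' bs' c'"
    using tree_machine_step[OF r(1), of Or] r(2-) unfolding c cfg_def by blast
qed

lemma reaches_ask:
  "w \<in> Or \<Longrightarrow> reaches 1 (cfg Ask p (tw w) as bs) (cfg Answered p (\<lambda>_. True) as bs)"
  "w \<in> Or \<Longrightarrow> reaches 1 (cfg AskRoot p (tw w) as bs) (cfg ToBound p (\<lambda>_. True) as bs)"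
proof -
  assume w: "w \<in> Or"
  show "reaches 1 (cfg Ask p (tw w) as bs) (cfg Answered p (\<lambda>_. True) as bs)"
  proof (rule reaches_step)
    fix c assume "cfg Ask p (tw w) as bs c"
    then obtain ti tq ta tb where c: "c = (to_nat Ask, [ti, tq, ta, tb])" "head_at ti p" "tape_word tq = w"
      "lists ta tb as bs" unfolding cfg_def tw_def by blast
    have "(to_nat Ask, to_nat Answered, to_nat Reject) \<in> queries tree_machine"
      by (simp add: tree_machine_def)
    from step.step_query[OF this, of Or "[ti, tq, ta, tb]"]
    have "step tree_machine Or c (to_nat Answered, [ti, tq, ta, tb])" using w c by simp
    moreover have "cfg Answered p (\<lambda>_. True) as bs (to_nat Answered, [ti, tq, ta, tb])"
      unfolding cfg_def using c by blast
    ultimately show "\<exists>c'. step tree_machine Or c c' \<and> cfg Answered p (\<lambda>_. True) as bs c'" by blast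
  qed
  show "reaches 1 (cfg AskRoot p (tw w) as bs) (cfg ToBound p (\<lambda>_. True) as bs)"
  proof (rule reaches_step)
    fix c assume "cfg AskRoot p (tw w) as bs c"
    then obtain ti tq ta tb where c: "c = (to_nat AskRoot, [ti, tq, ta, tb])" "head_at ti p" "tape_word tq = w"
      "lists ta tb as bs" unfolding cfg_def tw_def by blast
    have "(to_nat AskRoot, to_nat ToBound, to_nat Reject) \<in> queries tree_machine"
      by (simp add: tree_machine_def)
    from step.step_query[OF this, of Or "[ti, tq, ta, tb]"]
    have "step tree_machine Or c (to_nat ToBound, [ti, tq, ta, tb])" using w c by simp
    moreover have "cfg ToBound p (\<lambda>_. True) as bs (to_nat ToBound, [ti, tq, ta, tb])"
      unfolding cfg_def using c by blast
    ultimately show "\<exists>c'. step tree_machine Or c c' \<and> cfg ToBound p (\<lambda>_. True) as bs c'" by blast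
  qed
qed

lemma reaches_left:
  assumes "0 < p"
    and "\<And>q a b. rule s [X ! p, q, a, b] s' [(X ! p, MoveL), (q, Stay), (a, Stay), (b, Stay)]"
  shows "reaches 1 (cfg s p (qw w) as bs) (cfg s' (p - 1) (qw w) as bs)"
proof (rule reaches_cfg)
  fix ti tq ta tb assume *: "head_at ti p" "qw w tq" "lists ta tb as bs"
  then have "head_at (tape_act (X ! p, MoveL) ti) (p - 1)"
    using head_at_left assms(1) head_at_read by metis
  with * assms(2)[of "tape_read tq" "tape_read ta" "tape_read tb"] head_at_read[OF *(1)]
  show "\<exists>ai aq aa ab. rule s [tape_read ti, tape_read tq, tape_read ta, tape_read tb] s' [ai, aq, aa, ab] \<and>
      head_at (tape_act ai ti) (p - 1) \<and> qw w (tape_act aq tq) \<and> lists (tape_act aa ta) (tape_act ab tb) as bs"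
    by (intro exI conjI) (auto simp: qw_def)
qed

lemma reaches_right:
  assumes "p < last_pos" "Q = qw w \<or> Q = (\<lambda>_. True)"
    and "\<And>q a b. rule s [X ! p, q, a, b] s' [(X ! p, MoveR), (q, Stay), (a, Stay), (b, Stay)]"
  shows "reaches 1 (cfg s p Q as bs) (cfg s' (Suc p) Q as bs)"
proof (rule reaches_cfg)
  fix ti tq ta tb assume *: "head_at ti p" "Q tq" "lists ta tb as bs"
  then have "head_at (tape_act (X ! p, MoveR) ti) (Suc p)"
    using head_at_right assms(1) head_at_read by metis
  with * assms(2,3) assms(3)[of "tape_read tq" "tape_read ta" "tape_read tb"] head_at_read[OF *(1)]
  show "\<exists>ai aq aa ab. rule s [tape_read ti, tape_read tq, tape_read ta, tape_read tb] s' [ai, aq, aa, ab] \<and>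
      head_at (tape_act ai ti) (Suc p) \<and> Q (tape_act aq tq) \<and> lists (tape_act aa ta) (tape_act ab tb) as bs"
    by (intro exI conjI) (auto simp: qw_def)
qed

lemma reaches_left_many:
  assumes "\<And>i q a b. i \<noteq> None \<Longrightarrow> rule s [i, q, a, b] s [(i, MoveL), (q, Stay), (a, Stay), (b, Stay)]"
    and "\<And>p'. p < p' \<Longrightarrow> p' \<le> p + k \<Longrightarrow> X ! p' \<noteq> None"
  shows "reaches k (cfg s (p + k) (qw w) as bs) (cfg s p (qw w) as bs)"
  using assms(2)
proof (induction k)
  case (Suc k)
  have "reaches 1 (cfg s (p + Suc k) (qw w) as bs) (cfg s (p + Suc k - 1) (qw w) as bs)"
    by (rule reaches_left) (use assms(1) Suc.prems in auto)
  also have "reaches k (cfg s (p + Suc k - 1) (qw w) as bs) (cfg s p (qw w) as bs)"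
    using Suc by simp
  finally show ?case by simp
qed (simp add: reaches_refl)

lemma reaches_right_many:
  assumes "\<And>i q a b. i \<noteq> None \<Longrightarrow> rule s [i, q, a, b] s [(i, MoveR), (q, Stay), (a, Stay), (b, Stay)]"
    and "Q = qw w \<or> Q = (\<lambda>_. True)" and "p + k \<le> last_pos"
    and "\<And>p'. p \<le> p' \<Longrightarrow> p' < p + k \<Longrightarrow> X ! p' \<noteq> None"
  shows "reaches k (cfg s p Q as bs) (cfg s (p + k) Q as bs)"
  using assms(3,4)
proof (induction k)
  case (Suc k)
  then have "reaches k (cfg s p Q as bs) (cfg s (p + k) Q as bs)" by simp
  also have "reaches 1 (cfg s (p + k) Q as bs) (cfg s (Suc (p + k)) Q as bs)"
    by (rule reaches_right[OF _ assms(2)]) (use assms(1) Suc.prems in auto)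
  finally show ?case by simp
qed (simp add: reaches_refl)

text \<open>Bits are guessed from the last to the first, so the query and the stack both grow at the
  front of \<open>v\<close>, and induction on \<open>v\<close> follows the run.\<close>

lemma push_vertex:
  assumes "s \<in> {EdgeConcl, LeafVertex}"
  shows "reaches (length v) (cfg s p (qw (Hash # w)) ([] # as) bs)
    (cfg s p (qw (word_of_bits v @ Hash # w)) (v # as) bs)"
proof (induction v)
  case (Cons x v)
  note Cons
  also have "reaches 1 (cfg s p (qw (word_of_bits v @ Hash # w)) (v # as) bs)
    (cfg s p (qw (word_of_bits (x # v) @ Hash # w)) ((x # v) # as) bs)"
  proof (rule reaches_cfg)
    fix ti tq ta tb
    assume *: "head_at ti p" "qw (word_of_bits v @ Hash # w) tq" "lists ta tb (v # as) bs"
    have r: "rule s [tape_read ti, tape_read tq, tape_read ta, tape_read tb] s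
      [(tape_read ti, Stay), (Some (bit_sym x), MoveL), (Some (bit_sym x), MoveR), (tape_read tb, Stay)]"
      using assms by (auto intro: rule.intros)
    show "\<exists>ai aq aa ab. rule s [tape_read ti, tape_read tq, tape_read ta, tape_read tb] s [ai, aq, aa, ab] \<and>
        head_at (tape_act ai ti) p \<and> qw (word_of_bits (x # v) @ Hash # w) (tape_act aq tq) \<and>
        lists (tape_act aa ta) (tape_act ab tb) ((x # v) # as) bs"
      by (intro exI conjI, rule r) (use * head_at_stay in \<open>auto simp: qw_def\<close>)
  qed
  finally show ?case by simp
qed (simp add: reaches_refl)

lemma push_child:
  assumes "s \<in> {EdgePrem, RootVertex}"
  shows "reaches (length v) (cfg s p (qw (Hash # w)) as ([] # bs))
    (cfg s p (qw (word_of_bits v @ Hash # w)) as (v # bs))"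
proof (induction v)
  case (Cons x v)
  note Cons
  also have "reaches 1 (cfg s p (qw (word_of_bits v @ Hash # w)) as (v # bs))
    (cfg s p (qw (word_of_bits (x # v) @ Hash # w)) as ((x # v) # bs))"
  proof (rule reaches_cfg)
    fix ti tq ta tb
    assume *: "head_at ti p" "qw (word_of_bits v @ Hash # w) tq" "lists ta tb as (v # bs)"
    have r: "rule s [tape_read ti, tape_read tq, tape_read ta, tape_read tb] s
      [(tape_read ti, Stay), (Some (bit_sym x), MoveL), (tape_read ta, Stay), (Some (bit_sym x), MoveR)]"
      using assms by (auto intro: rule.intros)
    show "\<exists>ai aq aa ab. rule s [tape_read ti, tape_read tq, tape_read ta, tape_read tb] s [ai, aq, aa, ab] \<and>
        head_at (tape_act ai ti) p \<and> qw (word_of_bits (x # v) @ Hash # w) (tape_act aq tq) \<and>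
        lists (tape_act aa ta) (tape_act ab tb) as ((x # v) # bs)"
      by (intro exI conjI, rule r) (use * head_at_stay in \<open>auto simp: qw_def\<close>)
  qed
  finally show ?case by simp
qed (simp add: reaches_refl)

text \<open>The final state depends on \<open>C\<close>: without children the machine is still in
  \<open>EdgeConcl\<close>.\<close>

lemma push_children:
  "\<exists>s\<in>{EdgeConcl, EdgePrem}. reaches (length (delimited C))
    (cfg EdgeConcl p (qw (delimited [v])) as bs) (cfg s p (qw (delimited (C @ [v]))) as (C @ bs))"
proof (induction C)
  case Nil
  show ?case using reaches_refl by auto
next
  case (Cons u C)
  then obtain s where s: "s \<in> {EdgeConcl, EdgePrem}" and r: "reaches (length (delimited C))
    (cfg EdgeConcl p (qw (delimited [v])) as bs) (cfg s p (qw (delimited (C @ [v]))) as (C @ bs))"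
    by blast
  note r
  also have "reaches 1 (cfg s p (qw (delimited (C @ [v]))) as (C @ bs))
    (cfg EdgePrem p (qw (Hash # delimited (C @ [v]))) as ([] # C @ bs))"
  proof (rule reaches_cfg)
    fix ti tq ta tb
    assume *: "head_at ti p" "qw (delimited (C @ [v])) tq" "lists ta tb as (C @ bs)"
    have r: "rule s [tape_read ti, tape_read tq, tape_read ta, tape_read tb] EdgePrem
      [(tape_read ti, Stay), (Some Hash, MoveL), (tape_read ta, Stay), (Some Hash, MoveR)]"
      using s by (rule concl_end)
    show "\<exists>ai aq aa ab. rule s [tape_read ti, tape_read tq, tape_read ta, tape_read tb] EdgePrem [ai, aq, aa, ab] \<and>
        head_at (tape_act ai ti) p \<and> qw (Hash # delimited (C @ [v])) (tape_act aq tq) \<and>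
        lists (tape_act aa ta) (tape_act ab tb) as ([] # C @ bs)"
      by (intro exI conjI, rule r) (use * head_at_stay in \<open>auto simp: qw_def\<close>)
  qed
  also have "reaches (length u) (cfg EdgePrem p (qw (Hash # delimited (C @ [v]))) as ([] # C @ bs))
    (cfg EdgePrem p (qw (word_of_bits u @ Hash # delimited (C @ [v]))) as (u # C @ bs))"
    by (rule push_child) simp
  finally have "reaches (length (delimited C) + 1 + length u) (cfg EdgeConcl p (qw (delimited [v])) as bs)
    (cfg EdgePrem p (qw (delimited ((u # C) @ [v]))) as ((u # C) @ bs))" by simp
  then show ?case
    by (intro bexI[of _ EdgePrem]) (auto elim: reaches_mono)
qed

lemma reaches_tag:
  assumes "\<And>i q a b. rule s [i, q, a, b] s' [(i, Stay), (Some t, Stay), (a, Stay), (b, Stay)]"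
  shows "reaches 1 (cfg s p (qw w) as bs) (cfg s' p (tw (t # w)) as bs)"
proof (rule reaches_cfg)
  fix ti tq ta tb
  assume *: "head_at ti p" "qw w tq" "lists ta tb as bs"
  show "\<exists>ai aq aa ab. rule s [tape_read ti, tape_read tq, tape_read ta, tape_read tb] s' [ai, aq, aa, ab] \<and>
      head_at (tape_act ai ti) p \<and> tw (t # w) (tape_act aq tq) \<and> lists (tape_act aa ta) (tape_act ab tb) as bs"
    by (intro exI conjI, rule assms) (use * head_at_stay in \<open>auto simp: qw_def tw_def\<close>)
qed

lemma reaches_answered:
  "reaches 1 (cfg Answered p (\<lambda>_. True) as bs) (cfg Main p (qw []) as bs)"
proof (rule reaches_cfg)
  fix ti tq ta tb
  assume *: "head_at ti p" "lists ta tb as bs"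
  show "\<exists>ai aq aa ab. rule Answered [tape_read ti, tape_read tq, tape_read ta, tape_read tb] Main [ai, aq, aa, ab] \<and>
      head_at (tape_act ai ti) p \<and> qw [] (tape_act aq tq) \<and> lists (tape_act aa ta) (tape_act ab tb) as bs"
    by (intro exI conjI, rule answered) (use * head_at_stay in \<open>auto simp: qw_def\<close>)
qed

text \<open>The 4 steps are the choice of the branch, the tag, the query and the blank that cuts it
  off. Each of the others writes one symbol.\<close>

lemma edge_run:
  assumes "Zero # delimited (C @ [v]) \<in> Or"
  shows "reaches (length v + length (delimited C) + 4) (cfg Main p (qw []) as bs) (cfg Main p (qw []) (v # as) (C @ bs))"
proof -
  have "reaches 1 (cfg Main p (qw []) as bs) (cfg EdgeConcl p (qw (Hash # [])) ([] # as) bs)"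
  proof (rule reaches_cfg)
    fix ti tq ta tb
    assume *: "head_at ti p" "qw [] tq" "lists ta tb as bs"
    show "\<exists>ai aq aa ab. rule Main [tape_read ti, tape_read tq, tape_read ta, tape_read tb] EdgeConcl [ai, aq, aa, ab] \<and>
        head_at (tape_act ai ti) p \<and> qw (Hash # []) (tape_act aq tq) \<and> lists (tape_act aa ta) (tape_act ab tb) ([] # as) bs"
      by (intro exI conjI, rule edge) (use * head_at_stay in \<open>auto simp: qw_def\<close>)
  qed
  also have "reaches (length v) (cfg EdgeConcl p (qw (Hash # [])) ([] # as) bs)
      (cfg EdgeConcl p (qw (word_of_bits v @ Hash # [])) (v # as) bs)"
    by (rule push_vertex) simp
  finally have 1: "reaches (1 + length v) (cfg Main p (qw []) as bs)
      (cfg EdgeConcl p (qw (delimited [v])) (v # as) bs)" by simp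
  obtain s where s: "s \<in> {EdgeConcl, EdgePrem}" and 2: "reaches (length (delimited C))
      (cfg EdgeConcl p (qw (delimited [v])) (v # as) bs) (cfg s p (qw (delimited (C @ [v]))) (v # as) (C @ bs))"
    using push_children[of C p v "v # as" bs] by blast
  note 1
  also note 2
  also have "reaches 1 (cfg s p (qw (delimited (C @ [v]))) (v # as) (C @ bs))
      (cfg Ask p (tw (Zero # delimited (C @ [v]))) (v # as) (C @ bs))"
    by (rule reaches_tag) (rule edge_ask[OF s])
  also note reaches_ask(1)[OF assms]
  also note reaches_answered
  finally show ?thesis by (rule reaches_mono) simp
qed

lemma X_nth_not_None: "pre < p \<Longrightarrow> p < last_pos \<Longrightarrow> X ! p \<noteq> None"
  using X_nth_theory by simp

lemma copy_run:
  assumes "X ! (p + length \<alpha> + 1) = Some Hash" "\<And>i. i < length \<alpha> \<Longrightarrow> X ! (p + 1 + i) = Some (bit_sym (\<alpha> ! i))"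
  shows "reaches (length \<alpha>) (cfg LeafCopy (p + length \<alpha>) (qw w) as bs) (cfg LeafCopy p (qw (word_of_bits \<alpha> @ w)) as bs)"
  using assms
proof (induction \<alpha> arbitrary: p)
  case (Cons x \<alpha>)
  have "reaches (length \<alpha>) (cfg LeafCopy (Suc p + length \<alpha>) (qw w) as bs)
      (cfg LeafCopy (Suc p) (qw (word_of_bits \<alpha> @ w)) as bs)"
  proof (rule Cons.IH)
    show "X ! (Suc p + 1 + i) = Some (bit_sym (\<alpha> ! i))" if "i < length \<alpha>" for i
      using Cons.prems(2)[of "Suc i"] that by simp
  qed (use Cons.prems(1) in simp)
  also have "reaches 1 (cfg LeafCopy (Suc p) (qw (word_of_bits \<alpha> @ w)) as bs)
      (cfg LeafCopy p (qw (word_of_bits (x # \<alpha>) @ w)) as bs)"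
  proof (rule reaches_cfg)
    fix ti tq ta tb
    assume *: "head_at ti (Suc p)" "qw (word_of_bits \<alpha> @ w) tq" "lists ta tb as bs"
    have t: "tape_read ti = Some (bit_sym x)" using head_at_read[OF *(1)] Cons.prems(2)[of 0] by simp
    have left: "head_at (tape_act (tape_read ti, MoveL) ti) p" using head_at_left[OF *(1)] by simp
    show "\<exists>ai aq aa ab. rule LeafCopy [tape_read ti, tape_read tq, tape_read ta, tape_read tb] LeafCopy [ai, aq, aa, ab] \<and>
        head_at (tape_act ai ti) p \<and> qw (word_of_bits (x # \<alpha>) @ w) (tape_act aq tq) \<and> lists (tape_act aa ta) (tape_act ab tb) as bs"
      unfolding t by (intro exI conjI, rule copy) (use * left t in \<open>auto simp: qw_def\<close>)
  qed
  finally show ?case by simp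
qed (simp add: reaches_refl)

lemma leaf_run:
  assumes \<alpha>: "\<alpha> \<in> set \<theta>s" and Or: "One # word_of_bits v @ Hash # word_of_bits \<alpha> \<in> Or"
  shows "reaches (2 * last_pos + length v + 7) (cfg Main last_pos (qw []) as bs) (cfg Main last_pos (qw []) (v # as) bs)"
proof -
  obtain \<theta>1 \<theta>2 where \<theta>s: "\<theta>s = \<theta>1 @ \<alpha> # \<theta>2" using \<alpha> by (metis split_list)
  \<comment> \<open>\<open>p\<close> is the cell before the block of \<open>\<alpha>\<close>, and
    \<open>e\<close> is the separator that closes the block. The run seeks \<open>e\<close>, copies
    back to \<open>p\<close> and returns to the end of the input.\<close>
  define p where "p = pre + length (delimited \<theta>1)"
  define e where "e = p + length \<alpha> + 1"
  have e: "e < last_pos" unfolding e_def p_def last_pos_def by (simp add: \<theta>s)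
  have pe: "pre < e" and pp: "pre \<le> p" by (simp_all add: e_def p_def)
  have eq: "e + (last_pos - 1 - e) = last_pos - 1" "Suc p + (last_pos - Suc p) = last_pos"
    using e by (simp_all add: e_def)
  have X_e: "X ! e = Some Hash"
    using X_nth_theory[of e] e by (simp add: e_def p_def \<theta>s nth_append)
  have X_\<alpha>: "X ! (p + 1 + i) = Some (bit_sym (\<alpha> ! i))" if "i < length \<alpha>" for i
    using X_nth_theory[of "p + 1 + i"] e that by (simp add: e_def p_def \<theta>s nth_append)
  have X_p: "X ! p \<in> {None, Some Hash}"
  proof (cases "\<theta>1 = []")
    case False
    then obtain \<beta> \<theta>3 where b: "\<theta>1 = \<theta>3 @ [\<beta>]" by (metis rev_exhaust)
    show ?thesis using X_nth_theory[of p] e by (simp add: e_def p_def \<theta>s b nth_append)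
  qed (simp add: p_def X_nth_bound)
  have "reaches 1 (cfg Main last_pos (qw []) as bs) (cfg LeafSeek (last_pos - 1) (qw []) as bs)"
    by (rule reaches_left) (auto simp: last_pos_def intro: leaf)
  also have "reaches (last_pos - 1 - e) (cfg LeafSeek (last_pos - 1) (qw []) as bs) (cfg LeafSeek e (qw []) as bs)"
    by (rule reaches_left_many[of LeafSeek e "last_pos - 1 - e", OF seek, unfolded eq(1)])
      (assumption, rule X_nth_not_None, (use e pe in simp)+)
  also have "reaches 1 (cfg LeafSeek e (qw []) as bs) (cfg LeafCopy (e - 1) (qw []) as bs)"
    by (rule reaches_left) (simp add: e_def, simp add: X_e seek_end)
  also have "reaches (length \<alpha>) (cfg LeafCopy (e - 1) (qw []) as bs) (cfg LeafCopy p (qw (word_of_bits \<alpha>)) as bs)"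
    using copy_run[of p \<alpha> "[]"] X_e X_\<alpha> by (simp add: e_def)
  also have "reaches 1 (cfg LeafCopy p (qw (word_of_bits \<alpha>)) as bs) (cfg LeafReturn (Suc p) (qw (word_of_bits \<alpha>)) as bs)"
    by (rule reaches_right) (use e X_p in \<open>auto simp: e_def intro: copy_end\<close>)
  also have "reaches (last_pos - Suc p) (cfg LeafReturn (Suc p) (qw (word_of_bits \<alpha>)) as bs)
      (cfg LeafReturn last_pos (qw (word_of_bits \<alpha>)) as bs)"
    by (rule reaches_right_many[of LeafReturn "qw (word_of_bits \<alpha>)" "word_of_bits \<alpha>" "Suc p" "last_pos - Suc p",
        OF return, unfolded eq(2)])
      (assumption, simp, simp, rule X_nth_not_None, (use pp in simp)+)
  also have "reaches 1 (cfg LeafReturn last_pos (qw (word_of_bits \<alpha>)) as bs)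
      (cfg LeafVertex last_pos (qw (Hash # word_of_bits \<alpha>)) ([] # as) bs)"
  proof (rule reaches_cfg)
    fix ti tq ta tb
    assume *: "head_at ti last_pos" "qw (word_of_bits \<alpha>) tq" "lists ta tb as bs"
    have t: "tape_read ti = None" using head_at_read[OF *(1)] X_nth_last by simp
    show "\<exists>ai aq aa ab. rule LeafReturn [tape_read ti, tape_read tq, tape_read ta, tape_read tb] LeafVertex [ai, aq, aa, ab] \<and>
        head_at (tape_act ai ti) last_pos \<and> qw (Hash # word_of_bits \<alpha>) (tape_act aq tq) \<and>
        lists (tape_act aa ta) (tape_act ab tb) ([] # as) bs"
      unfolding t by (intro exI conjI, rule return_end) (use * head_at_stay[OF *(1)] t in \<open>auto simp: qw_def\<close>)
  qed
  also have "reaches (length v) (cfg LeafVertex last_pos (qw (Hash # word_of_bits \<alpha>)) ([] # as) bs)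
      (cfg LeafVertex last_pos (qw (word_of_bits v @ Hash # word_of_bits \<alpha>)) (v # as) bs)"
    by (rule push_vertex) simp
  also have "reaches 1 (cfg LeafVertex last_pos (qw (word_of_bits v @ Hash # word_of_bits \<alpha>)) (v # as) bs)
      (cfg Ask last_pos (tw (One # word_of_bits v @ Hash # word_of_bits \<alpha>)) (v # as) bs)"
    by (rule reaches_tag) (rule leaf_ask)
  also note reaches_ask(1)[OF Or]
  also note reaches_answered
  finally show ?thesis by (rule reaches_mono) (use e in \<open>simp add: e_def\<close>)
qed

text \<open>The run for \<open>v # as\<close> processes \<open>as\<close> first and then puts
  \<open>v\<close> on top, so induction on the lists fits the backward guessing.\<close>

lemma main_run:
  assumes "list_all2 node as Ds"
  shows "reaches (length as * (2 * last_pos + 7) + length (delimited as) + length (delimited (concat Ds)))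
    (cfg Main last_pos (qw []) [] []) (cfg Main last_pos (qw []) as (concat Ds))"
  using assms
proof (induction as Ds rule: list_all2_induct)
  case Nil
  show ?case using reaches_refl by simp
next
  case (Cons v as C Ds)
  note Cons.IH
  also have "reaches (2 * last_pos + length v + length (delimited C) + 7)
      (cfg Main last_pos (qw []) as (concat Ds)) (cfg Main last_pos (qw []) (v # as) (C @ concat Ds))"
  proof (cases "Zero # delimited (C @ [v]) \<in> Or")
    case True
    from edge_run[OF this] show ?thesis by (rule reaches_mono) simp
  next
    case False
    then obtain \<alpha> where "C = []" "\<alpha> \<in> set \<theta>s" "One # word_of_bits v @ Hash # word_of_bits \<alpha> \<in> Or"
      using Cons.hyps by auto
    from leaf_run[OF this(2,3)] \<open>C = []\<close> show ?thesis by simp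
  qed
  finally show ?case unfolding concat.simps by (rule reaches_mono) simp
qed

lemma copy_goal_run:
  "p \<le> length \<eta> \<Longrightarrow> reaches p (cfg CopyGoal p (qw (word_of_bits (drop p \<eta>))) as bs) (cfg CopyGoal 0 (qw (word_of_bits \<eta>)) as bs)"
proof (induction p)
  case 0
  then show ?case using reaches_refl by simp
next
  case (Suc p)
  have "reaches 1 (cfg CopyGoal (Suc p) (qw (word_of_bits (drop (Suc p) \<eta>))) as bs)
      (cfg CopyGoal p (qw (word_of_bits (drop p \<eta>))) as bs)"
  proof (rule reaches_cfg)
    fix ti tq ta tb
    assume *: "head_at ti (Suc p)" "qw (word_of_bits (drop (Suc p) \<eta>)) tq" "lists ta tb as bs"
    have t: "tape_read ti = Some (bit_sym (\<eta> ! p))"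
      using head_at_read[OF *(1)] X_nth_goal[of "Suc p"] Suc.prems by simp
    have left: "head_at (tape_act (tape_read ti, MoveL) ti) p" using head_at_left[OF *(1)] by simp
    have "drop p \<eta> = \<eta> ! p # drop (Suc p) \<eta>" using Suc.prems by (simp add: Cons_nth_drop_Suc)
    then show "\<exists>ai aq aa ab. rule CopyGoal [tape_read ti, tape_read tq, tape_read ta, tape_read tb] CopyGoal [ai, aq, aa, ab] \<and>
        head_at (tape_act ai ti) p \<and> qw (word_of_bits (drop p \<eta>)) (tape_act aq tq) \<and>
        lists (tape_act aa ta) (tape_act ab tb) as bs"
      unfolding t by - (intro exI conjI, rule copy_goal, use * left t in \<open>auto simp: qw_def\<close>)
  qed
  also note Suc.IH
  finally show ?case using Suc.prems by simp
qed

text \<open>A single \<open>x\<close> describes both tapes, as their contents agree in an accepting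
  run.\<close>

definition compare_cfg :: "nat \<Rightarrow> sym list \<Rightarrow> config \<Rightarrow> bool" where
  "compare_cfg j x c \<longleftrightarrow>
     (\<exists>ti tq ta tb. c = (to_nat Compare, [ti, tq, ta, tb]) \<and> head_at ti (length \<eta> + 2 + j) \<and>
       tape_read ta = first_cell (map Some x) \<and> fst ta = tl (map Some x) \<and>
       tape_read tb = first_cell (map Some x) \<and> fst tb = tl (map Some x))"

lemma sym_cases: obtains b where "x = bit_sym b" | "x = Hash"
  by (cases x) (use that(1)[of False] that(1)[of True] that(2) in \<open>simp_all add: bit_sym_def\<close>)

lemma compare_run:
  "j + count_list x Hash \<le> n \<Longrightarrow> reaches (length x) (compare_cfg j x) (compare_cfg (j + count_list x Hash) [])"
proof (induction x arbitrary: j)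
  case Nil
  then show ?case using reaches_refl by simp
next
  case (Cons a x)
  let ?j = "if a = Hash then Suc j else j"
  have "reaches 1 (compare_cfg j (a # x)) (compare_cfg ?j x)"
  proof (rule reaches_step)
    fix c assume "compare_cfg j (a # x) c"
    then obtain ti tq ta tb where c: "c = (to_nat Compare, [ti, tq, ta, tb])" "head_at ti (length \<eta> + 2 + j)"
      "tape_read ta = Some a" "fst ta = map Some x" "tape_read tb = Some a" "fst tb = map Some x"
      unfolding compare_cfg_def by auto
    show "\<exists>c'. step tree_machine Or c c' \<and> compare_cfg ?j x c'"
    proof (cases a rule: sym_cases)
      case (1 b)
      have "rule Compare [tape_read ti, tape_read tq, tape_read ta, tape_read tb] Compare
          [(tape_read ti, Stay), (tape_read tq, Stay), (Some (bit_sym b), MoveL), (Some (bit_sym b), MoveL)]"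
        using c 1 by (simp add: compare_bit)
      from tree_machine_step[OF this, of Or] show ?thesis
        using c head_at_stay[OF c(2)] 1 unfolding compare_cfg_def by fastforce
    next
      case 2
      have "j < n" using Cons.prems 2 by simp
      then have t: "tape_read ti = Some One"
        using head_at_read[OF c(2)] X_nth_bound(2)[of "length \<eta> + 2 + j"] by (simp add: pre_def)
      have r: "rule Compare [tape_read ti, tape_read tq, tape_read ta, tape_read tb] Compare
          [(tape_read ti, MoveR), (tape_read tq, Stay), (Some Hash, MoveL), (Some Hash, MoveL)]"
        using c 2 t by (simp add: compare_hash)
      have "head_at (tape_act (tape_read ti, MoveR) ti) (length \<eta> + 2 + Suc j)"
        using head_at_right[OF c(2)] \<open>j < n\<close> by (simp add: last_pos_def pre_def)
      then have "compare_cfg (Suc j) x (to_nat Compare, [tape_act (tape_read ti, MoveR) ti,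
          tape_act (tape_read tq, Stay) tq, tape_act (Some Hash, MoveL) ta, tape_act (Some Hash, MoveL) tb])"
        unfolding compare_cfg_def by - (intro exI conjI, rule refl, use c in auto)
      then show ?thesis using tree_machine_step[OF r, of Or] 2 unfolding c(1) by auto
    qed
  qed
  also have "reaches (length x) (compare_cfg ?j x) (compare_cfg (?j + count_list x Hash) [])"
    by (rule Cons.IH) (use Cons.prems in \<open>auto split: if_splits\<close>)
  finally show ?case by (cases "a = Hash") simp_all
qed

lemma finish_run:
  assumes as: "as = r # concat Ds" and Or: "One # word_of_bits r @ Hash # word_of_bits \<eta> \<in> Or" and n: "length as \<le> n"
  shows "reaches (2 * last_pos + length r + length (delimited as) + 10)
    (cfg Main last_pos (qw []) as (concat Ds)) (\<lambda>c. fst c = to_nat Accept)"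
proof -
  let ?bs = "concat Ds"
  have eq: "pre + (last_pos - 1 - pre) = last_pos - 1" by (simp add: last_pos_def)
  have "reaches 1 (cfg Main last_pos (qw []) as ?bs) (cfg SkipTheory (last_pos - 1) (qw []) as ?bs)"
    by (rule reaches_left) (auto simp: last_pos_def intro: finish)
  also have "reaches (last_pos - 1 - pre) (cfg SkipTheory (last_pos - 1) (qw []) as ?bs) (cfg SkipTheory pre (qw []) as ?bs)"
    by (rule reaches_left_many[of SkipTheory pre "last_pos - 1 - pre", OF skip_thy, unfolded eq])
      (assumption, rule X_nth_not_None, (use eq in simp)+)
  also have "reaches 1 (cfg SkipTheory pre (qw []) as ?bs) (cfg SkipBound (pre - 1) (qw []) as ?bs)"
    by (rule reaches_left) (simp add: pre_def, simp add: X_nth_bound(3) skip_thy_end)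
  also have "reaches n (cfg SkipBound (pre - 1) (qw []) as ?bs) (cfg SkipBound (length \<eta> + 1) (qw []) as ?bs)"
    using reaches_left_many[of SkipBound "length \<eta> + 1" n, OF skip_bound] X_nth_bound(2)
    by (simp add: pre_def add.commute)
  also have "reaches 1 (cfg SkipBound (length \<eta> + 1) (qw []) as ?bs) (cfg CopyGoal (length \<eta> + 1 - 1) (qw []) as ?bs)"
    by (rule reaches_left) (auto simp: X_nth_bound(1)[simplified] intro: skip_bound_end)
  also have "reaches (length \<eta>) (cfg CopyGoal (length \<eta> + 1 - 1) (qw []) as ?bs) (cfg CopyGoal 0 (qw (word_of_bits \<eta>)) as ?bs)"
    using copy_goal_run[of "length \<eta>"] by simp
  also have "reaches 1 (cfg CopyGoal 0 (qw (word_of_bits \<eta>)) as ?bs) (cfg RootVertex 1 (qw (Hash # word_of_bits \<eta>)) as ([] # ?bs))"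
  proof (rule reaches_cfg)
    fix ti tq ta tb
    assume *: "head_at ti 0" "qw (word_of_bits \<eta>) tq" "lists ta tb as ?bs"
    have t: "tape_read ti = None" using head_at_read[OF *(1)] X_nth_0 by simp
    have right: "head_at (tape_act (tape_read ti, MoveR) ti) 1" using head_at_right[OF *(1)] by (simp add: last_pos_def)
    show "\<exists>ai aq aa ab. rule CopyGoal [tape_read ti, tape_read tq, tape_read ta, tape_read tb] RootVertex [ai, aq, aa, ab] \<and>
        head_at (tape_act ai ti) 1 \<and> qw (Hash # word_of_bits \<eta>) (tape_act aq tq) \<and>
        lists (tape_act aa ta) (tape_act ab tb) as ([] # ?bs)"
      unfolding t by (intro exI conjI, rule copy_goal_end) (use * right t in \<open>auto simp: qw_def\<close>)
  qed
  also have "reaches (length r) (cfg RootVertex 1 (qw (Hash # word_of_bits \<eta>)) as ([] # ?bs))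
      (cfg RootVertex 1 (qw (word_of_bits r @ Hash # word_of_bits \<eta>)) as (r # ?bs))"
    by (rule push_child) simp
  also have "reaches 1 (cfg RootVertex 1 (qw (word_of_bits r @ Hash # word_of_bits \<eta>)) as (r # ?bs))
      (cfg AskRoot 1 (tw (One # word_of_bits r @ Hash # word_of_bits \<eta>)) as (r # ?bs))"
    by (rule reaches_tag) (rule root_ask)
  also note reaches_ask(2)[OF Or]
  also have "reaches (length \<eta>) (cfg ToBound 1 (\<lambda>_. True) as (r # ?bs)) (cfg ToBound (length \<eta> + 1) (\<lambda>_. True) as (r # ?bs))"
    using reaches_right_many[of ToBound "\<lambda>_. True" "[]" 1 "length \<eta>", OF to_bound] X_nth_goal
    by (simp add: last_pos_def pre_def)
  also have "reaches 1 (cfg ToBound (length \<eta> + 1) (\<lambda>_. True) as (r # ?bs)) (compare_cfg 0 (delimited as))"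
  proof (rule reaches_step)
    fix c assume "cfg ToBound (length \<eta> + 1) (\<lambda>_. True) as (r # ?bs) c"
    then obtain ti tq ta tb where c: "c = (to_nat ToBound, [ti, tq, ta, tb])" "head_at ti (length \<eta> + 1)" "lists ta tb as (r # ?bs)"
      unfolding cfg_def by blast
    have t: "tape_read ti = None" using head_at_read[OF c(2)] X_nth_bound(1) by simp
    have right: "head_at (tape_act (tape_read ti, MoveR) ti) (length \<eta> + 2 + 0)"
      using head_at_right[OF c(2)] by (simp add: last_pos_def pre_def)
    have "rule ToBound [tape_read ti, tape_read tq, tape_read ta, tape_read tb] Compare
        [(tape_read ti, MoveR), (tape_read tq, Stay), (tape_read ta, MoveL), (tape_read tb, MoveL)]"
      using t by (simp add: to_bound_end)
    from tree_machine_step[OF this, of Or] show "\<exists>c'. step tree_machine Or c c' \<and> compare_cfg 0 (delimited as) c'"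
      using c right as unfolding compare_cfg_def lists_def by fastforce
  qed
  also have "reaches (length (delimited as)) (compare_cfg 0 (delimited as)) (compare_cfg (0 + count_list (delimited as) Hash) [])"
    by (rule compare_run) (use n in simp)
  also have "reaches 1 (compare_cfg (0 + count_list (delimited as) Hash) []) (\<lambda>c. fst c = to_nat Accept)"
  proof (rule reaches_step)
    fix c assume "compare_cfg (0 + count_list (delimited as) Hash) [] c"
    then obtain ti tq ta tb where c: "c = (to_nat Compare, [ti, tq, ta, tb])" "tape_read ta = None" "tape_read tb = None"
      unfolding compare_cfg_def by auto
    have "rule Compare [tape_read ti, tape_read tq, tape_read ta, tape_read tb] Accept
        [(tape_read ti, Stay), (tape_read tq, Stay), (None, Stay), (None, Stay)]"
      using c by (simp add: compare_end)
    from tree_machine_step[OF this, of Or] show "\<exists>c'. step tree_machine Or c c' \<and> fst c' = to_nat Accept"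
      using c by fastforce
  qed
  finally show ?thesis by (rule reaches_mono) (simp add: last_pos_def pre_def)
qed

section \<open>The first pass over the input, and the total length of an accepting run\<close>

text \<open>Takes the place of \<open>cfg\<close> as long as separators are being replaced and the
  input tape is not yet \<open>X\<close>.\<close>

definition start_cfg :: "state \<Rightarrow> sym option list \<Rightarrow> sym option list \<Rightarrow> config \<Rightarrow> bool" where
  "start_cfg s l r c \<longleftrightarrow>
     (\<exists>ti tq ta tb. c = (to_nat s, [ti, tq, ta, tb]) \<and> fst ti = l \<and> tape_read ti # rest ti = r \<and>
       qword tq = [] \<and> lists ta tb [] [])"

lemma start_left:
  assumes "\<And>q a b. rule s [i, q, a, b] s' [(j, MoveL), (q, Stay), (a, Stay), (b, Stay)]"
  shows "reaches 1 (start_cfg s l (i # r)) (start_cfg s' (tl l) (first_cell l # j # r))"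
proof (rule reaches_step)
  fix c assume "start_cfg s l (i # r) c"
  then obtain ti tq ta tb where c: "c = (to_nat s, [ti, tq, ta, tb])" "fst ti = l" "tape_read ti = i" "rest ti = r"
    "qword tq = []" "lists ta tb [] []" unfolding start_cfg_def by auto
  have "rule s [tape_read ti, tape_read tq, tape_read ta, tape_read tb] s'
      [(j, MoveL), (tape_read tq, Stay), (tape_read ta, Stay), (tape_read tb, Stay)]"
    using assms c(3) by simp
  then have "step tree_machine Or c (to_nat s', [tape_act (j, MoveL) ti, tape_act (tape_read tq, Stay) tq,
      tape_act (tape_read ta, Stay) ta, tape_act (tape_read tb, Stay) tb])"
    unfolding c(1) by (rule tree_machine_step)
  moreover have "start_cfg s' (tl l) (first_cell l # j # r) (to_nat s', [tape_act (j, MoveL) ti, tape_act (tape_read tq, Stay) tq,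
      tape_act (tape_read ta, Stay) ta, tape_act (tape_read tb, Stay) tb])"
    unfolding start_cfg_def by (intro exI conjI, rule refl) (use c in \<open>auto simp: first_cell_tl\<close>)
  ultimately show "\<exists>c'. step tree_machine Or c c' \<and> start_cfg s' (tl l) (first_cell l # j # r) c'" by blast
qed

lemma start_right:
  assumes "\<And>q a b. rule s [i, q, a, b] s' [(j, MoveR), (q, Stay), (a, Stay), (b, Stay)]" "r \<noteq> []"
  shows "reaches 1 (start_cfg s l (i # r)) (start_cfg s' (j # l) r)"
proof (rule reaches_step)
  fix c assume "start_cfg s l (i # r) c"
  then obtain ti tq ta tb where c: "c = (to_nat s, [ti, tq, ta, tb])" "fst ti = l" "tape_read ti = i" "rest ti = r"
    "qword tq = []" "lists ta tb [] []" unfolding start_cfg_def by auto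
  have "rule s [tape_read ti, tape_read tq, tape_read ta, tape_read tb] s'
      [(j, MoveR), (tape_read tq, Stay), (tape_read ta, Stay), (tape_read tb, Stay)]"
    using assms(1) c(3) by simp
  then have "step tree_machine Or c (to_nat s', [tape_act (j, MoveR) ti, tape_act (tape_read tq, Stay) tq,
      tape_act (tape_read ta, Stay) ta, tape_act (tape_read tb, Stay) tb])"
    unfolding c(1) by (rule tree_machine_step)
  moreover have "start_cfg s' (j # l) r (to_nat s', [tape_act (j, MoveR) ti, tape_act (tape_read tq, Stay) tq,
      tape_act (tape_read ta, Stay) ta, tape_act (tape_read tb, Stay) tb])"
    unfolding start_cfg_def by (intro exI conjI, rule refl) (use c assms(2) in \<open>auto simp: first_cell_tl\<close>)
  ultimately show "\<exists>c'. step tree_machine Or c c' \<and> start_cfg s' (j # l) r c'" by blast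
qed

lemma start_right_many:
  assumes "\<And>x q a b. x \<in> set xs \<Longrightarrow> rule s [x, q, a, b] s [(x, MoveR), (q, Stay), (a, Stay), (b, Stay)]" "r \<noteq> []"
  shows "reaches (length xs) (start_cfg s l (xs @ r)) (start_cfg s (rev xs @ l) r)"
  using assms(1)
proof (induction xs arbitrary: l)
  case (Cons x xs)
  have "reaches 1 (start_cfg s l ((x # xs) @ r)) (start_cfg s (x # l) (xs @ r))"
    using start_right[of s x s x "xs @ r" l] Cons.prems[of x] assms(2) by simp
  also have "reaches (length xs) (start_cfg s (x # l) (xs @ r)) (start_cfg s (rev xs @ x # l) r)"
    using Cons by simp
  finally show ?case by simp
qed (simp add: reaches_refl)

lemma rewind_run:
  "reaches (Suc (length u)) (start_cfg Rewind (map Some u) (Some x # r))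
    (start_cfg Rewind [] (None # map Some (rev u) @ Some x # r))"
proof (induction u arbitrary: x r)
  case Nil
  show ?case using start_left[of Rewind "Some x" Rewind "Some x" "[]" r] by (simp add: rewind)
next
  case (Cons y u)
  have "reaches 1 (start_cfg Rewind (map Some (y # u)) (Some x # r)) (start_cfg Rewind (map Some u) (Some y # Some x # r))"
    using start_left[of Rewind "Some x" Rewind "Some x" "map Some (y # u)" r] by (simp add: rewind)
  also note Cons.IH
  finally show ?case by simp
qed

lemma start_run:
  "reaches (2 * length input + 3) (start_cfg Init (map Some (rev input)) [None]) (cfg Main last_pos (qw []) [] [])"
proof -
  obtain u x where ux: "rev input = x # u" by (cases "rev input") (auto simp: input_def)
  have len: "length input = Suc (length u)" using ux by (metis length_Cons length_rev)
  let ?r3 = "map Some (delimited \<theta>s) @ [None]"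
  let ?r2 = "replicate n (Some One) @ Some Hash # ?r3"
  let ?r1 = "map Some (word_of_bits \<eta>) @ Some Hash # ?r2"
  have r1: "map Some (rev u) @ Some x # [None] = ?r1"
  proof -
    have "input = rev u @ [x]" using ux by (metis rev.simps(2) rev_rev_ident)
    then have "map Some (rev u) @ Some x # [None] = map Some input @ [None]" by simp
    then show ?thesis by (simp add: input_def)
  qed
  have "reaches 1 (start_cfg Init (map Some (rev input)) [None]) (start_cfg Rewind (map Some u) (Some x # [None]))"
    using start_left[of Init None Rewind None "map Some (rev input)" "[]"] by (simp add: ux init)
  also have "reaches (Suc (length u)) (start_cfg Rewind (map Some u) (Some x # [None])) (start_cfg Rewind [] (None # ?r1))"
    using rewind_run[of u x "[None]"] by (simp only: r1)
  also have "reaches 1 (start_cfg Rewind [] (None # ?r1)) (start_cfg InGoal [None] ?r1)"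
    by (rule start_right) (simp_all add: rewind_end)
  also have "reaches (length (map Some (word_of_bits \<eta>))) (start_cfg InGoal [None] ?r1)
      (start_cfg InGoal (rev (map Some (word_of_bits \<eta>)) @ [None]) (Some Hash # ?r2))"
    by (rule start_right_many) (auto simp: word_of_bits_def goal[of True, unfolded bit_sym_def, simplified]
        goal[of False, unfolded bit_sym_def, simplified])
  also have "reaches 1 (start_cfg InGoal (rev (map Some (word_of_bits \<eta>)) @ [None]) (Some Hash # ?r2))
      (start_cfg InBound (None # rev (map Some (word_of_bits \<eta>)) @ [None]) ?r2)"
    by (rule start_right) (simp_all add: goal_end)
  also have "reaches (length (replicate n (Some One))) (start_cfg InBound (None # rev (map Some (word_of_bits \<eta>)) @ [None]) ?r2)
      (start_cfg InBound (rev (replicate n (Some One)) @ None # rev (map Some (word_of_bits \<eta>)) @ [None]) (Some Hash # ?r3))"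
    by (rule start_right_many) (auto simp: bound)
  also have "reaches 1 (start_cfg InBound (rev (replicate n (Some One)) @ None # rev (map Some (word_of_bits \<eta>)) @ [None]) (Some Hash # ?r3))
      (start_cfg InTheory (None # rev (replicate n (Some One)) @ None # rev (map Some (word_of_bits \<eta>)) @ [None]) ?r3)"
    by (rule start_right) (simp_all add: bound_end)
  also have "reaches (length (map Some (delimited \<theta>s)))
      (start_cfg InTheory (None # rev (replicate n (Some One)) @ None # rev (map Some (word_of_bits \<eta>)) @ [None]) ?r3)
      (start_cfg InTheory (rev (map Some (delimited \<theta>s)) @ None # rev (replicate n (Some One)) @ None #
        rev (map Some (word_of_bits \<eta>)) @ [None]) [None])"
    by (rule start_right_many) (auto simp: thy)
  also have "reaches 1 (start_cfg InTheory (rev (map Some (delimited \<theta>s)) @ None # rev (replicate n (Some One)) @ None #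
        rev (map Some (word_of_bits \<eta>)) @ [None]) [None]) (cfg Main last_pos (qw []) [] [])"
  proof (rule reaches_step)
    fix c assume "start_cfg InTheory (rev (map Some (delimited \<theta>s)) @ None # rev (replicate n (Some One)) @ None #
        rev (map Some (word_of_bits \<eta>)) @ [None]) [None] c"
    then obtain ti tq ta tb where c: "c = (to_nat InTheory, [ti, tq, ta, tb])"
      "fst ti = rev (map Some (delimited \<theta>s)) @ None # rev (replicate n (Some One)) @ None # rev (map Some (word_of_bits \<eta>)) @ [None]"
      "tape_read ti = None" "rest ti = []" "qword tq = []" "lists ta tb [] []" unfolding start_cfg_def by auto
    have "head_at ti last_pos"
      using c by (simp add: head_at_def X_def last_pos_def pre_def)
    from head_at_stay[OF this] have "cfg Main last_pos (qw []) [] [] (to_nat Main, [tape_act (tape_read ti, Stay) ti,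
        tape_act (tape_read tq, Stay) tq, tape_act (tape_read ta, Stay) ta, tape_act (tape_read tb, Stay) tb])"
      unfolding cfg_def by - (intro exI conjI, rule refl, use c in \<open>auto simp: qw_def\<close>)
    moreover have "step tree_machine Or c (to_nat Main, [tape_act (tape_read ti, Stay) ti,
        tape_act (tape_read tq, Stay) tq, tape_act (tape_read ta, Stay) ta, tape_act (tape_read tb, Stay) tb])"
      unfolding c(1) by (rule tree_machine_step) (simp add: c(3) thy_end)
    ultimately show "\<exists>c'. step tree_machine Or c c' \<and> cfg Main last_pos (qw []) [] [] c'" by blast
  qed
  finally show ?thesis by (rule reaches_mono) (simp add: len[symmetric], simp add: input_def)
qed

lemma tree_machine_complete:
  assumes cert: "bit_certificate Or \<eta> (set \<theta>s) as Ds" and n: "length as \<le> n"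
    and B: "\<And>v. v \<in> set as \<Longrightarrow> length v \<le> B"
  shows "\<exists>k tps. k \<le> length input * (2 * length input + 3 * B + 20) + B + 25 \<and>
    (step tree_machine Or ^^ k) (late_initial tree_machine input) (accept_state tree_machine, tps)"
proof -
  obtain r where r: "as = r # concat Ds" "One # word_of_bits r @ Hash # word_of_bits \<eta> \<in> Or"
    and nodes: "list_all2 node as Ds"
    using cert unfolding bit_certificate_def by blast
  have "reaches (2 * length input + 3) (start_cfg Init (map Some (rev input)) [None]) (cfg Main last_pos (qw []) [] [])"
    by (rule start_run)
  also note main_run[OF nodes]
  also note finish_run[OF r n]
  finally have run: "reaches (2 * length input + 3 + (length as * (2 * last_pos + 7) + length (delimited as) +
      length (delimited (concat Ds))) + (2 * last_pos + length r + length (delimited as) + 10))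
      (start_cfg Init (map Some (rev input)) [None]) (\<lambda>c. fst c = to_nat Accept)" .
  have delim: "length (delimited vs) \<le> length vs * Suc B" if "\<And>v. v \<in> set vs \<Longrightarrow> length v \<le> B" for vs
    using that
  proof (induction vs)
    case (Cons v vs)
    then have "length (delimited vs) \<le> length vs * Suc B" "length v \<le> B" by auto
    then show ?case by simp
  qed simp
  define N where "N = length input"
  \<comment> \<open>Here the unary coding matters: the input is at least as long as the bound
    \<open>n\<close> on the number of vertices.\<close>
  have N: "length as \<le> N" "last_pos = N + 1"
    using n by (simp_all add: N_def input_def last_pos_def pre_def)
  have "length (delimited as) \<le> length as * Suc B" by (rule delim) (rule B)
  also have "\<dots> \<le> N * Suc B" using N(1) by (rule mult_le_mono1)
  finally have 1: "length (delimited as) \<le> N * Suc B" .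
  have "length (delimited (concat Ds)) \<le> length (delimited as)" using r(1) by simp
  moreover have "length as * (2 * last_pos + 7) \<le> N * (2 * last_pos + 7)" using N(1) by (rule mult_le_mono1)
  moreover have "length r \<le> B" using B r(1) by simp
  \<comment> \<open>The three summands \<open>N * Suc B\<close> stand for writing the vertices,
    writing the children and comparing the two tapes.\<close>
  ultimately have "2 * N + 3 + (length as * (2 * last_pos + 7) + length (delimited as) +
      length (delimited (concat Ds))) + (2 * last_pos + length r + length (delimited as) + 10)
      \<le> 2 * N + 3 + (N * (2 * last_pos + 7) + N * Suc B + N * Suc B) + (2 * last_pos + B + N * Suc B + 10)"
    using 1 by linarith
  also have "\<dots> \<le> N * (2 * N + 3 * B + 20) + B + 25"
    by (simp add: N(2) algebra_simps)
  finally have bound: "2 * N + 3 + (length as * (2 * last_pos + 7) + length (delimited as) +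
      length (delimited (concat Ds))) + (2 * last_pos + length r + length (delimited as) + 10)
      \<le> N * (2 * N + 3 * B + 20) + B + 25" .
  have "start_cfg Init (map Some (rev input)) [None] (late_initial tree_machine input)"
    unfolding start_cfg_def late_initial_tree_machine
    by (intro exI conjI, rule refl) (simp_all add: tape_read_def rest_def qword_def lists_def)
  then obtain k c where k: "k \<le> N * (2 * N + 3 * B + 20) + B + 25"
    "(step tree_machine Or ^^ k) (late_initial tree_machine input) c" "fst c = to_nat Accept"
    using run bound unfolding reaches_def N_def by (meson le_trans)
  then have "c = (accept_state tree_machine, snd c)" by (metis prod.collapse tree_machine_simps(3))
  then show ?thesis using k unfolding N_def by metis
qed

end


section \<open>Decoding the oracle and the complexity bound\<close>

lemma binary_0 [simp]: "binary 0 = []"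
  by (simp add: binary.simps)

lemma binary_pos: "0 < n \<Longrightarrow> binary n = binary (n div 2) @ [odd n]"
  by (subst binary.simps) simp

lemma binary_inj: "binary i = binary j \<Longrightarrow> i = j"
proof (induction i arbitrary: j rule: less_induct)
  case (less i)
  show ?case
  proof (cases "i = 0 \<or> j = 0")
    case True
    then show ?thesis using less.prems binary_pos[of i] binary_pos[of j] by (cases "i = 0"; cases "j = 0") auto
  next
    case False
    then have "binary (i div 2) = binary (j div 2)" "odd i = odd j"
      using less.prems binary_pos[of i] binary_pos[of j] by auto
    moreover from this(1) have "i div 2 = j div 2" using less.IH False by simp
    ultimately show ?thesis by (metis bit_eq_rec even_iff_mod_2_eq_zero div_mult_mod_eq odd_iff_mod_2_eq_one)
  qed
qed

lemma inj_binary: "inj binary"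
  by (rule injI) (rule binary_inj)

lemma length_binary: "i < 2 ^ k \<Longrightarrow> length (binary i) \<le> k"
proof (induction k arbitrary: i)
  case (Suc k)
  show ?case
  proof (cases "i = 0")
    case False
    then have "length (binary (i div 2)) \<le> k" using Suc by simp
    then show ?thesis using False by (simp add: binary_pos)
  qed simp
qed simp

lemma delimited_binary: "concat (map index_word is) = delimited (map binary is)"
  by (induction "is") (simp_all add: index_word_def)

lemma is_deriverD:
  assumes "is_deriver L D"
  shows "conclusions D \<subseteq> sentences L"
    and "is_theory L T \<Longrightarrow> \<eta> \<in> conclusions D \<Longrightarrow> derivation_structure L T (structure_of D T \<eta>)"
proof -
  have *: "conclusions D \<subseteq> sentences L \<and>
     (\<forall>T \<eta>. is_theory L T \<longrightarrow> \<eta> \<in> conclusions D \<longrightarrow>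
        derivation_structure L T (structure_of D T \<eta>) \<and>
        (entails L T \<eta> \<longleftrightarrow>
          (\<exists>P. subhypergraph P (structure_of D T \<eta>) \<and> is_proof L T \<eta> P)))"
    using assms unfolding is_deriver_def .
  then show "conclusions D \<subseteq> sentences L" by (rule conjunct1)
  assume "is_theory L T" "\<eta> \<in> conclusions D"
  then show "derivation_structure L T (structure_of D T \<eta>)"
    by (rule conjunct1[OF conjunct2[OF *, rule_format]])
qed
lemma vertex_numberingD:
  assumes "vertex_numbering L D num" "is_theory L T" "\<eta> \<in> conclusions D"
  shows "set (num T \<eta>) = verts (structure_of D T \<eta>)"
  by (rule conjunct2[OF conjunct1[OF assms(1)[unfolded vertex_numbering_def], rule_format, OF assms(2,3)]])

section \<open>Certificates of an instance and breadth-first proofs\<close>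

locale mtp_instance =
  fixes L :: "('a, 'm) logic" and D :: "('v, 'a) deriver" and code :: "'a \<Rightarrow> bool list"
    and num :: "'a set \<Rightarrow> 'a \<Rightarrow> 'v list" and T :: "'a set" and \<eta> :: 'a and n :: nat
  assumes deriver: "is_deriver L D" and coding: "sentence_coding L code" and numbering: "vertex_numbering L D num"
    and inst: "(T, \<eta>, n) \<in> MTP_instances L D"
begin

abbreviation (input) "G \<equiv> structure_of D T \<eta>"
abbreviation (input) "vs \<equiv> num T \<eta>"
abbreviation (input) "Or \<equiv> MTP_oracle L D code num (T, \<eta>, n)"

text \<open>Indices in queries start at 1, whereas list positions start at 0. The value on words
  that are not numerals of vertices is irrelevant, since the oracle confirms no query about
  them.\<close>

definition decode :: "bool list \<Rightarrow> 'v" where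
  "decode v = vs ! (inv binary v - 1)"

definition encode :: "'v \<Rightarrow> bool list" where
  "encode x = binary (SOME i. i \<in> {1..length vs} \<and> vs ! (i - 1) = x)"

lemma theory_T: "is_theory L T" and \<eta>_concl: "\<eta> \<in> conclusions D"
  using inst by (auto simp: MTP_instances_def)

lemma G: "derivation_structure L T G"
  using is_deriverD(2)[OF deriver] theory_T \<eta>_concl by blast

lemma T_sub: "T \<subseteq> sentences L"
  using theory_T by (simp add: is_theory_def)

lemma \<eta>_sentence: "\<eta> \<in> sentences L"
  using is_deriverD(1)[OF deriver] \<eta>_concl by blast

lemma set_vs: "set vs = verts G"
  by (rule vertex_numberingD[OF numbering theory_T \<eta>_concl])

lemma decode_binary [simp]: "decode (binary i) = vs ! (i - 1)"
  by (simp add: decode_def inj_binary)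

lemma decode_in: "i \<in> {1..length vs} \<Longrightarrow> decode (binary i) \<in> verts G"
proof -
  assume "i \<in> {1..length vs}"
  then have "i - 1 < length vs" by auto
  then have "vs ! (i - 1) \<in> set vs" by (rule nth_mem)
  then show ?thesis by (simp only: decode_binary set_vs)
qed

lemma encode: "x \<in> verts G \<Longrightarrow> \<exists>i\<in>{1..length vs}. encode x = binary i \<and> vs ! (i - 1) = x"
proof -
  assume "x \<in> verts G"
  then obtain k where k: "k < length vs" "vs ! k = x" using set_vs by (metis in_set_conv_nth)
  then have "Suc k \<in> {1..length vs} \<and> vs ! (Suc k - 1) = x" by auto
  then have "(SOME i. i \<in> {1..length vs} \<and> vs ! (i - 1) = x) \<in> {1..length vs} \<and>
      vs ! ((SOME i. i \<in> {1..length vs} \<and> vs ! (i - 1) = x) - 1) = x" by (rule someI)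
  then show ?thesis unfolding encode_def by blast
qed

text \<open>The tag rules out label queries, and injectivity of \<open>delimited\<close> and of
  lists recovers the individual words.\<close>

lemma edge_oracle:
  "Zero # delimited (C @ [v]) \<in> Or \<longleftrightarrow>
    (\<exists>is j. C = map binary is \<and> v = binary j \<and> set is \<subseteq> {1..length vs} \<and> j \<in> {1..length vs} \<and>
      (decode ` set C, decode v) \<in> hedges G)"
proof
  assume "Zero # delimited (C @ [v]) \<in> Or"
  then obtain "is" j where ij: "delimited (C @ [v]) = delimited (map binary (is @ [j]))"
    "set is \<subseteq> {1..length vs}" "j \<in> {1..length vs}" "((\<lambda>i. vs ! (i - 1)) ` set is, vs ! (j - 1)) \<in> hedges G"
    unfolding MTP_oracle_def edge_queries_def label_queries_def delimited_binary by auto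
  then have "C @ [v] = map binary (is @ [j])" using delimited_inj by blast
  then have "C = map binary is" "v = binary j" by simp_all
  then show "\<exists>is j. C = map binary is \<and> v = binary j \<and> set is \<subseteq> {1..length vs} \<and> j \<in> {1..length vs} \<and>
      (decode ` set C, decode v) \<in> hedges G"
    using ij by (intro exI[of _ "is"] exI[of _ j]) (simp add: image_image)
next
  assume "\<exists>is j. C = map binary is \<and> v = binary j \<and> set is \<subseteq> {1..length vs} \<and> j \<in> {1..length vs} \<and>
      (decode ` set C, decode v) \<in> hedges G"
  then obtain "is" j where ij: "C = map binary is" "v = binary j" "set is \<subseteq> {1..length vs}" "j \<in> {1..length vs}"
      "((\<lambda>i. vs ! (i - 1)) ` set is, vs ! (j - 1)) \<in> hedges G" by (auto simp: image_image)
  then have "Zero # concat (map index_word (is @ [j])) \<in> edge_queries G vs"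
    unfolding edge_queries_def by blast
  then show "Zero # delimited (C @ [v]) \<in> Or"
    unfolding MTP_oracle_def delimited_binary using ij(1,2) by simp
qed

text \<open>The first separator ends the index, and \<open>code\<close> is injective on sentences,
  so the query determines both its vertex index and its sentence.\<close>

lemma label_oracle:
  assumes "\<alpha> \<in> sentences L"
  shows "One # word_of_bits v @ Hash # word_of_bits (code \<alpha>) \<in> Or \<longleftrightarrow>
    (\<exists>i\<in>{1..length vs}. v = binary i \<and> label G (decode v) = \<alpha>)"
proof
  assume "One # word_of_bits v @ Hash # word_of_bits (code \<alpha>) \<in> Or"
  then obtain i \<beta> where i: "word_of_bits v @ Hash # word_of_bits (code \<alpha>) =
      word_of_bits (binary i) @ Hash # word_of_bits (code \<beta>)"
    "i \<in> {1..length vs}" "\<beta> \<in> sentences L" "label G (vs ! (i - 1)) = \<beta>"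
    unfolding MTP_oracle_def edge_queries_def label_queries_def index_word_def by auto
  then have "v = binary i" "code \<alpha> = code \<beta>"
    using word_of_bits_split word_of_bits_inj by blast+
  moreover from this have "\<alpha> = \<beta>"
    using coding assms i(3) by (auto simp: sentence_coding_def dest: inj_onD)
  ultimately show "\<exists>i\<in>{1..length vs}. v = binary i \<and> label G (decode v) = \<alpha>" using i by auto
next
  assume "\<exists>i\<in>{1..length vs}. v = binary i \<and> label G (decode v) = \<alpha>"
  then obtain i where "i \<in> {1..length vs}" "v = binary i" "label G (vs ! (i - 1)) = \<alpha>" by auto
  then show "One # word_of_bits v @ Hash # word_of_bits (code \<alpha>) \<in> Or"
    using assms unfolding MTP_oracle_def label_queries_def index_word_def by auto
qed

text \<open>A positive answer implies that the words in the query are numerals of vertices, so the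
  guesses need no check of their own. Every vertex of the list is the subject of such a
  query.\<close>

lemma bfs_proof_of_bit_certificate:
  assumes cert: "bit_certificate Or (code \<eta>) (code ` T) as Ds"
  shows "bfs_proof G T \<eta> (map decode as) (map (map decode) Ds)"
proof -
  obtain r where r: "as = r # concat Ds" "One # word_of_bits r @ Hash # word_of_bits (code \<eta>) \<in> Or"
    and nodes: "list_all2 (\<lambda>v C. C = [] \<and> (\<exists>\<alpha>\<in>code ` T. One # word_of_bits v @ Hash # word_of_bits \<alpha> \<in> Or) \<or>
       Zero # delimited (C @ [v]) \<in> Or) as Ds"
    using cert unfolding bit_certificate_def by blast
  have node: "decode v \<in> verts G \<and>
      (C = [] \<and> label G (decode v) \<in> T \<or> (decode ` set C, decode v) \<in> hedges G)"
    if "C = [] \<and> (\<exists>\<alpha>\<in>code ` T. One # word_of_bits v @ Hash # word_of_bits \<alpha> \<in> Or) \<or>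
       Zero # delimited (C @ [v]) \<in> Or" for v C
    using that
  proof
    assume "C = [] \<and> (\<exists>\<alpha>\<in>code ` T. One # word_of_bits v @ Hash # word_of_bits \<alpha> \<in> Or)"
    then obtain \<alpha> where \<alpha>: "C = []" "\<alpha> \<in> T" "One # word_of_bits v @ Hash # word_of_bits (code \<alpha>) \<in> Or" by auto
    then obtain i where "i \<in> {1..length vs}" "v = binary i" "label G (decode v) = \<alpha>"
      using label_oracle[of \<alpha> v] T_sub by blast
    then show ?thesis using \<alpha> decode_in by blast
  next
    assume "Zero # delimited (C @ [v]) \<in> Or"
    then show ?thesis using edge_oracle[of C v] decode_in by blast
  qed
  have "label G (decode r) = \<eta>" using r(2) label_oracle[OF \<eta>_sentence] by blast
  moreover have "set (map decode as) \<subseteq> verts G"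
    using nodes node unfolding list_all2_conv_all_nth by (fastforce simp: in_set_conv_nth)
  moreover have "list_all2 (\<lambda>v C. C = [] \<and> label G v \<in> T \<or> (set C, v) \<in> hedges G)
      (map decode as) (map (map decode) Ds)"
    unfolding list.rel_map
  proof (rule list_all2_all_nthI[OF list_all2_lengthD[OF nodes]])
    fix i assume "i < length as"
    from node[OF list_all2_nthD[OF nodes this]]
    show "map decode (Ds ! i) = [] \<and> label G (decode (as ! i)) \<in> T \<or>
        (set (map decode (Ds ! i)), decode (as ! i)) \<in> hedges G" by auto
  qed
  ultimately show ?thesis using r(1) unfolding bfs_proof_def by (auto simp: map_concat)
qed

lemma bit_certificate_of_bfs_proof:
  assumes bfs: "bfs_proof G T \<eta> as Ds"
  shows "bit_certificate Or (code \<eta>) (code ` T) (map encode as) (map (map encode) Ds)"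
proof -
  obtain r where r: "as = r # concat Ds" "label G r = \<eta>" and verts: "set as \<subseteq> verts G"
    and nodes: "list_all2 (\<lambda>v C. C = [] \<and> label G v \<in> T \<or> (set C, v) \<in> hedges G) as Ds"
    using bfs unfolding bfs_proof_def by blast
  have dec: "decode (encode x) = x" if "x \<in> verts G" for x
    using encode[OF that] by auto
  have lab: "One # word_of_bits (encode x) @ Hash # word_of_bits (code (label G x)) \<in> Or"
    if "x \<in> verts G" "label G x \<in> sentences L" for x
    using label_oracle[OF that(2), of "encode x"] encode[OF that(1)] dec[OF that(1)] by auto
  have edge: "Zero # delimited (map encode C @ [encode x]) \<in> Or"
    if "x \<in> verts G" "set C \<subseteq> verts G" "(set C, x) \<in> hedges G" for x C
  proof -
    have "\<exists>is. map encode C = map binary is \<and> set is \<subseteq> {1..length vs}" using that(2)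
    proof (induction C)
      case (Cons y C)
      then obtain "is" where "map encode C = map binary is" "set is \<subseteq> {1..length vs}" by auto
      moreover obtain i where "i \<in> {1..length vs}" "encode y = binary i" using encode[of y] Cons.prems by auto
      ultimately show ?case by (intro exI[of _ "i # is"]) simp
    qed simp
    moreover have "decode ` set (map encode C) = set C"
      using dec that(2) by (force simp: image_image)
    ultimately show ?thesis
      using edge_oracle[of "map encode C" "encode x"] encode[OF that(1)] dec[OF that(1)] that(3) by metis
  qed
  have len: "length as = length Ds" using nodes by (rule list_all2_lengthD)
  have "list_all2 (\<lambda>v C. C = [] \<and> (\<exists>\<alpha>\<in>code ` T. One # word_of_bits v @ Hash # word_of_bits \<alpha> \<in> Or) \<or>
       Zero # delimited (C @ [v]) \<in> Or) (map encode as) (map (map encode) Ds)"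
    unfolding list.rel_map
  proof (rule list_all2_all_nthI[OF len])
    fix i assume i: "i < length as"
    have x: "as ! i \<in> verts G" using verts i by auto
    \<comment> \<open>By the list equation, children occur in \<open>as\<close> themselves and are
      thus vertices of the derivation structure.\<close>
    have "Ds ! i \<in> set Ds" using i len by simp
    then have "set (Ds ! i) \<subseteq> set (concat Ds)" by auto
    then have C: "set (Ds ! i) \<subseteq> verts G" using verts r(1) by auto
    from list_all2_nthD[OF nodes i]
    show "map encode (Ds ! i) = [] \<and>
        (\<exists>\<alpha>\<in>code ` T. One # word_of_bits (encode (as ! i)) @ Hash # word_of_bits \<alpha> \<in> Or) \<or>
        Zero # delimited (map encode (Ds ! i) @ [encode (as ! i)]) \<in> Or"
      using lab[OF x] edge[OF x C] T_sub by blast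
  qed
  moreover have "One # word_of_bits (encode r) @ Hash # word_of_bits (code \<eta>) \<in> Or"
    using lab[of r] r verts \<eta>_sentence by simp
  moreover have "map encode as = encode r # concat (map (map encode) Ds)"
    using r(1) by (simp add: map_concat)
  ultimately show ?thesis
    unfolding bit_certificate_def by - (intro conjI exI[of _ "encode r"], assumption+)
qed

lemma yes_iff:
  "(T, \<eta>, n) \<in> MTP_yes L D \<longleftrightarrow> (\<exists>as Ds. bfs_proof G T \<eta> as Ds \<and> length as \<le> n)"
proof
  assume "(T, \<eta>, n) \<in> MTP_yes L D"
  then obtain P :: "(nat, 'a) hypergraph" and h where "is_tree_proof L T \<eta> P" "homomorphism h P G" "ct P \<le> n"
    by (auto simp: MTP_yes_def admissible_def)
  then show "\<exists>as Ds. bfs_proof G T \<eta> as Ds \<and> length as \<le> n"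
    using bfs_proof_of_tree_proof le_trans by metis
next
  assume "\<exists>as Ds. bfs_proof G T \<eta> as Ds \<and> length as \<le> n"
  then obtain as Ds where "bfs_proof G T \<eta> as Ds" "length as \<le> n" by blast
  then obtain P :: "(nat, 'a) hypergraph" and h where "is_tree_proof L T \<eta> P" "homomorphism h P G" "ct P \<le> n"
    using tree_proof_of_bfs_proof[OF G] le_trans by metis
  then show "(T, \<eta>, n) \<in> MTP_yes L D"
    by (auto simp: MTP_yes_def admissible_def)
qed

text \<open>\<open>Suc k\<close> and not \<open>k\<close>: the largest index may be
  \<open>2 ^ k\<close> itself, which has one more bit.\<close>

lemma length_encode:
  assumes "length vs \<le> 2 ^ k" "x \<in> verts G"
  shows "length (encode x) \<le> Suc k"
proof -
  obtain i where "i \<in> {1..length vs}" "encode x = binary i" using encode[OF assms(2)] by blast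
  moreover from this have "i < 2 ^ Suc k" using assms(1) by auto
  ultimately show ?thesis using length_binary by metis
qed

end

section \<open>Choice of the number of clock digits\<close>

lemma nat_poly_mono: "x \<le> y \<Longrightarrow> poly p x \<le> poly p y" for p :: "nat poly"
  by (induction p) (auto intro: add_mono mult_mono)

text \<open>Turns a polynomial number of steps into a number of digits. At 0 the power is 1 for
  every \<open>d\<close>, whence the condition on \<open>x\<close>; inputs contain separators and
  are never empty.\<close>

lemma nat_poly_less_power: "\<exists>d. \<forall>x\<ge>1. poly p x < (x + 1) ^ d" for p :: "nat poly"
proof (induction p)
  case 0
  show ?case by (intro exI[of _ 0]) simp
next
  case (pCons a p)
  then obtain d where d: "\<And>x. 1 \<le> x \<Longrightarrow> poly p x < (x + 1) ^ d" by blast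
  \<comment> \<open>The exponent \<open>a\<close> suffices for the constant coefficient, because
    \<open>a < 2 ^ a\<close>, and \<open>Suc d\<close> suffices for the rest. The sum of the two
    costs a factor 2, which one more power of \<open>x + 1\<close> absorbs.\<close>
  define e where "e = max a (Suc d)"
  have "poly (pCons a p) x < (x + 1) ^ Suc e" if x: "1 \<le> x" for x
  proof -
    have "a < 2 ^ a" by (rule less_exp)
    also have "\<dots> \<le> (x + 1) ^ a" using x by (intro power_mono) auto
    also have "\<dots> \<le> (x + 1) ^ e" by (intro power_increasing) (auto simp: e_def)
    finally have 1: "a < (x + 1) ^ e" .
    have "x * poly p x \<le> (x + 1) * (x + 1) ^ d" using d[OF x] by (intro mult_mono) auto
    also have "\<dots> = (x + 1) ^ Suc d" by simp
    also have "\<dots> \<le> (x + 1) ^ e" by (intro power_increasing) (auto simp: e_def)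
    finally have "poly (pCons a p) x < 2 * (x + 1) ^ e" using 1 by simp
    also have "\<dots> \<le> (x + 1) * (x + 1) ^ e" using x by (intro mult_mono) auto
    finally show ?thesis by simp
  qed
  then show ?case by blast
qed

lemma length_le_delimited: "length vs \<le> length (delimited vs)"
  by (induction vs) auto

lemma length_in_delimited: "v \<in> set vs \<Longrightarrow> length v \<le> length (delimited vs)"
  by (induction vs) auto

text \<open>Sizes have to be bounded through the length of the input, the only quantity available to
  the clock. The factor \<open>[:1, 1:]\<close> accounts for at most as many sentences as the input
  has symbols, and one more for the conclusion.\<close>

lemma instance_size:
  assumes p: "\<And>\<alpha>. \<alpha> \<in> sentences L \<Longrightarrow> sent_size L \<alpha> \<le> poly p (length (code \<alpha>))"
    and ts: "set ts \<subseteq> sentences L" "\<eta> \<in> sentences L"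
  shows "theory_size L (set ts) + sent_size L \<eta> \<le>
    poly ([:1, 1:] * p) (length (tree_input.input (code \<eta>) n (map code ts)))"
proof -
  define N where "N = length (tree_input.input (code \<eta>) n (map code ts))"
  have N: "length (code \<eta>) \<le> N" "length (delimited (map code ts)) \<le> N"
    by (simp_all add: N_def tree_input.input_def)
  have "sent_size L \<alpha> \<le> poly p N" if "\<alpha> \<in> set ts" for \<alpha>
  proof -
    have "length (code \<alpha>) \<le> N"
      using length_in_delimited[of "code \<alpha>" "map code ts"] that N(2) by simp
    then show ?thesis using p[of \<alpha>] ts that nat_poly_mono le_trans by (metis subsetD)
  qed
  then have "theory_size L (set ts) \<le> card (set ts) * poly p N"
    unfolding theory_size_def using sum_bounded_above[of "set ts" "sent_size L" "poly p N"] by simp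
  also have "card (set ts) \<le> N"
    using card_length[of ts] length_le_delimited[of "map code ts"] N(2) by simp
  finally have "theory_size L (set ts) \<le> N * poly p N" by simp
  moreover have "sent_size L \<eta> \<le> poly p N"
    using p[OF ts(2)] nat_poly_mono[OF N(1)] le_trans by blast
  ultimately show ?thesis unfolding N_def[symmetric] by simp
qed

theorem theorem19:
  fixes L :: "('a, 'm) logic"
    and D :: "('v, 'a) deriver"
    and code :: "'a \<Rightarrow> bool list"
    and num :: "'a set \<Rightarrow> 'a \<Rightarrow> 'v list"
  assumes "exponential_deriver L D"
    and "sentence_coding L code"
    and "vertex_numbering L D num"
  shows "in_NP (MTP_instances L D) (MTP_yes L D) (instance_codes code) (MTP_oracle L D code num)"
proof -
  have deriver: "is_deriver L D" using assms(1) by (simp add: exponential_deriver_def)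
  obtain p where p: "\<And>\<alpha>. \<alpha> \<in> sentences L \<Longrightarrow> sent_size L \<alpha> \<le> poly p (length (code \<alpha>))"
    using assms(2) by (auto simp: sentence_coding_def)
  obtain q where q: "\<And>T \<eta>. is_theory L T \<Longrightarrow> \<eta> \<in> conclusions D \<Longrightarrow>
      length (num T \<eta>) \<le> 2 ^ poly q (theory_size L T + sent_size L \<eta>)"
    using assms(3) unfolding vertex_numbering_def by blast
  \<comment> \<open>Bounds the bits of a vertex index in terms of the length of the input:
    \<open>q\<close> is applied to the bound of \<open>instance_size\<close>, and the 1 comes from
    \<open>length_encode\<close>.\<close>
  define b where "b = pcompose q ([:1, 1:] * p) + 1"
  \<comment> \<open>The step bound of \<open>tree_machine_complete\<close> as a polynomial, with
    \<open>b\<close> for \<open>B\<close>.\<close>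
  define t where "t = [:0, 1:] * ([:20, 2:] + 3 * b) + b + [:25:]"
  obtain d where d: "\<And>x. 1 \<le> x \<Longrightarrow> poly t x < (x + 1) ^ d" using nat_poly_less_power[of t] by blast
  have "accepts (clocked d tree_machine) (MTP_oracle L D code num i) w \<longleftrightarrow> i \<in> MTP_yes L D"
    if i: "i \<in> MTP_instances L D" and w: "w \<in> instance_codes code i" for i w
  proof -
    obtain T \<eta> n where i_eq: "i = (T, \<eta>, n)" by (cases i)
    note inst = i[unfolded i_eq]
    interpret mtp_instance L D code num T \<eta> n
      by unfold_locales (fact deriver assms(2,3) inst)+
    obtain ts where ts: "set ts = T" and "w = tree_input.input (code \<eta>) n (map code ts)"
      using w by (auto simp: i_eq instance_codes_def tree_input.input_def delimited_def comp_def)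
    note w = this(2)
    interpret tree_input "MTP_oracle L D code num i" "code \<eta>" n "map code ts" .
    show ?thesis
    proof
      assume "accepts (clocked d tree_machine) (MTP_oracle L D code num i) w"
      from clocked_accepts_only[OF tree_machine_is_machine tree_machine_no_chained_queries this]
      obtain as Ds where "bit_certificate (MTP_oracle L D code num i) (code \<eta>) (set (map code ts)) as Ds" "length as \<le> n"
        using tree_machine_sound unfolding w by blast
      then show "i \<in> MTP_yes L D"
        using bfs_proof_of_bit_certificate[of as Ds] yes_iff ts by (metis i_eq length_map set_map)
    next
      assume "i \<in> MTP_yes L D"
      then obtain as Ds where bfs: "bfs_proof (structure_of D T \<eta>) T \<eta> as Ds" "length as \<le> n"
        using yes_iff by (auto simp: i_eq)
      let ?as = "map (encode) as"
      have cert: "bit_certificate (MTP_oracle L D code num i) (code \<eta>) (set (map code ts)) ?as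
          (map (map (encode)) Ds)"
        using bit_certificate_of_bfs_proof[OF bfs(1)] ts by (simp add: i_eq)
      define B where "B = poly b (length w)"
      have "theory_size L T + sent_size L \<eta> \<le> poly ([:1, 1:] * p) (length w)"
        using instance_size[where ts = ts and \<eta> = \<eta> and code = code and n = n, OF p] T_sub \<eta>_sentence ts w by simp
      then have "poly q (theory_size L T + sent_size L \<eta>) \<le> poly q (poly ([:1, 1:] * p) (length w))"
        by (rule nat_poly_mono)
      also have "Suc \<dots> = B" by (simp add: B_def b_def poly_pcompose)
      finally have len: "Suc (poly q (theory_size L T + sent_size L \<eta>)) \<le> B" by simp
      have "length v \<le> B" if v: "v \<in> set ?as" for v
      proof -
        obtain x where "x \<in> verts (structure_of D T \<eta>)" "v = encode x"
          using v bfs(1) by (auto simp: bfs_proof_def)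
        then show ?thesis using length_encode[OF q[OF theory_T \<eta>_concl]] len by fastforce
      qed
      from tree_machine_complete[OF cert _ this] obtain k tps where
        k: "k \<le> length w * (2 * length w + 3 * B + 20) + B + 25" and
        run: "(step tree_machine (MTP_oracle L D code num i) ^^ k) (late_initial tree_machine w) (accept_state tree_machine, tps)"
        using bfs(2) unfolding w by auto
      have "length w * (2 * length w + 3 * B + 20) + B + 25 = poly t (length w)"
        by (simp add: t_def B_def algebra_simps)
      also have "\<dots> < (length w + 1) ^ d" by (rule d) (simp add: w input_def)
      finally have "k < Suc (length w) ^ d" using k by simp
      then show "accepts (clocked d tree_machine) (MTP_oracle L D code num i) w"
        by (rule clocked_accepts[OF tree_machine_is_machine run])
    qed
  qed
  then show ?thesis
    unfolding in_NP_def
    using clocked_is_machine[OF tree_machine_is_machine]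
      clocked_polynomial_time[OF tree_machine_is_machine tree_machine_no_chained_queries] by blast
qed

end
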